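(* Let $K$ be a field, $S=K[x_1,\ldots,x_n]$, and let $\Delta$ be a pure simplicial forest on the vertex set $[n]=\{1,\ldots,n\}$ with the property that each of its connected components $\Delta_1,\ldots,\Delta_k$ is connected in codimension one. Then the following conditions are equivalent: (a) the depth function of $I(\Delta)$ is constant; (b) for all $i$, $I(\Delta_i)$ is a product of monomial prime ideals such that at most one of the factors is not principal; (c) $I(\Delta)$ belongs to the class $\mathcal{C}$ (defined in the context).
   Context: For a simplicial complex $\Delta$ on $[n]$, $\mathcal{F}(\Delta)$ denotes its set of facets, and the facet ideal $I(\Delta)\subset S$ is the ideal generated by the monomials $x_F=\prod_{i\in F}x_i$, $F\in\mathcal{F}(\Delta)$. $\Delta$ is pure if all its facets have the same dimension. A pure simplicial complex of dimension $d$ is connected in codimension one if for any two facets $F,G$ there exist facets $F=F_1,F_2,\ldots,F_r=G$ such that $\dim(F_i\cap F_{i+1})=d-1$ for all $i$. A facet $F$ of $\Delta$ is a leaf if either $\mathcal{F}(\Delta)=\{F\}$ or there exists a facet $G\neq F$ such that $F\cap H\subseteq F\cap G$ for all $H\in\mathcal{F}(\Delta)$ with $H\ne F$. $\Delta$ is a simplicial forest if every (nonempty) simplicial complex $\Gamma$ with $\mathcal{F}(\Gamma)\subset\mathcal{F}(\Delta)$ has a leaf. A monomial prime ideal is an ideal generated by a set of variables. The class $\mathcal{C}$ consists of all ideals $I$ of the form $I=I_1+\cdots+I_k$, where the ideals $I_j$ are defined in pairwise disjoint sets of variables and each $I_j$ is itself a product of monomial prime ideals in pairwise disjoint sets of variables.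 The depth function of a proper graded ideal $L\subset S$ is $k\mapsto \operatorname{depth} S/L^k$ for integers $k\ge 1$; it is constant if $\operatorname{depth} S/L^k=\operatorname{depth} S/L$ for all $k\ge 1$. *)

theory Defs
  imports
    "HOL-Algebra.Ideal_Product"
    "HOL-Algebra.QuotRing"
    "HOL-Algebra.Algebraic_Closure_Type"
    "HOL-Library.Poly_Mapping"
    "HOL-Library.Extended_Nat"
    "HOL-Library.Disjoint_Sets"
begin

section \<open>The polynomial ring\<close>

text \<open>
  The set \<open>[n]\<close> is rendered by a finite index type \<open>'n\<close> with \<open>n = CARD('n)\<close>.
  A polynomial maps exponent vectors to coefficients; its multiplication in
  \<open>Poly_Mapping\<close> is convolution. Ideals are those of \<open>HOL-Algebra\<close>, and sums, products and
  powers of ideals are taken in the semiring \<^const>\<open>ideals_set\<close> of all ideals.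
\<close>

type_synonym ('n, 'k) mpoly = "('n \<Rightarrow>\<^sub>0 nat) \<Rightarrow>\<^sub>0 'k"

abbreviation poly_ring :: "('n, 'k::field) mpoly ring" where
  "poly_ring \<equiv> ring_of_type_algebra"

abbreviation poly_ideals :: "('n, 'k::field) mpoly set ring" where
  "poly_ideals \<equiv> ideals_set poly_ring"

definition indet :: "'n \<Rightarrow> ('n, 'k::field) mpoly" where
  "indet i = Poly_Mapping.single (Poly_Mapping.single i 1) 1"

definition poly_vars :: "('n, 'k::field) mpoly \<Rightarrow> 'n set" where
  "poly_vars f = (\<Union>m \<in> Poly_Mapping.keys f. Poly_Mapping.keys m)"


section \<open>Depth\<close>

definition graded_max_ideal :: "('n, 'k::field) mpoly set" where
  "graded_max_ideal = Idl\<^bsub>poly_ring\<^esub> (range indet)"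

definition nonzerodivisor_mod :: "('n, 'k::field) mpoly set \<Rightarrow> ('n, 'k) mpoly \<Rightarrow> bool" where
  "nonzerodivisor_mod J f \<longleftrightarrow>
     (\<forall>u \<in> carrier (poly_ring Quot J).
        (J +>\<^bsub>poly_ring\<^esub> f) \<otimes>\<^bsub>poly_ring Quot J\<^esub> u = \<zero>\<^bsub>poly_ring Quot J\<^esub>
          \<longrightarrow> u = \<zero>\<^bsub>poly_ring Quot J\<^esub>)"

text \<open>
  Regular sequences on the module \<open>M = S/I\<close>: here \<open>M/(f\<^sub>1,\<dots>,f\<^sub>i)M\<close> is
  \<open>S/(I + (f\<^sub>1,\<dots>,f\<^sub>i))\<close>.
\<close>

definition regular_sequence_mod :: "('n, 'k::field) mpoly set \<Rightarrow> ('n, 'k) mpoly list \<Rightarrow> bool" where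
  "regular_sequence_mod I fs \<longleftrightarrow>
     (\<forall>i < length fs.
        nonzerodivisor_mod (I <+>\<^bsub>poly_ring\<^esub> Idl\<^bsub>poly_ring\<^esub> (set (take i fs))) (fs ! i)) \<and>
     I <+>\<^bsub>poly_ring\<^esub> Idl\<^bsub>poly_ring\<^esub> (set fs) \<noteq> carrier poly_ring"

text \<open>
  \<open>depth S/I\<close> for a proper graded ideal \<open>I\<close>, as the supremum of the lengths of regular
  sequences on \<open>S/I\<close> contained in the graded maximal ideal. The values are taken in
  \<^typ>\<open>enat\<close> so that the supremum is meaningful without knowing that it is finite.
\<close>

definition depth_quotient :: "('n, 'k::field) mpoly set \<Rightarrow> enat" where
  "depth_quotient I =
     (SUP fs \<in> {fs. set fs \<subseteq> graded_max_ideal \<and> regular_sequence_mod I fs}. enat (length fs))"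

definition depth_function :: "('n, 'k::field) mpoly set \<Rightarrow> nat \<Rightarrow> enat" where
  "depth_function L k = depth_quotient (L [^]\<^bsub>poly_ideals\<^esub> k)"

definition constant_depth_function :: "('n, 'k::field) mpoly set \<Rightarrow> bool" where
  "constant_depth_function L \<longleftrightarrow> (\<forall>k \<ge> 1. depth_function L k = depth_quotient L)"


section \<open>Simplicial complexes\<close>

text \<open>
  A simplicial complex on \<open>[n]\<close> always contains the empty face; it need not contain every
  singleton.
\<close>

definition simplicial_complex :: "'n set set \<Rightarrow> bool" where
  "simplicial_complex \<Delta> \<longleftrightarrow> \<Delta> \<noteq> {} \<and> (\<forall>F \<in> \<Delta>. \<forall>G. G \<subseteq> F \<longrightarrow> G \<in> \<Delta>)"

definition facets :: "'n set set \<Rightarrow> 'n set set" where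
  "facets \<Delta> = {F \<in> \<Delta>. \<forall>G \<in> \<Delta>. F \<subseteq> G \<longrightarrow> G = F}"

definition face_dim :: "'n set \<Rightarrow> int" where
  "face_dim F = int (card F) - 1"

definition complex_dim :: "'n set set \<Rightarrow> int" where
  "complex_dim \<Delta> = Max (face_dim ` \<Delta>)"

definition pure_complex :: "'n set set \<Rightarrow> bool" where
  "pure_complex \<Delta> \<longleftrightarrow> (\<forall>F \<in> facets \<Delta>. \<forall>G \<in> facets \<Delta>. face_dim F = face_dim G)"

definition connected_in_codim_one :: "'n set set \<Rightarrow> bool" where
  "connected_in_codim_one \<Delta> \<longleftrightarrow>
     (\<forall>F \<in> facets \<Delta>. \<forall>G \<in> facets \<Delta>.
        \<exists>Fs. Fs \<noteq> [] \<and> set Fs \<subseteq> facets \<Delta> \<and> hd Fs = F \<and> last Fs = G \<and>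
          (\<forall>i. Suc i < length Fs \<longrightarrow> face_dim (Fs ! i \<inter> Fs ! Suc i) = complex_dim \<Delta> - 1))"

definition leaf :: "'n set set \<Rightarrow> 'n set \<Rightarrow> bool" where
  "leaf \<Delta> F \<longleftrightarrow> F \<in> facets \<Delta> \<and>
     (facets \<Delta> = {F} \<or>
      (\<exists>G \<in> facets \<Delta>. G \<noteq> F \<and> (\<forall>H \<in> facets \<Delta>. H \<noteq> F \<longrightarrow> F \<inter> H \<subseteq> F \<inter> G)))"

definition simplicial_forest :: "'n set set \<Rightarrow> bool" where
  "simplicial_forest \<Delta> \<longleftrightarrow> simplicial_complex \<Delta> \<and>
     (\<forall>\<Gamma>. simplicial_complex \<Gamma> \<and> facets \<Gamma> \<subseteq> facets \<Delta> \<longrightarrow> (\<exists>F. leaf \<Gamma> F))"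

text \<open>A complex is connected if its 1-skeleton is a connected graph.\<close>

definition connected_complex :: "'n set set \<Rightarrow> bool" where
  "connected_complex \<Delta> \<longleftrightarrow> (\<forall>u \<in> \<Union>\<Delta>. \<forall>v \<in> \<Union>\<Delta>. (u, v) \<in> {(a, b). {a, b} \<in> \<Delta>}\<^sup>*)"

definition connected_subcomplex :: "'n set set \<Rightarrow> 'n set set \<Rightarrow> bool" where
  "connected_subcomplex \<Delta> \<Gamma> \<longleftrightarrow> simplicial_complex \<Gamma> \<and> \<Gamma> \<subseteq> \<Delta> \<and> connected_complex \<Gamma>"

definition complex_components :: "'n set set \<Rightarrow> 'n set set set" where
  "complex_components \<Delta> =
     {\<Gamma>. connected_subcomplex \<Delta> \<Gamma> \<and>
         (\<forall>\<Gamma>'. connected_subcomplex \<Delta> \<Gamma>' \<and> \<Gamma> \<subseteq> \<Gamma>' \<longrightarrow> \<Gamma>' = \<Gamma>)}"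

definition facet_ideal :: "'n set set \<Rightarrow> ('n, 'k::field) mpoly set" where
  "facet_ideal \<Delta> = Idl\<^bsub>poly_ring\<^esub> ((\<lambda>F. \<Prod>i \<in> F. indet i) ` facets \<Delta>)"


section \<open>Products of monomial prime ideals\<close>

definition monomial_prime :: "'n set \<Rightarrow> ('n, 'k::field) mpoly set" where
  "monomial_prime A = Idl\<^bsub>poly_ring\<^esub> (indet ` A)"

definition product_at_most_one_nonprincipal :: "('n, 'k::field) mpoly set \<Rightarrow> bool" where
  "product_at_most_one_nonprincipal I \<longleftrightarrow>
     (\<exists>r > 0. \<exists>A :: nat \<Rightarrow> 'n set.
        I = (\<Otimes>\<^bsub>poly_ideals\<^esub> j \<in> {..<r}. monomial_prime (A j)) \<and>
        card {j. j < r \<and>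
          \<not> principalideal (monomial_prime (A j) :: ('n, 'k) mpoly set) poly_ring} \<le> 1)"

definition product_disjoint_monomial_primes :: "('n, 'k::field) mpoly set \<Rightarrow> bool" where
  "product_disjoint_monomial_primes I \<longleftrightarrow>
     (\<exists>r > 0. \<exists>A :: nat \<Rightarrow> 'n set. disjoint_family_on A {..<r} \<and>
        I = (\<Otimes>\<^bsub>poly_ideals\<^esub> j \<in> {..<r}. monomial_prime (A j)))"

definition ideal_in_vars :: "'n set \<Rightarrow> ('n, 'k::field) mpoly set \<Rightarrow> bool" where
  "ideal_in_vars V I \<longleftrightarrow> (\<exists>G. (\<forall>g \<in> G. poly_vars g \<subseteq> V) \<and> I = Idl\<^bsub>poly_ring\<^esub> G)"

text \<open>The class \<open>\<C>\<close>.\<close>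

definition class_C :: "('n, 'k::field) mpoly set set" where
  "class_C =
     {I. \<exists>k > 0. \<exists>J :: nat \<Rightarrow> ('n, 'k) mpoly set. \<exists>V :: nat \<Rightarrow> 'n set.
        disjoint_family_on V {..<k} \<and>
        (\<forall>j < k. ideal_in_vars (V j) (J j) \<and> product_disjoint_monomial_primes (J j)) \<and>
        I = (\<Oplus>\<^bsub>poly_ideals\<^esub> j \<in> {..<k}. J j)}"

end

theory Submission
  imports Defs
begin

text \<open>
  All three conditions say that every facet has a vertex that lies in no other facet. For (b) and (c)
  this is a comparison of minimal generators. For (a), let \<open>n\<close> be the number of variables and \<open>r\<close> the
  number of facets. If all facets have such a vertex, then \<open>depth S/I\<^sup>k = n - r\<close> for all \<open>k \<ge> 1\<close>.
  Otherwise \<open>depth S/I > n - r\<close>, but \<open>depth S/I\<^sup>k \<le> n - r\<close> for some \<open>k\<close>.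

  Lower bounds: the elementary symmetric polynomials \<open>e\<^sub>1, \<dots>, e\<^sub>t\<close> form a regular sequence modulo
  every monomial prime of height at most \<open>n - t\<close>, over any field. Hence they are regular on every
  \<open>S/J\<close> that has a filtration by quotients modulo such primes.

  Upper bounds: a regular sequence of length \<open>t\<close> in the graded maximal ideal makes the Koszul
  cohomology of \<open>S/J\<close> vanish below degree \<open>t\<close>. A nonzero class in degree \<open>n - r\<close> comes from
  identifying the vertices that are exchanged across ridges: each component collapses to one simplex,
  and the product of the boundary spheres of these simplices carries the class.
\<close>

section \<open>Regular sequences in commutative rings\<close>

text \<open>The number n - r comes from building each component leaf by leaf: a new facet brings
  exactly one new vertex, so a component with f facets of size d + 1 has f + d vertices. Hence n - r
  is the number of vertices outside the complex plus d for each component, and this is the degree of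
  the Koszul class. The class needs a product of facets in front because a set with one vertex of
  each colour is in general only an integral combination of facets, with negative coefficients.
  Multiplication by \<open>u\<close> clears them, at the price of a high power. If every facet has a
  private vertex, its coefficient is read off at that vertex and is 0 or 1, so nothing has to be
  cleared and all powers obey the same bound. If some facet is covered by the others, the filtration
  of S/I can be arranged with one generator less, which raises the depth of the first power. General
  linear forms would serve as regular sequences only over large fields; this is the reason for
  symmetric polynomials.\<close>

definition is_ideal :: "'a::comm_ring_1 set \<Rightarrow> bool" where
  "is_ideal J \<longleftrightarrow> 0 \<in> J \<and> (\<forall>a\<in>J. \<forall>b\<in>J. a + b \<in> J) \<and> (\<forall>a\<in>J. \<forall>r. r * a \<in> J)"

definition adjoin :: "'a::comm_ring_1 set \<Rightarrow> 'a \<Rightarrow> 'a set" where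
  "adjoin J f = {a + f * b | a b. a \<in> J}"

definition colon :: "'a::comm_ring_1 set \<Rightarrow> 'a \<Rightarrow> 'a set" where
  "colon J f = {a. f * a \<in> J}"

text \<open>Regularity on the quotient by \<open>J\<close> without the demand that the final
  quotient be nonzero. Colon ideals that become the whole ring in a filtration then need no
  exception; properness enters only in \<open>depth_quotient_ge\<close>.\<close>

fun weakly_regular :: "'a::comm_ring_1 set \<Rightarrow> 'a list \<Rightarrow> bool" where
  "weakly_regular J [] \<longleftrightarrow> True"
| "weakly_regular J (f # fs) \<longleftrightarrow> (\<forall>a. f * a \<in> J \<longrightarrow> a \<in> J) \<and> weakly_regular (adjoin J f) fs"

lemma ideal_0: "is_ideal J \<Longrightarrow> 0 \<in> J"
  and ideal_add: "is_ideal J \<Longrightarrow> a \<in> J \<Longrightarrow> b \<in> J \<Longrightarrow> a + b \<in> J"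
  and ideal_mult: "is_ideal J \<Longrightarrow> a \<in> J \<Longrightarrow> r * a \<in> J"
  by (auto simp: is_ideal_def)

lemma ideal_mult_right: "is_ideal J \<Longrightarrow> a \<in> J \<Longrightarrow> a * r \<in> J"
  using ideal_mult[of J a r] by (simp add: mult.commute)

lemma ideal_uminus: "is_ideal J \<Longrightarrow> a \<in> J \<Longrightarrow> - a \<in> J"
  using ideal_mult[of J a "-1"] by simp

lemma ideal_diff: "is_ideal J \<Longrightarrow> a \<in> J \<Longrightarrow> b \<in> J \<Longrightarrow> a - b \<in> J"
  using ideal_add[of J a "- b"] ideal_uminus[of J b] by simp

lemma ideal_sum: "is_ideal J \<Longrightarrow> (\<And>i. i \<in> A \<Longrightarrow> g i \<in> J) \<Longrightarrow> sum g A \<in> J"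
  by (induction A rule: infinite_finite_induct) (auto intro: ideal_0 ideal_add)

lemma ideal_adjoin:
  assumes "is_ideal J"
  shows "is_ideal (adjoin J f)"
  unfolding is_ideal_def
proof (intro conjI ballI allI)
  show "0 \<in> adjoin J f"
    unfolding adjoin_def using ideal_0[OF assms] by (auto intro!: exI[of _ 0])
next
  fix a b assume "a \<in> adjoin J f" "b \<in> adjoin J f"
  then obtain a1 a2 b1 b2 where "a1 \<in> J" "b1 \<in> J" "a = a1 + f * a2" "b = b1 + f * b2"
    by (auto simp: adjoin_def)
  then show "a + b \<in> adjoin J f"
    unfolding adjoin_def using ideal_add[OF assms, of a1 b1]
    by (simp only: mem_Collect_eq, intro exI[of _ "a1 + b1"] exI[of _ "a2 + b2"]) (simp add: algebra_simps)
next
  fix a r assume "a \<in> adjoin J f"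
  then obtain a1 a2 where "a1 \<in> J" "a = a1 + f * a2"
    by (auto simp: adjoin_def)
  then show "r * a \<in> adjoin J f"
    unfolding adjoin_def using ideal_mult[OF assms, of a1 r]
    by (simp only: mem_Collect_eq, intro exI[of _ "r * a1"] exI[of _ "r * a2"]) (simp add: algebra_simps)
qed

lemma subset_adjoin: "J \<subseteq> adjoin J f"
  unfolding adjoin_def by (metis (mono_tags, lifting) add.right_neutral mem_Collect_eq mult_zero_right subsetI)

lemma adjoin_I2: "is_ideal J \<Longrightarrow> f * b \<in> adjoin J f"
  by (force simp: adjoin_def dest: ideal_0)

lemma adjoin_self: "is_ideal J \<Longrightarrow> f \<in> adjoin J f"
  using adjoin_I2[of J f 1] by simp

lemma adjoin_least: "is_ideal L \<Longrightarrow> J \<subseteq> L \<Longrightarrow> f \<in> L \<Longrightarrow> adjoin J f \<subseteq> L"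
  by (auto simp: adjoin_def intro!: ideal_add ideal_mult_right)

lemma adjoin_commute: "adjoin (adjoin J f) g = adjoin (adjoin J g) f"
  by (auto simp: adjoin_def) (metis add.assoc add.commute)+

text \<open>Multiplication by \<open>u\<close> embeds the quotient by \<open>colon J u\<close> into
  the quotient by \<open>J\<close>, with cokernel the quotient by \<open>adjoin J u\<close>. A
  sequence that is regular on both ends of this short exact sequence is regular in the middle. The
  induction works because a nonzerodivisor on the cokernel preserves exactness.\<close>

lemma weakly_regular_colon_adjoin:
  assumes "is_ideal J" "weakly_regular (colon J u) fs" "weakly_regular (adjoin J u) fs"
  shows "weakly_regular J fs"
  using assms
proof (induction fs arbitrary: J)
  case (Cons f fs)
  have quot: "(\<exists>a'. a - u * a' \<in> J)" if "f * a \<in> adjoin J u" for a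
  proof -
    have "a \<in> adjoin J u" using Cons.prems(3) that by simp
    then obtain j b where "j \<in> J" "a = j + u * b" by (auto simp: adjoin_def)
    then have "a - u * b \<in> J" by simp
    then show ?thesis ..
  qed
  have nzd: "a \<in> J" if "f * a \<in> J" for a
  proof -
    have "f * a \<in> adjoin J u" using that subset_adjoin by (rule rev_subsetD)
    then obtain b where b: "a - u * b \<in> J" using quot by blast
    have "f * a - f * (a - u * b) \<in> J"
      using ideal_diff[OF Cons.prems(1) that ideal_mult[OF Cons.prems(1) b]] .
    then have "f * b \<in> colon J u" by (simp add: colon_def algebra_simps)
    then have "b \<in> colon J u" using Cons.prems(2) by simp
    then show ?thesis
      using ideal_add[OF Cons.prems(1) b, of "u * b"] by (simp add: colon_def)
  qed
  \<comment> \<open>Exactness after dividing by \<open>f\<close>: if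
    \<open>u * b = j + f * a\<close>, then \<open>a\<close> is a multiple of \<open>u\<close> modulo
    \<open>J\<close>, and this multiple corrects \<open>b\<close>.\<close>
  have "colon (adjoin J f) u = adjoin (colon J u) f"
  proof (intro equalityI subsetI)
    fix b assume "b \<in> colon (adjoin J f) u"
    then obtain j a where ja: "j \<in> J" "u * b = j + f * a" by (auto simp: colon_def adjoin_def)
    have "f * a \<in> adjoin J u"
    proof -
      have "f * a = - j + u * b" using ja by (simp add: algebra_simps)
      then show ?thesis
        using ideal_uminus[OF Cons.prems(1) ja(1)] unfolding adjoin_def by blast
    qed
    then obtain b' where b': "a - u * b' \<in> J" using quot by blast
    have "j + f * (a - u * b') \<in> J"
      using ideal_add[OF Cons.prems(1) ja(1) ideal_mult[OF Cons.prems(1) b']] .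
    moreover have "u * (b - f * b') = j + f * (a - u * b')"
      using ja by (simp add: algebra_simps)
    ultimately have "b - f * b' \<in> colon J u" by (simp add: colon_def)
    then show "b \<in> adjoin (colon J u) f"
      unfolding adjoin_def by (simp only: mem_Collect_eq, intro exI[of _ "b - f * b'"] exI[of _ b']) simp
  next
    fix b assume "b \<in> adjoin (colon J u) f"
    then obtain c a where "u * c \<in> J" "b = c + f * a" by (auto simp: colon_def adjoin_def)
    then show "b \<in> colon (adjoin J f) u"
      unfolding colon_def adjoin_def
      by (simp only: mem_Collect_eq, intro exI[of _ "u * c"] exI[of _ "u * a"]) (simp add: algebra_simps)
  qed
  then have "weakly_regular (adjoin J f) fs"
    using Cons.IH[of "adjoin J f"] Cons.prems ideal_adjoin[OF Cons.prems(1)] adjoin_commute[of J f u]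
    by simp
  then show ?case using nzd by simp
qed simp


section \<open>The Koszul complex\<close>

definition ksign :: "('v \<Rightarrow> nat) \<Rightarrow> 'v \<Rightarrow> 'v set \<Rightarrow> 'a::comm_ring_1" where
  "ksign ord v \<sigma> = (-1) ^ card {w \<in> \<sigma>. ord w < ord v}"

text \<open>A cochain gives the coefficient of the exterior monomial of each index set, and
  \<open>kdiff\<close> is exterior multiplication by the linear form with coefficients
  \<open>x v\<close>. All degrees live in one function; degree i means vanishing on sets of any
  other size.\<close>

definition kdiff :: "('v \<Rightarrow> nat) \<Rightarrow> ('v \<Rightarrow> 'a::comm_ring_1) \<Rightarrow> ('v set \<Rightarrow> 'a) \<Rightarrow> 'v set \<Rightarrow> 'a" where
  "kdiff ord x c \<sigma> = (\<Sum>v\<in>\<sigma>. ksign ord v \<sigma> * x v * c (\<sigma> - {v}))"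

text \<open>Interior product with the dual of the basis vector at \<open>v\<close>.\<close>

definition kcontr :: "('v \<Rightarrow> nat) \<Rightarrow> 'v \<Rightarrow> ('v set \<Rightarrow> 'a::comm_ring_1) \<Rightarrow> 'v set \<Rightarrow> 'a" where
  "kcontr ord v c \<sigma> = (if v \<in> \<sigma> then 0 else ksign ord v \<sigma> * c (insert v \<sigma>))"

lemma ksign_sq [simp]: "ksign ord v \<sigma> * ksign ord v \<sigma> = 1"
  by (simp add: ksign_def flip: power_add mult_2)

lemma ksign_sq_left [simp]: "ksign ord v \<sigma> * (ksign ord v \<sigma> * a) = a"
  by (simp flip: mult.assoc)

lemma ksign_insert_self [simp]: "ksign ord v (insert v \<sigma>) = ksign ord v \<sigma>"
  unfolding ksign_def by (rule arg_cong[where f="\<lambda>S. (-1) ^ card S"]) auto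

lemma ksign_remove_self [simp]: "ksign ord v (\<sigma> - {v}) = ksign ord v \<sigma>"
  unfolding ksign_def by (rule arg_cong[where f="\<lambda>S. (-1) ^ card S"]) auto

lemma ksign_insert:
  assumes "finite \<sigma>" "v \<notin> \<sigma>"
  shows "ksign ord w (insert v \<sigma>) = (if ord v < ord w then - ksign ord w \<sigma> else ksign ord w \<sigma>)"
proof -
  have "{a \<in> insert v \<sigma>. ord a < ord w} =
     (if ord v < ord w then insert v {a \<in> \<sigma>. ord a < ord w} else {a \<in> \<sigma>. ord a < ord w})"
    by auto
  then show ?thesis using assms by (simp add: ksign_def)
qed

lemma ksign_remove:
  assumes "finite \<sigma>" "v \<in> \<sigma>"
  shows "(ksign ord w (\<sigma> - {v}) :: 'a::comm_ring_1) = (if ord v < ord w then - ksign ord w \<sigma> else ksign ord w \<sigma>)"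
proof -
  have "insert v (\<sigma> - {v}) = \<sigma>" using assms by auto
  then have "(ksign ord w \<sigma> :: 'a) = (if ord v < ord w then - ksign ord w (\<sigma> - {v}) else ksign ord w (\<sigma> - {v}))"
    using ksign_insert[of "\<sigma> - {v}" v ord w] assms by simp
  then show ?thesis by (simp split: if_splits)
qed

text \<open>The interior product is an antiderivation. If \<open>v\<close> lies in
  \<open>\<sigma>\<close>, only the term at \<open>v\<close> of the second summand survives.
  Otherwise, removing \<open>w\<close> and inserting \<open>v\<close> in the two possible orders
  gives opposite signs, and the term at \<open>v\<close> itself remains.\<close>

lemma kdiff_kcontr:
  fixes x :: "'v::finite \<Rightarrow> 'a::comm_ring_1"
  assumes "inj ord"
  shows "kcontr ord v (kdiff ord x c) \<sigma> + kdiff ord x (kcontr ord v c) \<sigma> = x v * c \<sigma>"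
proof (cases "v \<in> \<sigma>")
  case True
  have "kdiff ord x (kcontr ord v c) \<sigma> = (\<Sum>w\<in>\<sigma>. if w = v then x v * c \<sigma> else 0)"
    unfolding kdiff_def
  proof (rule sum.cong)
    fix w assume "w \<in> \<sigma>"
    show "ksign ord w \<sigma> * x w * kcontr ord v c (\<sigma> - {w}) = (if w = v then x v * c \<sigma> else 0)"
      using True by (auto simp: kcontr_def insert_absorb algebra_simps)
  qed simp
  then show ?thesis using True by (simp add: kcontr_def)
next
  case False
  have "kcontr ord v (kdiff ord x c) \<sigma> = x v * c \<sigma> +
      (\<Sum>w\<in>\<sigma>. ksign ord v \<sigma> * (ksign ord w (insert v \<sigma>) * x w * c (insert v \<sigma> - {w})))"
    using False by (simp add: kcontr_def kdiff_def sum_distrib_left distrib_left algebra_simps)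
  also have "(\<Sum>w\<in>\<sigma>. ksign ord v \<sigma> * (ksign ord w (insert v \<sigma>) * x w * c (insert v \<sigma> - {w})))
      = (\<Sum>w\<in>\<sigma>. - (ksign ord w \<sigma> * x w * kcontr ord v c (\<sigma> - {w})))"
  proof (rule sum.cong)
    fix w assume w: "w \<in> \<sigma>"
    with False have ne: "w \<noteq> v" by auto
    then have "ord w \<noteq> ord v" using assms by (auto dest: injD)
    moreover have "insert v \<sigma> - {w} = insert v (\<sigma> - {w})" using ne by auto
    ultimately show "ksign ord v \<sigma> * (ksign ord w (insert v \<sigma>) * x w * c (insert v \<sigma> - {w}))
        = - (ksign ord w \<sigma> * x w * kcontr ord v c (\<sigma> - {w}))"
      using w False by (simp add: kcontr_def ksign_insert ksign_remove algebra_simps)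
  qed simp
  finally show ?thesis by (simp only: kdiff_def[of ord x "kcontr ord v c"] sum_negf) simp
qed

lemma kdiff_diff: "kdiff ord x (\<lambda>\<sigma>. a \<sigma> - b \<sigma>) \<sigma> = kdiff ord x a \<sigma> - kdiff ord x b \<sigma>"
  by (simp add: kdiff_def algebra_simps sum_subtractf)

lemma kdiff_add: "kdiff ord x (\<lambda>\<sigma>. a \<sigma> + b \<sigma>) \<sigma> = kdiff ord x a \<sigma> + kdiff ord x b \<sigma>"
  by (simp add: kdiff_def algebra_simps sum.distrib)

lemma kdiff_scale: "kdiff ord x (\<lambda>\<sigma>. r * a \<sigma>) \<sigma> = r * kdiff ord x a \<sigma>"
  by (simp add: kdiff_def sum_distrib_left algebra_simps)

lemma kdiff_sum: "kdiff ord x (\<lambda>\<sigma>. \<Sum>i\<in>A. a i \<sigma>) \<sigma> = (\<Sum>i\<in>A. kdiff ord x (a i) \<sigma>)"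
  by (simp add: kdiff_def sum_distrib_left) (rule sum.swap)

text \<open>By \<open>kdiff_kcontr\<close>, contraction with \<open>v\<close> commutes with the
  square of \<open>kdiff\<close>, since the two corrections cancel. So the value on
  \<open>insert v \<sigma>\<close> is, up to sign, the value of such a square on the smaller
  set.\<close>

lemma kdiff_kdiff:
  fixes x :: "'v::finite \<Rightarrow> 'a::comm_ring_1"
  assumes "inj ord"
  shows "kdiff ord x (kdiff ord x c) \<sigma> = 0"
proof -
  have "finite \<sigma>" by simp
  then show ?thesis
  proof (induction \<sigma> arbitrary: c rule: finite_induct)
    case empty
    then show ?case by (simp add: kdiff_def)
  next
    case (insert v \<sigma>)
    have contr: "kcontr ord v (kdiff ord x a) = (\<lambda>\<tau>. x v * a \<tau> - kdiff ord x (kcontr ord v a) \<tau>)" for a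
    proof
      show "kcontr ord v (kdiff ord x a) \<tau> = x v * a \<tau> - kdiff ord x (kcontr ord v a) \<tau>" for \<tau>
        using kdiff_kcontr[OF assms, of v x a \<tau>] by (simp add: algebra_simps)
    qed
    have "ksign ord v \<sigma> * kdiff ord x (kdiff ord x c) (insert v \<sigma>) = kcontr ord v (kdiff ord x (kdiff ord x c)) \<sigma>"
      using insert.hyps by (simp only: kcontr_def if_False)
    also have "\<dots> = x v * kdiff ord x c \<sigma> - kdiff ord x (kcontr ord v (kdiff ord x c)) \<sigma>"
      by (simp only: contr[of "kdiff ord x c"])
    also have "kdiff ord x (kcontr ord v (kdiff ord x c)) \<sigma> =
        x v * kdiff ord x c \<sigma> - kdiff ord x (kdiff ord x (kcontr ord v c)) \<sigma>"
      by (simp only: contr[of c] kdiff_diff kdiff_scale)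
    also have "x v * kdiff ord x c \<sigma> - (x v * kdiff ord x c \<sigma> - kdiff ord x (kdiff ord x (kcontr ord v c)) \<sigma>) = 0"
      by (simp only: insert.IH) simp
    finally have "ksign ord v \<sigma> * (ksign ord v \<sigma> * kdiff ord x (kdiff ord x c) (insert v \<sigma>)) = 0" by simp
    then show ?case by (simp only: ksign_sq_left)
  qed
qed

lemma kdiff_in_ideal:
  assumes "is_ideal J" "\<And>\<sigma>. c \<sigma> \<in> J"
  shows "kdiff ord x c \<sigma> \<in> J"
  unfolding kdiff_def using assms by (intro ideal_sum ideal_mult) auto

text \<open>
  Contraction with the coefficients of \<open>f = \<Sum> a\<^sub>v x\<^sub>v\<close> is a homotopy between multiplication by \<open>f\<close>
  and zero. So a cocycle \<open>c\<close> modulo \<open>J\<close> contracts to a cocycle of lower degree modulo \<open>J + (f)\<close>, to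
  which induction on the regular sequence applies.
\<close>

lemma koszul_exact:
  fixes x :: "'v::finite \<Rightarrow> 'a::comm_ring_1"
  assumes "inj ord" "is_ideal J" "weakly_regular J fs"
    and "\<And>f. f \<in> set fs \<Longrightarrow> \<exists>a. f = (\<Sum>v\<in>UNIV. a v * x v)"
    and "\<And>\<sigma>. card \<sigma> \<noteq> i \<Longrightarrow> c \<sigma> = 0" "i < length fs" "\<And>\<sigma>. kdiff ord x c \<sigma> \<in> J"
  shows "\<exists>b. \<forall>\<sigma>. c \<sigma> - kdiff ord x b \<sigma> \<in> J"
  using assms(2-)
proof (induction fs arbitrary: J c i)
  case (Cons f fs)
  note J = \<open>is_ideal J\<close>
  have nzd: "f * a \<in> J \<Longrightarrow> a \<in> J" for a using Cons.prems by simp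
  obtain a where a: "f = (\<Sum>v\<in>UNIV. a v * x v)" using Cons.prems(3)[of f] by auto
  define h where "h c \<sigma> = (\<Sum>v\<in>UNIV. a v * kcontr ord v c \<sigma>)" for c :: "'v set \<Rightarrow> 'a" and \<sigma>
  have h: "h (kdiff ord x c) \<sigma> + kdiff ord x (h c) \<sigma> = f * c \<sigma>" for \<sigma>
  proof -
    have "kdiff ord x (h c) \<sigma> = (\<Sum>v\<in>UNIV. a v * kdiff ord x (kcontr ord v c) \<sigma>)"
      unfolding h_def by (simp add: kdiff_sum kdiff_scale)
    then have "h (kdiff ord x c) \<sigma> + kdiff ord x (h c) \<sigma> =
       (\<Sum>v\<in>UNIV. a v * (kcontr ord v (kdiff ord x c) \<sigma> + kdiff ord x (kcontr ord v c) \<sigma>))"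
      unfolding h_def by (simp add: sum.distrib distrib_left)
    then show ?thesis by (simp add: kdiff_kcontr[OF assms(1)] a sum_distrib_right mult.assoc)
  qed
  have hd: "h (kdiff ord x c) \<sigma> \<in> J" for \<sigma>
    unfolding h_def kcontr_def using Cons.prems(6)
    by (intro ideal_sum[OF J] ideal_mult[OF J]) (auto intro: ideal_0[OF J] ideal_mult[OF J])
  show ?case
  proof (cases i)
    case 0
    have "h c \<sigma> = 0" for \<sigma>
      unfolding h_def kcontr_def using 0 Cons.prems(4) by (intro sum.neutral) auto
    then have "kdiff ord x (h c) \<sigma> = 0" for \<sigma> by (simp add: kdiff_def)
    then have "c \<sigma> \<in> J" for \<sigma> using h[of \<sigma>] hd[of \<sigma>] by (simp add: nzd)
    then show ?thesis by (intro exI[of _ "\<lambda>_. 0"]) (simp add: kdiff_def)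
  next
    case (Suc j)
    have "\<exists>b. \<forall>\<sigma>. h c \<sigma> - kdiff ord x b \<sigma> \<in> adjoin J f"
    proof (rule Cons.IH)
      show "is_ideal (adjoin J f)" by (rule ideal_adjoin[OF J])
      show "weakly_regular (adjoin J f) fs" "j < length fs" using Cons.prems Suc by auto
      show "\<exists>a. g = (\<Sum>v\<in>UNIV. a v * x v)" if "g \<in> set fs" for g using Cons.prems(3) that by simp
      show "h c \<sigma> = 0" if "card \<sigma> \<noteq> j" for \<sigma>
      proof -
        have "kcontr ord v c \<sigma> = 0" for v
          using that Cons.prems(4)[of "insert v \<sigma>"] Suc by (auto simp: kcontr_def)
        then show ?thesis by (simp add: h_def)
      qed
      show "kdiff ord x (h c) \<sigma> \<in> adjoin J f" for \<sigma>
      proof -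
        have "kdiff ord x (h c) \<sigma> = - h (kdiff ord x c) \<sigma> + f * c \<sigma>"
          using h[of \<sigma>] by (simp add: algebra_simps)
        then show ?thesis using ideal_uminus[OF J hd[of \<sigma>]] unfolding adjoin_def by blast
      qed
    qed
    then obtain b where b: "\<And>\<sigma>. h c \<sigma> - kdiff ord x b \<sigma> \<in> adjoin J f" by blast
    have "\<exists>j e. j \<in> J \<and> h c \<sigma> = kdiff ord x b \<sigma> + (j + f * e)" for \<sigma>
    proof -
      obtain j e where "j \<in> J" "h c \<sigma> - kdiff ord x b \<sigma> = j + f * e"
        using b[of \<sigma>] by (auto simp: adjoin_def)
      then show ?thesis by (intro exI[of _ j] exI[of _ e]) (simp add: algebra_simps)
    qed
    then obtain j e where j: "\<And>\<sigma>. j \<sigma> \<in> J"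
      and e: "\<And>\<sigma>. h c \<sigma> = kdiff ord x b \<sigma> + (j \<sigma> + f * e \<sigma>)"
      by metis
    \<comment> \<open>Applying \<open>kdiff\<close> to the expression for \<open>h c\<close> kills
      the part from \<open>b\<close>. The homotopy then puts \<open>f\<close> times this difference
      into \<open>J\<close>, so \<open>e\<close> is the required primitive.\<close>
    have "c \<sigma> - kdiff ord x e \<sigma> \<in> J" for \<sigma>
    proof (rule nzd)
      have "h c = (\<lambda>\<sigma>. kdiff ord x b \<sigma> + (j \<sigma> + f * e \<sigma>))" using e by (rule ext)
      then have "kdiff ord x (h c) \<sigma> = kdiff ord x (\<lambda>\<sigma>. kdiff ord x b \<sigma> + (j \<sigma> + f * e \<sigma>)) \<sigma>"
        by (rule arg_cong)
      also have "\<dots> = kdiff ord x j \<sigma> + f * kdiff ord x e \<sigma>"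
        by (simp add: kdiff_add kdiff_scale kdiff_kdiff[OF assms(1)])
      finally have "f * (c \<sigma> - kdiff ord x e \<sigma>) = h (kdiff ord x c) \<sigma> + kdiff ord x j \<sigma>"
        using h[of \<sigma>] by (simp add: algebra_simps)
      then show "f * (c \<sigma> - kdiff ord x e \<sigma>) \<in> J"
        using ideal_add[OF J hd kdiff_in_ideal[OF J j]] by simp
    qed
    then show ?thesis by blast
  qed
qed simp


section \<open>Ideals of the ring of a type\<close>

interpretation type_ring: cring "ring_of_type_algebra :: 'a::comm_ring_1 ring"
  by (rule cring_from_type_algebra)

lemma type_ring_simps [simp]:
  "carrier (ring_of_type_algebra :: 'a::comm_ring_1 ring) = UNIV"
  "a \<otimes>\<^bsub>(ring_of_type_algebra :: 'a ring)\<^esub> b = a * b"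
  "a \<oplus>\<^bsub>(ring_of_type_algebra :: 'a ring)\<^esub> b = a + b"
  "\<one>\<^bsub>(ring_of_type_algebra :: 'a ring)\<^esub> = 1"
  "\<zero>\<^bsub>(ring_of_type_algebra :: 'a ring)\<^esub> = 0"
  by (simp_all add: ring_of_type_algebra_def)

lemma ideal_type_ring_iff: "ideal J (ring_of_type_algebra :: 'a::comm_ring_1 ring) \<longleftrightarrow> is_ideal J"
proof
  assume "ideal J (ring_of_type_algebra :: 'a ring)"
  then interpret ideal J "ring_of_type_algebra :: 'a ring" .
  show "is_ideal J"
    unfolding is_ideal_def
    using zero_closed a_closed I_l_closed by (metis UNIV_I type_ring_simps additive_subgroup.zero_closed additive_subgroup_axioms)
next
  assume J: "is_ideal J"
  show "ideal J (ring_of_type_algebra :: 'a ring)"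
  proof (rule idealI)
    show "ring (ring_of_type_algebra :: 'a ring)" ..
    show "subgroup J (add_monoid (ring_of_type_algebra :: 'a ring))"
    proof (rule type_ring.add.subgroupI)
      fix a assume a: "a \<in> J"
      then show "\<ominus>\<^bsub>(ring_of_type_algebra :: 'a ring)\<^esub> a \<in> J"
        using ideal_uminus[OF J a] type_ring.minus_equality[of "- a" a] by simp
    next
      show "J \<noteq> {}" using ideal_0[OF J] by blast
      show "a \<oplus>\<^bsub>(ring_of_type_algebra :: 'a ring)\<^esub> b \<in> J" if "a \<in> J" "b \<in> J" for a b
        using ideal_add[OF J that] by simp
    qed simp
    show "x \<otimes>\<^bsub>(ring_of_type_algebra :: 'a ring)\<^esub> a \<in> J" if "a \<in> J" for a x
      using ideal_mult[OF J that] by simp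
    show "a \<otimes>\<^bsub>(ring_of_type_algebra :: 'a ring)\<^esub> x \<in> J" if "a \<in> J" for a x
      using ideal_mult_right[OF J that] by simp
  qed
qed

lemma genideal_type_ring:
  "Idl\<^bsub>(ring_of_type_algebra :: 'a::comm_ring_1 ring)\<^esub> G = \<Inter>{L. is_ideal L \<and> G \<subseteq> L}"
  by (simp add: genideal_def ideal_type_ring_iff)

lemma is_ideal_genideal: "is_ideal (Idl\<^bsub>(ring_of_type_algebra :: 'a::comm_ring_1 ring)\<^esub> G)"
  using type_ring.genideal_ideal[of G] by (simp add: ideal_type_ring_iff)

lemma genideal_eqI:
  assumes "is_ideal L" "G \<subseteq> L" "\<And>M. is_ideal M \<Longrightarrow> G \<subseteq> M \<Longrightarrow> L \<subseteq> M"
  shows "Idl\<^bsub>(ring_of_type_algebra :: 'a::comm_ring_1 ring)\<^esub> G = L"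
  unfolding genideal_type_ring
proof (rule subset_antisym)
  show "\<Inter>{M. is_ideal M \<and> G \<subseteq> M} \<subseteq> L" using assms(1,2) by (intro Inter_lower CollectI conjI)
  show "L \<subseteq> \<Inter>{M. is_ideal M \<and> G \<subseteq> M}" using assms(3) by (intro Inter_greatest) (elim CollectE conjE)
qed

lemma set_add_genideal:
  assumes "is_ideal (J :: 'a::comm_ring_1 set)"
  shows "J <+>\<^bsub>ring_of_type_algebra\<^esub> Idl\<^bsub>ring_of_type_algebra\<^esub> G = Idl\<^bsub>ring_of_type_algebra\<^esub> (J \<union> G)"
proof -
  have "J <+>\<^bsub>ring_of_type_algebra\<^esub> Idl\<^bsub>ring_of_type_algebra\<^esub> G
      = Idl\<^bsub>ring_of_type_algebra\<^esub> (J \<union> Idl\<^bsub>ring_of_type_algebra\<^esub> G)"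
    using type_ring.union_genideal[of J "Idl\<^bsub>ring_of_type_algebra\<^esub> G"] assms is_ideal_genideal[of G]
    by (simp add: ideal_type_ring_iff)
  also have "\<dots> = Idl\<^bsub>ring_of_type_algebra\<^esub> (J \<union> G)"
    unfolding genideal_type_ring by (rule arg_cong[where f=Inter]) blast
  finally show ?thesis .
qed

lemma genideal_insert:
  assumes "is_ideal (J :: 'a::comm_ring_1 set)"
  shows "Idl\<^bsub>ring_of_type_algebra\<^esub> (J \<union> insert f G) = Idl\<^bsub>ring_of_type_algebra\<^esub> (adjoin J f \<union> G)"
proof -
  have "J \<union> insert f G \<subseteq> L \<longleftrightarrow> adjoin J f \<union> G \<subseteq> L" if "is_ideal L" for L
    using adjoin_least[OF that, of J f] subset_adjoin[of J f] adjoin_self[OF assms, of f] by blast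
  then show ?thesis unfolding genideal_type_ring by (metis (no_types, lifting))
qed

section \<open>Comparison with regular sequences defined through quotient rings\<close>

lemma nonzerodivisor_mod_iff:
  assumes "is_ideal J"
  shows "nonzerodivisor_mod J f \<longleftrightarrow> (\<forall>a. f * a \<in> J \<longrightarrow> a \<in> J)"
proof -
  interpret ideal J "poly_ring" using assms by (simp add: ideal_type_ring_iff)
  have mem: "J +>\<^bsub>poly_ring\<^esub> a = J \<longleftrightarrow> a \<in> J" for a
    using a_rcos_const[of a] rcos_const_imp_mem[of a] by auto
  have "carrier (poly_ring Quot J) = range (\<lambda>a. J +>\<^bsub>poly_ring\<^esub> a)"
    by (auto simp: FactRing_def A_RCOSETS_def')
  moreover have "(J +>\<^bsub>poly_ring\<^esub> f) \<otimes>\<^bsub>poly_ring Quot J\<^esub> (J +>\<^bsub>poly_ring\<^esub> a) = J +>\<^bsub>poly_ring\<^esub> (f * a)" for a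
    using rcoset_mult_add[of f a] by (simp add: FactRing_def)
  moreover have "\<zero>\<^bsub>poly_ring Quot J\<^esub> = J" by (simp add: FactRing_def)
  ultimately show ?thesis
    by (simp add: nonzerodivisor_mod_def mem)
qed

text \<open>The ideals in the indexed definition are obtained by absorbing the elements of the
  sequence one by one into \<open>J\<close>, which is the recursion of
  \<open>weakly_regular\<close>.\<close>

lemma regular_sequence_mod_iff:
  assumes "is_ideal J"
  shows "regular_sequence_mod J fs \<longleftrightarrow>
    weakly_regular J fs \<and> Idl\<^bsub>poly_ring\<^esub> (J \<union> set fs) \<noteq> UNIV"
proof -
  have "(\<forall>i < length fs. nonzerodivisor_mod (Idl\<^bsub>poly_ring\<^esub> (J \<union> set (take i fs))) (fs ! i))
      \<longleftrightarrow> weakly_regular J fs"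
    using assms
  proof (induction fs arbitrary: J)
    case (Cons f fs)
    have "Idl\<^bsub>poly_ring\<^esub> J = J"
      using Cons.prems by (intro genideal_eqI) auto
    moreover have "Idl\<^bsub>poly_ring\<^esub> (J \<union> insert f G) = Idl\<^bsub>poly_ring\<^esub> (adjoin J f \<union> G)" for G
      by (rule genideal_insert[OF Cons.prems])
    ultimately show ?case
      using Cons.IH[OF ideal_adjoin[OF Cons.prems]] Cons.prems
      by (simp add: All_less_Suc2 nonzerodivisor_mod_iff)
  qed simp
  then show ?thesis
    unfolding regular_sequence_mod_def by (simp add: set_add_genideal[OF assms])
qed


section \<open>Monomial ideals\<close>

abbreviation "keys \<equiv> Poly_Mapping.keys"

abbreviation "lookup \<equiv> Poly_Mapping.lookup"

abbreviation "single \<equiv> Poly_Mapping.single"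

abbreviation monom :: "('n \<Rightarrow>\<^sub>0 nat) \<Rightarrow> ('n, 'k::field) mpoly" where
  "monom m \<equiv> single m 1"

text \<open>For up-closed \<open>U\<close> this is the monomial ideal with exponent set
  \<open>U\<close>. As the ideal determines \<open>U\<close>, sums, products, colons and inclusions
  of monomial ideals become statements about sets of exponent vectors, in which the field no longer
  occurs.\<close>

definition mono_ideal :: "('n \<Rightarrow>\<^sub>0 nat) set \<Rightarrow> ('n, 'k::field) mpoly set" where
  "mono_ideal U = {f. keys f \<subseteq> U}"

definition up_closed :: "('n \<Rightarrow>\<^sub>0 nat) set \<Rightarrow> bool" where
  "up_closed U \<longleftrightarrow> (\<forall>m\<in>U. \<forall>q. m + q \<in> U)"

definition up_closure :: "('n \<Rightarrow>\<^sub>0 nat) set \<Rightarrow> ('n \<Rightarrow>\<^sub>0 nat) set" where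
  "up_closure A = {a + q | a q. a \<in> A}"

lemma up_closed_up_closure [simp]: "up_closed (up_closure A)"
  unfolding up_closed_def
proof (intro ballI allI)
  fix m q assume "m \<in> up_closure A"
  then obtain a p where "m = a + p" "a \<in> A" unfolding up_closure_def by blast
  then have "m + q = a + (p + q)" "a \<in> A" by (simp_all add: add.assoc)
  then show "m + q \<in> up_closure A" unfolding up_closure_def by blast
qed

lemma up_closure_superset: "A \<subseteq> up_closure A"
proof
  fix a assume "a \<in> A"
  moreover have "a = a + 0" by simp
  ultimately show "a \<in> up_closure A" unfolding up_closure_def by blast
qed

lemma up_closed_Un: "up_closed U \<Longrightarrow> up_closed V \<Longrightarrow> up_closed (U \<union> V)"
  by (auto simp: up_closed_def)

lemma poly_eq_sum_monom:
  "(f :: ('n, 'k::field) mpoly) = (\<Sum>m\<in>keys f. single m (lookup f m))"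
proof (rule poly_mapping_eqI)
  fix k
  have "(\<Sum>m\<in>keys f. lookup (single m (lookup f m)) k)
     = (\<Sum>m\<in>keys f. if m = k then lookup f m else 0)"
    by (rule sum.cong) (auto simp: lookup_single when_def)
  then show "lookup f k =
      lookup (\<Sum>m\<in>keys f. single m (lookup f m)) k"
    by (simp add: lookup_sum in_keys_iff)
qed

lemma lookup_single_mult:
  "lookup (single a c * f) (a + m) = c * lookup (f :: ('n, 'k::field) mpoly) m"
  by (simp add: lookup_mult lookup_single when_mult)

lemma lookup_single_mult_eq_0:
  assumes "\<nexists>m. k = a + m"
  shows "lookup (single a c * (f :: ('n, 'k::field) mpoly)) k = 0"
proof -
  have "lookup f q = 0 \<or> k \<noteq> a + q" for q using assms by blast
  then have "(\<Sum>q. lookup f q when k = a + q) = (0 :: 'k)"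
    using assms by auto
  then show ?thesis by (simp add: lookup_mult lookup_single when_mult)
qed

lemma keys_monom_mult:
  "keys (monom a * (f :: ('n, 'k::field) mpoly)) = (+) a ` keys f"
proof (intro equalityI subsetI)
  fix k assume k: "k \<in> keys (monom a * f)"
  then obtain m where "k = a + m" using lookup_single_mult_eq_0[of k a 1 f] by (auto simp: in_keys_iff)
  then show "k \<in> (+) a ` keys f" using k by (auto simp: in_keys_iff lookup_single_mult)
qed (auto simp: in_keys_iff lookup_single_mult)

lemma ideal_mono_ideal: "up_closed U \<Longrightarrow> is_ideal (mono_ideal U :: ('n, 'k::field) mpoly set)"
proof -
  assume U: "up_closed U"
  have "keys (r * a) \<subseteq> U" if "keys a \<subseteq> U" for r a :: "('n, 'k) mpoly"
    using keys_mult[of r a] that U by (fastforce simp: up_closed_def add.commute)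
  moreover have "keys (a + b) \<subseteq> U"
    if "keys a \<subseteq> U" "keys b \<subseteq> U" for a b :: "('n, 'k) mpoly"
    using keys_add[of a b] that by blast
  ultimately show ?thesis unfolding is_ideal_def mono_ideal_def by simp
qed

lemma monom_in_mono_ideal [simp]: "monom m \<in> mono_ideal U \<longleftrightarrow> m \<in> U"
  by (simp add: mono_ideal_def)

lemma mono_ideal_mono: "mono_ideal U \<subseteq> (mono_ideal V :: ('n, 'k::field) mpoly set) \<longleftrightarrow> U \<subseteq> V"
proof
  assume sub: "mono_ideal U \<subseteq> (mono_ideal V :: ('n, 'k) mpoly set)"
  show "U \<subseteq> V"
  proof
    fix m assume "m \<in> U"
    then have "(monom m :: ('n, 'k) mpoly) \<in> mono_ideal U" by simp
    then have "(monom m :: ('n, 'k) mpoly) \<in> mono_ideal V" using sub by blast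
    then show "m \<in> V" by simp
  qed
qed (auto simp: mono_ideal_def)

lemma mono_ideal_inject: "mono_ideal U = (mono_ideal V :: ('n, 'k::field) mpoly set) \<longleftrightarrow> U = V"
  using mono_ideal_mono[of U V, where 'k='k] mono_ideal_mono[of V U, where 'k='k] by blast

lemma mono_ideal_least:
  assumes "is_ideal (J :: ('n, 'k::field) mpoly set)" "\<And>m. m \<in> U \<Longrightarrow> monom m \<in> J"
  shows "mono_ideal U \<subseteq> J"
proof
  fix f :: "('n, 'k) mpoly" assume f: "f \<in> mono_ideal U"
  have "(\<Sum>m\<in>keys f. single m (lookup f m)) \<in> J"
  proof (rule ideal_sum[OF assms(1)])
    fix m assume "m \<in> keys f"
    then have "monom m \<in> J" using f assms(2) by (auto simp: mono_ideal_def)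
    then have "single 0 (lookup f m) * monom m \<in> J" by (rule ideal_mult[OF assms(1)])
    then show "single m (lookup f m) \<in> J" by (simp add: mult_single)
  qed
  then show "f \<in> J" using poly_eq_sum_monom[of f] by simp
qed

lemma genideal_monom:
  "Idl\<^bsub>poly_ring\<^esub> (monom ` A) = (mono_ideal (up_closure A) :: ('n, 'k::field) mpoly set)"
proof (rule genideal_eqI)
  show "monom ` A \<subseteq> (mono_ideal (up_closure A) :: ('n, 'k) mpoly set)" using up_closure_superset[of A] by auto
  fix M :: "('n, 'k) mpoly set" assume M: "is_ideal M" "monom ` A \<subseteq> M"
  show "mono_ideal (up_closure A) \<subseteq> M"
  proof (rule mono_ideal_least[OF M(1)])
    fix m assume "m \<in> up_closure A"
    then obtain a q where "m = q + a" "a \<in> A" by (auto simp: up_closure_def add.commute)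
    then show "monom m \<in> M" using ideal_mult[OF M(1), of "monom a" "monom q"] M(2) by (auto simp: mult_single)
  qed
qed (simp add: ideal_mono_ideal)

lemma set_add_mono_ideal:
  assumes "up_closed U" "up_closed V"
  shows "mono_ideal U <+>\<^bsub>poly_ring\<^esub> mono_ideal V = (mono_ideal (U \<union> V) :: ('n, 'k::field) mpoly set)"
proof -
  have "mono_ideal U <+>\<^bsub>poly_ring\<^esub> mono_ideal V
     = Idl\<^bsub>poly_ring\<^esub> (mono_ideal U \<union> mono_ideal V :: ('n, 'k) mpoly set)"
    using ideal_mono_ideal[OF assms(1)] ideal_mono_ideal[OF assms(2)]
    unfolding ideal_type_ring_iff[symmetric] by (rule type_ring.union_genideal[symmetric])
  also have "\<dots> = mono_ideal (U \<union> V)"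
  proof (rule genideal_eqI)
    show "is_ideal (mono_ideal (U \<union> V) :: ('n, 'k) mpoly set)" using assms by (simp add: ideal_mono_ideal up_closed_Un)
    show "mono_ideal U \<union> mono_ideal V \<subseteq> (mono_ideal (U \<union> V) :: ('n, 'k) mpoly set)" by (auto simp: mono_ideal_def)
    show "mono_ideal (U \<union> V) \<subseteq> M" if M: "is_ideal M" "mono_ideal U \<union> mono_ideal V \<subseteq> M" for M :: "('n, 'k) mpoly set"
    proof (rule mono_ideal_least[OF M(1)])
      fix m assume "m \<in> U \<union> V"
      then have "monom m \<in> (mono_ideal U \<union> mono_ideal V :: ('n, 'k) mpoly set)" by simp
      then show "monom m \<in> M" using M(2) by blast
    qed
  qed
  finally show ?thesis .
qed

lemma ideal_prod_mono_ideal: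
  assumes "up_closed U" "up_closed V"
  shows "ideal_prod poly_ring (mono_ideal U) (mono_ideal V) =
    (mono_ideal {u + v | u v. u \<in> U \<and> v \<in> V} :: ('n, 'k::field) mpoly set)"
proof
  let ?W = "{u + v | u v. u \<in> U \<and> v \<in> V}"
  have W: "up_closed ?W"
    unfolding up_closed_def
  proof (intro ballI allI)
    fix m q assume "m \<in> ?W"
    then obtain u v where uv: "m = u + v" "u \<in> U" "v \<in> V" by blast
    then have "v + q \<in> V" using assms(2) by (simp add: up_closed_def)
    then show "m + q \<in> ?W" using uv by (auto simp: add.assoc)
  qed
  show "ideal_prod poly_ring (mono_ideal U) (mono_ideal V) \<subseteq> (mono_ideal ?W :: ('n, 'k) mpoly set)"
  proof
    fix f :: "('n, 'k) mpoly" assume "f \<in> ideal_prod poly_ring (mono_ideal U) (mono_ideal V)"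
    then show "f \<in> mono_ideal ?W"
    proof (induction f rule: ideal_prod.induct)
      case (prod f g)
      then have "keys (f * g) \<subseteq> ?W"
        using keys_mult[of f g] unfolding mono_ideal_def by blast
      then show ?case by (simp add: mono_ideal_def)
    next
      case (sum f g)
      then show ?case using ideal_add[OF ideal_mono_ideal[OF W]] by simp
    qed
  qed
  have "is_ideal (ideal_prod poly_ring (mono_ideal U) (mono_ideal V) :: ('n, 'k) mpoly set)"
    using type_ring.ideal_prod_is_ideal[of "mono_ideal U" "mono_ideal V"] assms
    by (simp add: ideal_type_ring_iff ideal_mono_ideal)
  then show "mono_ideal ?W \<subseteq> (ideal_prod poly_ring (mono_ideal U) (mono_ideal V) :: ('n, 'k) mpoly set)"
  proof (rule mono_ideal_least)
    fix m assume "m \<in> ?W"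
    then obtain u v where "m = u + v" "u \<in> U" "v \<in> V" by blast
    then show "(monom m :: ('n, 'k) mpoly) \<in> ideal_prod poly_ring (mono_ideal U) (mono_ideal V)"
      using ideal_prod.prod[of "monom u :: ('n, 'k) mpoly" "mono_ideal U" "monom v" "mono_ideal V" poly_ring]
      by (simp add: mult_single)
  qed
qed

lemma colon_mono_ideal: "colon (mono_ideal U) (monom a) = mono_ideal {m. a + m \<in> U}"
  by (auto simp: colon_def mono_ideal_def keys_monom_mult)

lemma adjoin_mono_ideal:
  assumes "up_closed U"
  shows "adjoin (mono_ideal U) (monom a) = (mono_ideal (U \<union> up_closure {a}) :: ('n, 'k::field) mpoly set)"
proof
  have UC: "up_closed (U \<union> up_closure {a})" using assms by (simp add: up_closed_Un)
  show "adjoin (mono_ideal U) (monom a) \<subseteq> (mono_ideal (U \<union> up_closure {a}) :: ('n, 'k) mpoly set)"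
    using up_closure_superset[of "{a}"]
    by (intro adjoin_least ideal_mono_ideal UC) (auto simp: mono_ideal_mono)
  show "mono_ideal (U \<union> up_closure {a}) \<subseteq> adjoin (mono_ideal U :: ('n, 'k) mpoly set) (monom a)"
  proof (rule mono_ideal_least)
    show "is_ideal (adjoin (mono_ideal U :: ('n, 'k) mpoly set) (monom a))"
      by (intro ideal_adjoin ideal_mono_ideal assms)
    fix m assume "m \<in> U \<union> up_closure {a}"
    then show "monom m \<in> adjoin (mono_ideal U :: ('n, 'k) mpoly set) (monom a)"
    proof
      assume "m \<in> U"
      then show ?thesis using subset_adjoin[of "mono_ideal U :: ('n, 'k) mpoly set" "monom a"] by auto
    next
      assume "m \<in> up_closure {a}"
      then obtain q where "m = a + q" by (auto simp: up_closure_def)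
      then show ?thesis using adjoin_I2[OF ideal_mono_ideal[OF assms], of "monom a" "monom q"] by (simp add: mult_single)
    qed
  qed
qed

lemma nonzero_lookup: "m \<noteq> 0 \<Longrightarrow> \<exists>i. lookup m i \<noteq> 0"
  using poly_mapping_eqI[of m 0] by auto

lemma graded_max_ideal_eq: "(graded_max_ideal :: ('n, 'k::field) mpoly set) = mono_ideal (- {0})"
proof -
  have "up_closure (range (\<lambda>i. single i 1)) = (- {0} :: ('n \<Rightarrow>\<^sub>0 nat) set)"
  proof (intro equalityI subsetI)
    fix m :: "'n \<Rightarrow>\<^sub>0 nat" assume "m \<in> up_closure (range (\<lambda>i. single i 1))"
    then obtain i q where "m = single i 1 + q" by (auto simp: up_closure_def)
    then have "lookup m i \<noteq> 0" by (simp add: lookup_add)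
    then show "m \<in> - {0}" by auto
  next
    fix m :: "'n \<Rightarrow>\<^sub>0 nat" assume "m \<in> - {0}"
    then obtain i where i: "lookup m i \<noteq> 0" using nonzero_lookup by auto
    have "m = single i 1 + (m - single i 1)"
      using i by (intro poly_mapping_eqI) (auto simp: lookup_add lookup_minus lookup_single when_def)
    then show "m \<in> up_closure (range (\<lambda>i. single i 1))" unfolding up_closure_def by blast
  qed
  moreover have "range indet = (monom ` range (\<lambda>i. single i 1) :: ('n, 'k) mpoly set)"
    by (auto simp: indet_def)
  ultimately show ?thesis unfolding graded_max_ideal_def by (simp only: genideal_monom)
qed

lemma up_closed_nonzero: "up_closed (- {0} :: ('n \<Rightarrow>\<^sub>0 nat) set)"
  unfolding up_closed_def
proof (intro ballI allI)
  fix m q :: "'n \<Rightarrow>\<^sub>0 nat" assume "m \<in> - {0}"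
  then obtain i where "lookup m i \<noteq> 0" using nonzero_lookup by auto
  then have "lookup (m + q) i \<noteq> 0" by (simp add: lookup_add)
  then show "m + q \<in> - {0}" by auto
qed

text \<open>This supplies the coefficients with which \<open>koszul_exact\<close> contracts.\<close>

lemma graded_max_ideal_combination:
  fixes f :: "('n::finite, 'k::field) mpoly"
  assumes "f \<in> graded_max_ideal"
  shows "\<exists>a. f = (\<Sum>v\<in>UNIV. a v * indet v)"
proof -
  let ?L = "{f :: ('n, 'k) mpoly. \<exists>a. f = (\<Sum>v\<in>UNIV. a v * indet v)}"
  have "is_ideal ?L"
    unfolding is_ideal_def
  proof (intro conjI ballI allI)
    show "0 \<in> ?L" by (rule CollectI, rule exI[of _ "\<lambda>_. 0"]) simp
    show "f + g \<in> ?L" if fg: "f \<in> ?L" "g \<in> ?L" for f g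
    proof -
      obtain a b where "f = (\<Sum>v\<in>UNIV. a v * indet v)" "g = (\<Sum>v\<in>UNIV. b v * indet v)" using fg by blast
      then show ?thesis 
        by (intro CollectI exI[of _ "\<lambda>v. a v + b v"]) (simp add: distrib_right sum.distrib)
    qed
    show "r * f \<in> ?L" if f: "f \<in> ?L" for f r
    proof -
      obtain a where "f = (\<Sum>v\<in>UNIV. a v * indet v)" using f by blast
      then show ?thesis 
        by (intro CollectI exI[of _ "\<lambda>v. r * a v"]) (simp add: sum_distrib_left mult.assoc)
    qed
  qed
  moreover have "range indet \<subseteq> ?L"
  proof
    fix f :: "('n, 'k) mpoly" assume "f \<in> range indet"
    then obtain i where "f = indet i" by blast
    then have "f = (\<Sum>v\<in>UNIV. if v = i then indet v else 0)" by simp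
    also have "\<dots> = (\<Sum>v\<in>UNIV. (if v = i then 1 else 0) * indet v)" by (rule sum.cong) auto
    finally show "f \<in> ?L" by (intro CollectI exI)
  qed
  ultimately show ?thesis using assms unfolding graded_max_ideal_def genideal_type_ring by blast
qed


section \<open>Bounds for the depth\<close>

text \<open>Properness of the final ideal is automatic, as \<open>J\<close> and the sequence lie in
  \<open>graded_max_ideal\<close>, which does not contain 1.\<close>

lemma depth_quotient_ge:
  fixes J :: "('n, 'k::field) mpoly set"
  assumes "is_ideal J" "J \<subseteq> graded_max_ideal" "set fs \<subseteq> graded_max_ideal" "weakly_regular J fs"
  shows "enat (length fs) \<le> depth_quotient J"
proof -
  have "Idl\<^bsub>poly_ring\<^esub> (J \<union> set fs) \<subseteq> graded_max_ideal"
    using assms(2,3) is_ideal_genideal unfolding graded_max_ideal_def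
    by (auto simp: genideal_type_ring[of "J \<union> set fs"])
  moreover have "1 \<notin> (graded_max_ideal :: ('n, 'k) mpoly set)"
    by (simp add: graded_max_ideal_eq mono_ideal_def)
  ultimately have "Idl\<^bsub>poly_ring\<^esub> (J \<union> set fs) \<noteq> UNIV" by blast
  then show ?thesis
    unfolding depth_quotient_def using assms
    by (intro SUP_upper) (simp add: regular_sequence_mod_iff)
qed

lemma depth_quotient_le:
  fixes J :: "('n, 'k::field) mpoly set"
  assumes "is_ideal J"
    and "\<And>fs. set fs \<subseteq> graded_max_ideal \<Longrightarrow> weakly_regular J fs \<Longrightarrow> length fs \<le> s"
  shows "depth_quotient J \<le> enat s"
  unfolding depth_quotient_def
proof (rule SUP_least)
  fix fs :: "('n, 'k) mpoly list"
  assume "fs \<in> {fs. set fs \<subseteq> graded_max_ideal \<and> regular_sequence_mod J fs}"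
  then have "set fs \<subseteq> graded_max_ideal" "weakly_regular J fs"
    using regular_sequence_mod_iff[OF assms(1)] by blast+
  then show "enat (length fs) \<le> enat s" using assms(2) by simp
qed


section \<open>Grading\<close>

definition edeg :: "('n::finite \<Rightarrow>\<^sub>0 nat) \<Rightarrow> nat" where
  "edeg m = (\<Sum>i\<in>UNIV. lookup m i)"

definition hcomp :: "nat \<Rightarrow> ('n::finite, 'k::field) mpoly \<Rightarrow> ('n, 'k) mpoly" where
  "hcomp d f = (\<Sum>m | m \<in> keys f \<and> edeg m = d. single m (lookup f m))"

definition homogeneous :: "nat \<Rightarrow> ('n::finite, 'k::field) mpoly \<Rightarrow> bool" where
  "homogeneous e f \<longleftrightarrow> (\<forall>m\<in>keys f. edeg m = e)"

definition graded :: "('n::finite, 'k::field) mpoly set \<Rightarrow> bool" where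
  "graded J \<longleftrightarrow> (\<forall>f\<in>J. \<forall>d. hcomp d f \<in> J)"

lemma edeg_add [simp]: "edeg (a + b) = edeg a + edeg b"
  by (simp add: edeg_def lookup_add sum.distrib)

lemma lookup_hcomp: "lookup (hcomp d f) k = (if edeg k = d then lookup f k else 0)"
proof -
  have "lookup (hcomp d f) k =
      (\<Sum>m | m \<in> keys f \<and> edeg m = d. if m = k then lookup f m else 0)"
    unfolding hcomp_def lookup_sum by (rule sum.cong) (auto simp: lookup_single when_def)
  also have "\<dots> = (if k \<in> {m \<in> keys f. edeg m = d} then lookup f k else 0)"
    by simp
  finally show ?thesis by (auto simp: in_keys_iff)
qed

lemma hcomp_add: "hcomp d (f + g) = hcomp d f + hcomp d g"
  by (rule poly_mapping_eqI) (simp add: lookup_hcomp lookup_add)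

lemma keys_hcomp: "keys (hcomp d f) = {m \<in> keys f. edeg m = d}"
  by (auto simp: in_keys_iff lookup_hcomp split: if_splits)

lemma hcomp_homogeneous: "homogeneous e f \<Longrightarrow> hcomp e f = f"
  by (rule poly_mapping_eqI) (auto simp: lookup_hcomp homogeneous_def in_keys_iff)

lemma hcomp_eq_0: "(\<And>m. m \<in> keys f \<Longrightarrow> edeg m \<noteq> d) \<Longrightarrow> hcomp d f = 0"
  by (rule poly_mapping_eqI) (auto simp: lookup_hcomp in_keys_iff)

lemma hcomp_mult:
  assumes "homogeneous e f"
  shows "hcomp d (f * g) = (if d < e then 0 else f * hcomp (d - e) g)"
proof (cases "d < e")
  case True
  then show ?thesis
    using keys_mult[of f g] assms by (auto simp: homogeneous_def intro!: hcomp_eq_0 dest!: subsetD[OF keys_mult])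
next
  case False
  define r where "r = g - hcomp (d - e) g"
  have r: "edeg m \<noteq> d - e" if "m \<in> keys r" for m
    using that by (auto simp: r_def in_keys_iff lookup_minus lookup_hcomp)
  have "hcomp d (f * hcomp (d - e) g) = f * hcomp (d - e) g"
  proof (rule hcomp_homogeneous, unfold homogeneous_def, rule ballI)
    fix m assume "m \<in> keys (f * hcomp (d - e) g)"
    then obtain a b where "m = a + b" "a \<in> keys f" "b \<in> keys (hcomp (d - e) g)"
      using keys_mult by blast
    then show "edeg m = d" using assms False by (simp add: homogeneous_def keys_hcomp)
  qed
  moreover have "hcomp d (f * r) = 0"
  proof (rule hcomp_eq_0)
    fix m assume "m \<in> keys (f * r)"
    then obtain a b where "m = a + b" "a \<in> keys f" "b \<in> keys r"
      using keys_mult by blast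
    then show "edeg m \<noteq> d" using assms False r[of b] by (auto simp: homogeneous_def)
  qed
  moreover have "f * g = f * hcomp (d - e) g + f * r" by (simp add: r_def algebra_simps)
  ultimately show ?thesis using False by (simp add: hcomp_add)
qed

lemma homogeneous_one: "homogeneous 0 (1 :: ('n::finite, 'k::field) mpoly)"
  by (simp add: homogeneous_def edeg_def)

lemma homogeneous_mult:
  assumes "homogeneous d f" "homogeneous e g"
  shows "homogeneous (d + e) (f * g)"
  unfolding homogeneous_def
proof
  fix m assume "m \<in> keys (f * g)"
  then obtain a b where "m = a + b" "a \<in> keys f" "b \<in> keys g"
    using keys_mult by blast
  then show "edeg m = d + e" using assms by (simp add: homogeneous_def)
qed

lemma homogeneous_power: "homogeneous e f \<Longrightarrow> homogeneous (N * e) (f ^ N)"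
  by (induction N) (simp_all add: homogeneous_one homogeneous_mult)

lemma homogeneous_sum: "(\<And>i. i \<in> A \<Longrightarrow> homogeneous e (f i)) \<Longrightarrow> homogeneous e (sum f A)"
proof (induction A rule: infinite_finite_induct)
  case (insert a A)
  then have "homogeneous e (f a)" "homogeneous e (sum f A)" by auto
  then show ?case using insert.hyps keys_add[of "f a" "sum f A"] unfolding homogeneous_def by auto
qed (simp_all add: homogeneous_def)

lemma in_ideal_if_hcomp:
  assumes "is_ideal J" "\<And>d. hcomp d f \<in> J"
  shows "f \<in> J"
proof -
  let ?D = "edeg ` keys f"
  have "f = (\<Sum>d\<in>?D. hcomp d f)"
  proof (rule poly_mapping_eqI)
    fix k
    show "lookup f k = lookup (\<Sum>d\<in>?D. hcomp d f) k"
      by (auto simp: lookup_sum lookup_hcomp in_keys_iff)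
  qed
  moreover have "(\<Sum>d\<in>?D. hcomp d f) \<in> J" by (rule ideal_sum[OF assms])
  ultimately show ?thesis by simp
qed

lemma graded_mono_ideal: "graded (mono_ideal U)"
  by (auto simp: graded_def mono_ideal_def keys_hcomp)

lemma graded_adjoin:
  assumes "is_ideal J" "graded J" "homogeneous e f"
  shows "graded (adjoin J f)"
  unfolding graded_def
proof (intro ballI allI)
  fix g d assume "g \<in> adjoin J f"
  then obtain a b where g: "g = a + f * b" "a \<in> J" by (auto simp: adjoin_def)
  have a: "hcomp d a \<in> J" using g(2) assms(2) by (simp add: graded_def)
  show "hcomp d g \<in> adjoin J f"
  proof (cases "d < e")
    case True
    then show ?thesis using a subset_adjoin[of J f] by (auto simp: g hcomp_add hcomp_mult[OF assms(3)])
  next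
    case False
    then show ?thesis using a by (auto simp: g hcomp_add hcomp_mult[OF assms(3)] adjoin_def)
  qed
qed

text \<open>A graded form of Krull's intersection theorem: in degree d, a multiple of a power of
  \<open>x\<close> with exponent above d contributes nothing, so the component of \<open>a\<close>
  is that of an element of \<open>J\<close>.\<close>

lemma graded_separated:
  assumes "is_ideal J" "graded J" "homogeneous e x" "e > 0"
    and "\<And>N. \<exists>b. a - x ^ N * b \<in> J"
  shows "a \<in> J"
proof (rule in_ideal_if_hcomp[OF assms(1)])
  fix d
  obtain b where b: "a - x ^ Suc d * b \<in> J" using assms(5) by blast
  have "d < Suc d * e" using assms(4) by (cases e) auto
  then have "hcomp d (x ^ Suc d * b) = 0" by (simp only: hcomp_mult[OF homogeneous_power[OF assms(3)]] if_True)
  moreover have "hcomp d ((a - x ^ Suc d * b) + x ^ Suc d * b) =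
      hcomp d (a - x ^ Suc d * b) + hcomp d (x ^ Suc d * b)" by (rule hcomp_add)
  moreover have "hcomp d (a - x ^ Suc d * b) \<in> J" using b assms(2) by (simp add: graded_def)
  ultimately show "hcomp d a \<in> J" by simp
qed

lemma weakly_regular_append:
  "weakly_regular J (fs @ gs) \<longleftrightarrow> weakly_regular J fs \<and> weakly_regular (foldl adjoin J fs) gs"
  by (induction fs arbitrary: J) auto

lemma foldl_adjoin_ideal: "is_ideal J \<Longrightarrow> is_ideal (foldl adjoin J fs)"
  by (induction fs arbitrary: J) (auto intro: ideal_adjoin)

lemma foldl_adjoin_subset: "J \<subseteq> foldl adjoin J fs"
  by (induction fs arbitrary: J) (use subset_adjoin in fastforce)+

text \<open>A nonzerodivisor at the front of a regular sequence may be moved to its end. For general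
  rings this fails; here homogeneity and the positive degree of \<open>x\<close> let
  \<open>graded_separated\<close> replace Nakayama's lemma. The result transfers regularity from
  \<open>adjoin J x\<close> down to \<open>J\<close>.\<close>

lemma weakly_regular_permute:
  fixes x :: "('n::finite, 'k::field) mpoly"
  assumes "is_ideal J" "graded J" "homogeneous e x" "e > 0" "\<And>a. x * a \<in> J \<Longrightarrow> a \<in> J"
    and "weakly_regular (adjoin J x) fs" "\<And>f. f \<in> set fs \<Longrightarrow> \<exists>d. homogeneous d f"
  shows "weakly_regular J fs \<and> (\<forall>a. x * a \<in> foldl adjoin J fs \<longrightarrow> a \<in> foldl adjoin J fs)"
  using assms(1,2,5-)
proof (induction fs arbitrary: J)
  case (Cons f fs)
  note J = \<open>is_ideal J\<close>
  have reg: "\<exists>j b'. j \<in> J \<and> b = j + x * b'" if "f * b \<in> adjoin J x" for b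
    using Cons.prems(4) that by (auto simp: adjoin_def)
  have nzd: "a \<in> J" if "f * a \<in> J" for a
  proof (rule graded_separated[OF J \<open>graded J\<close> assms(3,4)])
    fix N
    \<comment> \<open>Modulo \<open>J\<close>, the element \<open>a\<close> can be divided by
      \<open>x\<close> again and again, because each quotient is still annihilated by
      \<open>f\<close>.\<close>
    have "\<exists>b. a - x ^ N * b \<in> J \<and> f * b \<in> J"
    proof (induction N)
      case 0
      show ?case using that ideal_0[OF J] by (intro exI[of _ a]) simp
    next
      case (Suc N)
      then obtain b where b: "a - x ^ N * b \<in> J" "f * b \<in> J" by blast
      have "f * b \<in> adjoin J x" using b(2) subset_adjoin by (rule rev_subsetD)
      then obtain j b' where b': "j \<in> J" "b = j + x * b'" using reg by blast
      have "x * (f * b') = f * b - f * j" using b'(2) by (simp add: algebra_simps)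
      also have "\<dots> \<in> J" by (rule ideal_diff[OF J b(2) ideal_mult[OF J b'(1)]])
      finally have "f * b' \<in> J" by (rule Cons.prems(3))
      moreover have "a - x ^ Suc N * b' = (a - x ^ N * b) + x ^ N * j"
        using b'(2) by (simp add: algebra_simps)
      moreover have "(a - x ^ N * b) + x ^ N * j \<in> J" by (rule ideal_add[OF J b(1) ideal_mult[OF J b'(1)]])
      ultimately show ?case by (intro exI[of _ b']) (simp only: simp_thms)
    qed
    then show "\<exists>b. a - x ^ N * b \<in> J" by blast
  qed
  \<comment> \<open>A relation between \<open>x\<close> and \<open>f\<close> modulo \<open>J\<close>
    is trivial: \<open>b\<close> is a multiple of \<open>x\<close> modulo \<open>J\<close>, and
    cancelling \<open>x\<close> makes \<open>a\<close> a multiple of \<open>f\<close>.\<close>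
  have nzd_x: "a \<in> adjoin J f" if xa: "x * a \<in> adjoin J f" for a
  proof -
    obtain j b where jb: "x * a = j + f * b" "j \<in> J" using xa unfolding adjoin_def by blast
    have "f * b = - j + x * a" using jb(1) by simp
    then have "f * b \<in> adjoin J x" using ideal_uminus[OF J jb(2)] unfolding adjoin_def by blast
    then obtain j' b' where b': "j' \<in> J" "b = j' + x * b'" using reg by blast
    have "x * (a - f * b') = j + f * j'" using jb(1) b'(2) by (simp add: algebra_simps)
    also have "\<dots> \<in> J" by (rule ideal_add[OF J jb(2) ideal_mult[OF J b'(1)]])
    finally have "a - f * b' \<in> J" by (rule Cons.prems(3))
    moreover have "a = (a - f * b') + f * b'" by simp
    ultimately show ?thesis unfolding adjoin_def by blast
  qed
  obtain d where d: "homogeneous d f" using Cons.prems(5)[of f] by auto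
  have "weakly_regular (adjoin J f) fs \<and>
      (\<forall>a. x * a \<in> foldl adjoin (adjoin J f) fs \<longrightarrow> a \<in> foldl adjoin (adjoin J f) fs)"
  proof (rule Cons.IH)
    show "is_ideal (adjoin J f)" by (rule ideal_adjoin[OF J])
    show "graded (adjoin J f)" by (rule graded_adjoin[OF J \<open>graded J\<close> d])
    show "weakly_regular (adjoin (adjoin J f) x) fs" using Cons.prems(4) by (simp add: adjoin_commute[of J f x])
    show "\<exists>d. homogeneous d g" if "g \<in> set fs" for g using Cons.prems(5) that by simp
  qed (rule nzd_x)
  then show ?case using nzd by simp
qed simp


section \<open>Squarefree monomial ideals\<close>

definition ind :: "'n::finite set \<Rightarrow> 'n \<Rightarrow>\<^sub>0 nat" where
  "ind F = (\<Sum>i\<in>F. single i 1)"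

lemma lookup_ind: "lookup (ind F) i = (if i \<in> F then 1 else 0)"
  by (simp add: ind_def lookup_sum lookup_single when_def)

lemma keys_ind [simp]: "keys (ind F) = F"
  by (auto simp: in_keys_iff lookup_ind split: if_splits)

lemma ind_singleton: "ind {i} = single i 1"
  by (simp add: ind_def)

lemma edeg_ind: "edeg (ind F) = card F"
  by (simp add: edeg_def lookup_ind flip: sum.inter_filter)

lemma keys_add_nat: "keys (a + b :: 'n \<Rightarrow>\<^sub>0 nat) = keys a \<union> keys b"
  by (auto simp: in_keys_iff lookup_add)

lemma edvd_iff: "(\<exists>q. m = a + q) \<longleftrightarrow> (\<forall>i. lookup a i \<le> lookup (m :: 'n \<Rightarrow>\<^sub>0 nat) i)"
proof
  assume "\<forall>i. lookup a i \<le> lookup m i"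
  then have "m = a + (m - a)" by (intro poly_mapping_eqI) (simp add: lookup_add lookup_minus)
  then show "\<exists>q. m = a + q" ..
qed (auto simp: lookup_add)

lemma ind_edvd_iff: "(\<exists>q. m = ind F + q) \<longleftrightarrow> F \<subseteq> keys m"
  unfolding edvd_iff by (auto simp: lookup_ind in_keys_iff Suc_le_eq)

text \<open>The exponent set of the squarefree ideal generated by the monomials of
  \<open>\<F>\<close>. Arbitrary families are allowed since splitting destroys the antichain
  property; the empty set as a member gives the whole ring.\<close>

definition fam_up :: "'n set set \<Rightarrow> ('n::finite \<Rightarrow>\<^sub>0 nat) set" where
  "fam_up \<F> = {m. \<exists>F\<in>\<F>. F \<subseteq> keys m}"

lemma fam_up_eq: "fam_up \<F> = up_closure (ind ` \<F>)"
proof -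
  have "fam_up \<F> = {m. \<exists>F\<in>\<F>. \<exists>q. m = ind F + q}" by (simp add: fam_up_def ind_edvd_iff)
  then show ?thesis by (auto simp: up_closure_def)
qed

lemma up_closed_fam_up [simp]: "up_closed (fam_up \<F>)"
  by (simp add: fam_up_eq)

lemma ideal_fam_up [simp]: "is_ideal (mono_ideal (fam_up \<F>))"
  by (rule ideal_mono_ideal) simp

lemma weakly_regular_UNIV: "weakly_regular UNIV fs"
proof (induction fs)
  case (Cons f fs)
  have "adjoin UNIV f = UNIV" using subset_adjoin[of UNIV f] by auto
  then show ?case using Cons by simp
qed simp

text \<open>The colon by the variable \<open>x\<close> deletes \<open>x\<close> from every
  generator, and adjoining \<open>x\<close> makes every generator through \<open>x\<close>
  redundant.\<close>

lemma weakly_regular_fam_split: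
  assumes "weakly_regular (mono_ideal (fam_up ((\<lambda>F. F - {x}) ` \<F>)) :: ('n::finite, 'k::field) mpoly set) fs"
    and "weakly_regular (mono_ideal (fam_up (insert {x} {F\<in>\<F>. x \<notin> F})) :: ('n, 'k) mpoly set) fs"
  shows "weakly_regular (mono_ideal (fam_up \<F>) :: ('n, 'k) mpoly set) fs"
proof (rule weakly_regular_colon_adjoin[where u = "monom (ind {x})"])
  have "{m. ind {x} + m \<in> fam_up \<F>} = fam_up ((\<lambda>F. F - {x}) ` \<F>)"
    by (auto simp: fam_up_def keys_add_nat)
  then show "weakly_regular (colon (mono_ideal (fam_up \<F>) :: ('n, 'k) mpoly set) (monom (ind {x}))) fs"
    using assms(1) by (simp add: colon_mono_ideal)
  have "fam_up \<F> \<union> up_closure {ind {x}} = fam_up (insert {x} {F\<in>\<F>. x \<notin> F})"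
    using fam_up_eq[of "{{x}}"] by (auto simp: fam_up_def)
  then show "weakly_regular (adjoin (mono_ideal (fam_up \<F>) :: ('n, 'k) mpoly set) (monom (ind {x}))) fs"
    using assms(2) by (simp add: adjoin_mono_ideal)
qed simp

definition var_fam :: "'n set \<Rightarrow> 'n set set" where
  "var_fam A = (\<lambda>a. {a}) ` A"

text \<open>
  Splitting off one variable at a time filters the quotient by quotients modulo monomial primes.
  Neither of the two splitting families is larger than the original one.
\<close>

lemma weakly_regular_fam:
  assumes "\<And>A. card A \<le> s \<Longrightarrow> weakly_regular (mono_ideal (fam_up (var_fam A)) :: ('n::finite, 'k::field) mpoly set) fs"
    and "card \<F> \<le> s"
  shows "weakly_regular (mono_ideal (fam_up \<F>) :: ('n, 'k) mpoly set) fs"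
  using assms(2)
\<comment> \<open>The measure counts the vertices of generators with at least two elements.
  Splitting at such a vertex \<open>x\<close> removes it from this set in both families.\<close>
proof (induction "card (\<Union>{F\<in>\<F>. card F \<ge> 2})" arbitrary: \<F> rule: less_induct)
  case (less \<F>)
  show ?case
  proof (cases "\<exists>F\<in>\<F>. card F \<ge> 2")
    case True
    then obtain F where F: "F \<in> \<F>" "card F \<ge> 2" by blast
    then obtain x where x: "x \<in> F" by fastforce
    let ?A = "(\<lambda>F. F - {x}) ` \<F>" and ?B = "insert {x} {F\<in>\<F>. x \<notin> F}"
    show ?thesis
    proof (rule weakly_regular_fam_split)
      have "\<Union>{G\<in>?A. card G \<ge> 2} \<subseteq> \<Union>{G\<in>\<F>. card G \<ge> 2} - {x}"
      proof
        fix y assume "y \<in> \<Union>{G\<in>?A. card G \<ge> 2}"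
        then obtain G where G: "G \<in> \<F>" "y \<in> G - {x}" "card (G - {x}) \<ge> 2" by auto
        then have "card G \<ge> 2" by (metis card_mono Diff_subset finite order_trans)
        then show "y \<in> \<Union>{G\<in>\<F>. card G \<ge> 2} - {x}" using G by auto
      qed
      moreover have "x \<in> \<Union>{G\<in>\<F>. card G \<ge> 2}" using F x by blast
      ultimately have "\<Union>{G\<in>?A. card G \<ge> 2} \<subset> \<Union>{G\<in>\<F>. card G \<ge> 2}" by blast
      moreover have "card ?A \<le> s" using card_image_le[of \<F> "\<lambda>F. F - {x}"] less.prems by simp
      ultimately show "weakly_regular (mono_ideal (fam_up ?A) :: ('n, 'k) mpoly set) fs"
        by (intro less.hyps psubset_card_mono) simp_all
      have "\<Union>{G\<in>?B. card G \<ge> 2} \<subseteq> \<Union>{G\<in>\<F>. card G \<ge> 2} - {x}" by auto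
      then have "\<Union>{G\<in>?B. card G \<ge> 2} \<subset> \<Union>{G\<in>\<F>. card G \<ge> 2}" using F x by blast
      moreover have "card ?B \<le> s"
      proof -
        have "card {F\<in>\<F>. x \<notin> F} < card \<F>" using F x by (intro psubset_card_mono) auto
        then show ?thesis using less.prems card_insert_le_m1[of s "{F\<in>\<F>. x \<notin> F}" "{x}"]
          by (simp add: card_insert_if)
      qed
      ultimately show "weakly_regular (mono_ideal (fam_up ?B) :: ('n, 'k) mpoly set) fs"
        by (intro less.hyps psubset_card_mono) simp_all
    qed
  next
    \<comment> \<open>All generators are now empty or singletons, so the ideal is the whole ring or
      a monomial prime.\<close>
    case False
    show ?thesis
    proof (cases "{} \<in> \<F>")
      case True
      then have "(mono_ideal (fam_up \<F>) :: ('n, 'k) mpoly set) = UNIV"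
        by (auto simp: mono_ideal_def fam_up_def)
      then show ?thesis by (simp add: weakly_regular_UNIV)
    next
      case ne: False
      have "\<F> \<subseteq> var_fam {a. {a} \<in> \<F>}"
      proof
        fix F assume F: "F \<in> \<F>"
        then have "card F < 2" "card F \<noteq> 0" using False ne by (auto simp: not_le)
        then have "card F = 1" by linarith
        then show "F \<in> var_fam {a. {a} \<in> \<F>}" using F by (auto simp: card_1_singleton_iff var_fam_def)
      qed
      then have \<F>: "\<F> = var_fam {a. {a} \<in> \<F>}" by (auto simp: var_fam_def)
      have "card (var_fam {a. {a} \<in> \<F>}) = card {a. {a} \<in> \<F>}" unfolding var_fam_def by (rule card_image) simp
      then have "card {a. {a} \<in> \<F>} \<le> s" using less.prems \<F> by simp
      then show ?thesis using assms(1) \<F> by metis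
    qed
  qed
qed

text \<open>A covered generator saves one generator in the filtration. Adjoining a vertex
  \<open>x\<close> of \<open>F\<close> replaces \<open>F\<close> and a second generator through
  \<open>x\<close> by \<open>{x}\<close> alone, which leaves at most \<open>s\<close> generators.
  The colon shortens \<open>F\<close>: either generators merge, or the shorter \<open>F\<close> is
  still covered, until it is empty and the ideal is the whole ring.\<close>

lemma weakly_regular_fam_covered:
  assumes "\<And>A. card A \<le> s \<Longrightarrow> weakly_regular (mono_ideal (fam_up (var_fam A)) :: ('n::finite, 'k::field) mpoly set) fs"
    and "card \<F> \<le> Suc s" "F \<in> \<F>" "F \<subseteq> \<Union>(\<F> - {F})"
  shows "weakly_regular (mono_ideal (fam_up \<F>) :: ('n, 'k) mpoly set) fs"
  using assms(2-)
proof (induction "card F" arbitrary: F \<F>)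
  case 0
  then have "(mono_ideal (fam_up \<F>) :: ('n, 'k) mpoly set) = UNIV"
    by (auto simp: mono_ideal_def fam_up_def)
  then show ?case by (simp add: weakly_regular_UNIV)
next
  case (Suc k)
  then obtain x where x: "x \<in> F" by fastforce
  then obtain G where G: "G \<in> \<F>" "G \<noteq> F" "x \<in> G" using Suc.prems by blast
  let ?A = "(\<lambda>F. F - {x}) ` \<F>" and ?B = "insert {x} {F\<in>\<F>. x \<notin> F}"
  show ?case
  proof (rule weakly_regular_fam_split)
    have "card {F\<in>\<F>. x \<notin> F} \<le> card (\<F> - {F, G})" using x G by (intro card_mono) auto
    also have "\<dots> = card \<F> - 2" using G Suc.prems by (simp add: card_Diff_subset)
    finally have "card {F\<in>\<F>. x \<notin> F} \<le> card \<F> - 2" .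
    moreover have "card \<F> \<ge> 2" using G Suc.prems card_mono[of \<F> "{F, G}"] by simp
    ultimately have "card ?B \<le> s" using Suc.prems(1) by (simp add: card_insert_if)
    then show "weakly_regular (mono_ideal (fam_up ?B) :: ('n, 'k) mpoly set) fs"
      by (rule weakly_regular_fam[where s = s, rotated]) (erule assms(1))
    show "weakly_regular (mono_ideal (fam_up ?A) :: ('n, 'k) mpoly set) fs"
    proof (cases "card ?A \<le> s")
      case True
      then show ?thesis by (rule weakly_regular_fam[where s = s, rotated]) (erule assms(1))
    next
      case False
      then have "card ?A = card \<F>" using card_image_le[of \<F> "\<lambda>F. F - {x}"] Suc.prems(1) by simp
      \<comment> \<open>No two generators have merged, so those that cover \<open>F\<close> stay
        different from \<open>F - {x}\<close>.\<close>
      then have inj: "inj_on (\<lambda>F. F - {x}) \<F>" by (intro eq_card_imp_inj_on) auto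
      show ?thesis
      proof (rule Suc.hyps(1))
        show "k = card (F - {x})" using x Suc.hyps(2) by simp
        show "card ?A \<le> Suc s" using card_image_le[of \<F> "\<lambda>F. F - {x}"] Suc.prems(1) by simp
        show "F - {x} \<in> ?A" using Suc.prems by blast
        show "F - {x} \<subseteq> \<Union>(?A - {F - {x}})"
        proof
          fix y assume y: "y \<in> F - {x}"
          then obtain H where H: "H \<in> \<F>" "H \<noteq> F" "y \<in> H" using Suc.prems(3) by blast
          then have "H - {x} \<noteq> F - {x}" using inj_onD[OF inj, of H F] Suc.prems(2) by blast
          then show "y \<in> \<Union>(?A - {F - {x}})" using y H by blast
        qed
      qed
    qed
  qed
qed


section \<open>Elementary symmetric polynomials as regular sequences\<close>

definition esym :: "nat \<Rightarrow> ('n::finite, 'k::field) mpoly" where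
  "esym i = (\<Sum>\<sigma> | card \<sigma> = i. monom (ind \<sigma>))"

definition esyms :: "nat \<Rightarrow> ('n::finite, 'k::field) mpoly list" where
  "esyms t = map esym [1..<Suc t]"

lemma homogeneous_esym: "homogeneous i (esym i)"
  unfolding esym_def by (rule homogeneous_sum) (simp add: homogeneous_def edeg_ind)

lemma homogeneous_esyms: "f \<in> set (esyms t) \<Longrightarrow> \<exists>d. homogeneous d f"
  using homogeneous_esym by (auto simp: esyms_def)

lemma esyms_subset_max_ideal: "set (esyms t) \<subseteq> (graded_max_ideal :: ('n::finite, 'k::field) mpoly set)"
proof
  fix f :: "('n, 'k) mpoly" assume "f \<in> set (esyms t)"
  then obtain i where i: "f = esym i" "i \<ge> 1" by (auto simp: esyms_def)
  show "f \<in> graded_max_ideal"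
    unfolding i esym_def graded_max_ideal_eq
  proof (rule ideal_sum[OF ideal_mono_ideal[OF up_closed_nonzero]])
    fix \<sigma> :: "'n set" assume "\<sigma> \<in> {\<sigma>. card \<sigma> = i}"
    then have "\<sigma> \<noteq> {}" using i by auto
    then show "(monom (ind \<sigma>) :: ('n, 'k) mpoly) \<in> mono_ideal (- {0})"
      by (metis ComplI keys_ind keys_zero monom_in_mono_ideal singletonD)
  qed
qed

lemma length_esyms: "length (esyms t) = t"
  by (simp add: esyms_def)

lemma mem_var_fam_up: "m \<in> fam_up (var_fam A) \<longleftrightarrow> keys m \<inter> A \<noteq> {}"
  by (auto simp: fam_up_def var_fam_def)

text \<open>Modulo the prime of \<open>A\<close>, a variable \<open>x\<close> outside
  \<open>A\<close> is a homogeneous nonzerodivisor. So \<open>weakly_regular_permute\<close> pulls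
  regularity back from the prime of \<open>insert x A\<close>.\<close>

lemma weakly_regular_var_fam_smaller:
  assumes "\<And>A. card A = s \<Longrightarrow> weakly_regular (mono_ideal (fam_up (var_fam A)) :: ('n::finite, 'k::field) mpoly set) fs"
    and "\<And>f. f \<in> set fs \<Longrightarrow> \<exists>d. homogeneous d f" "s \<le> card (UNIV :: 'n set)" "card A \<le> s"
  shows "weakly_regular (mono_ideal (fam_up (var_fam A)) :: ('n, 'k) mpoly set) fs"
  using assms(4)
proof (induction "s - card A" arbitrary: A)
  case 0
  then show ?case using assms(1) by simp
next
  case (Suc k)
  then have "card A < card (UNIV :: 'n set)" using assms(3) by simp
  then obtain x where x: "x \<notin> A" by (metis UNIV_eq_I less_irrefl)
  let ?P = "mono_ideal (fam_up (var_fam A)) :: ('n, 'k) mpoly set"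
  have "fam_up (var_fam A) \<union> up_closure {ind {x}} = fam_up (var_fam (insert x A))"
    using fam_up_eq[of "{{x}}"] by (auto simp: fam_up_def var_fam_def)
  then have "adjoin ?P (monom (ind {x})) = mono_ideal (fam_up (var_fam (insert x A)))"
    by (simp add: adjoin_mono_ideal)
  moreover have "weakly_regular (mono_ideal (fam_up (var_fam (insert x A))) :: ('n, 'k) mpoly set) fs"
    by (rule Suc.hyps(1)) (use Suc.hyps(2) Suc.prems x in auto)
  ultimately have "weakly_regular (adjoin ?P (monom (ind {x}))) fs" by simp
  moreover have "a \<in> ?P" if "monom (ind {x}) * a \<in> ?P" for a :: "('n, 'k) mpoly"
    using that x by (auto simp: mono_ideal_def keys_monom_mult mem_var_fam_up keys_add_nat)
  moreover have "homogeneous 1 (monom (ind {x}) :: ('n, 'k) mpoly)" by (simp add: homogeneous_def edeg_ind)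
  ultimately show ?case
    using weakly_regular_permute[of ?P 1 "monom (ind {x})" fs] assms(2) by (simp add: graded_mono_ideal)
qed

text \<open>Modulo the prime of a set \<open>B\<close> with n - t - 1 elements only t + 1 variables
  remain, and the symmetric polynomial of degree t + 1 becomes their product. Adjoining this product
  gives a squarefree ideal with at most n - t generators, on which the first t symmetric polynomials
  are regular by the filtration and the induction hypothesis. Then the product is moved to the end
  of the sequence.\<close>

lemma weakly_regular_esyms_var_fam:
  assumes "t \<le> card (UNIV :: 'n::finite set)" "card A \<le> card (UNIV :: 'n set) - t"
  shows "weakly_regular (mono_ideal (fam_up (var_fam A)) :: ('n, 'k::field) mpoly set) (esyms t)"
  using assms
proof (induction t arbitrary: A)
  case 0
  then show ?case by (simp add: esyms_def)
next
  case (Suc t)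
  have "weakly_regular (mono_ideal (fam_up (var_fam B)) :: ('n, 'k) mpoly set) (esyms (Suc t))"
    if B: "card B = card (UNIV :: 'n set) - Suc t" for B :: "'n set"
  proof -
    let ?P = "mono_ideal (fam_up (var_fam B)) :: ('n, 'k) mpoly set"
    let ?x = "monom (ind (- B)) :: ('n, 'k) mpoly"
    have cB: "card (- B) = Suc t" using B Suc.prems(1) by (simp add: Compl_eq_Diff_UNIV card_Diff_subset)
    have "fam_up (var_fam B) \<union> up_closure {ind (- B)} = fam_up (insert (- B) (var_fam B))"
      using fam_up_eq[of "{- B}"] by (auto simp: fam_up_def)
    then have "adjoin ?P ?x = mono_ideal (fam_up (insert (- B) (var_fam B)))"
      by (simp add: adjoin_mono_ideal)
    moreover have "weakly_regular (mono_ideal (fam_up (insert (- B) (var_fam B))) :: ('n, 'k) mpoly set) (esyms t)"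
    proof (rule weakly_regular_fam)
      show "weakly_regular (mono_ideal (fam_up (var_fam A)) :: ('n, 'k) mpoly set) (esyms t)"
        if "card A \<le> card (UNIV :: 'n set) - t" for A using Suc.IH that Suc.prems by simp
      have "card (var_fam B) \<le> card B" unfolding var_fam_def by (rule card_image_le) simp
      moreover have "card (insert (- B) (var_fam B)) \<le> Suc (card (var_fam B))" by (simp add: card_insert_if)
      ultimately show "card (insert (- B) (var_fam B)) \<le> card (UNIV :: 'n set) - t"
        using B Suc.prems(1) by linarith
    qed
    ultimately have "weakly_regular (adjoin ?P ?x) (esyms t)" by simp
    moreover have "a \<in> ?P" if "?x * a \<in> ?P" for a :: "('n, 'k) mpoly"
    proof -
      have "(+) (ind (- B)) ` keys a \<subseteq> fam_up (var_fam B)"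
        using that by (simp add: mono_ideal_def keys_monom_mult)
      then have "ind (- B) + m \<in> fam_up (var_fam B)" if "m \<in> keys a" for m using that by blast
      then have "m \<in> fam_up (var_fam B)" if "m \<in> keys a" for m
        using that by (auto simp: mem_var_fam_up keys_add_nat)
      then show ?thesis by (auto simp: mono_ideal_def)
    qed
    moreover have "homogeneous (Suc t) ?x" using cB by (simp add: homogeneous_def edeg_ind)
    ultimately have "weakly_regular ?P (esyms t) \<and>
        (\<forall>a. ?x * a \<in> foldl adjoin ?P (esyms t) \<longrightarrow> a \<in> foldl adjoin ?P (esyms t))"
      by (intro weakly_regular_permute[where e = "Suc t" and x = ?x] ideal_fam_up graded_mono_ideal homogeneous_esyms) simp_all
    then have perm: "weakly_regular ?P (esyms t)"
      "\<And>a. ?x * a \<in> foldl adjoin ?P (esyms t) \<Longrightarrow> a \<in> foldl adjoin ?P (esyms t)" by blast+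
    let ?L = "foldl adjoin ?P (esyms t)"
    have L: "is_ideal ?L" by (intro foldl_adjoin_ideal) simp
    \<comment> \<open>Every other set of size \<open>Suc t\<close> meets \<open>B\<close>, so its
      monomial lies in \<open>?P\<close>.\<close>
    have "esym (Suc t) - ?x = (\<Sum>\<sigma> \<in> {\<sigma>. card \<sigma> = Suc t} - {- B}. monom (ind \<sigma>))"
      using cB by (simp add: esym_def sum_diff1)
    also have "\<dots> \<in> ?P"
    proof (rule ideal_sum)
      fix \<sigma> assume "\<sigma> \<in> {\<sigma>. card \<sigma> = Suc t} - {- B}"
      then have "\<not> \<sigma> \<subseteq> - B" using cB card_subset_eq[of "- B" \<sigma>] by auto
      then show "(monom (ind \<sigma>) :: ('n, 'k) mpoly) \<in> ?P" by (auto simp: mem_var_fam_up)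
    qed simp
    finally have diff: "esym (Suc t) - ?x \<in> ?L" using foldl_adjoin_subset by blast
    have "a \<in> ?L" if "esym (Suc t) * a \<in> ?L" for a
    proof (rule perm(2))
      have "?x * a = esym (Suc t) * a - (esym (Suc t) - ?x) * a" by (simp add: algebra_simps)
      then show "?x * a \<in> ?L" using ideal_diff[OF L that ideal_mult_right[OF L diff]] by simp
    qed
    moreover have "(esyms (Suc t) :: ('n, 'k) mpoly list) = esyms t @ [esym (Suc t)]" by (simp add: esyms_def)
    ultimately show ?thesis using perm(1) by (simp only: weakly_regular_append weakly_regular.simps) blast
  qed
  then show ?case
    by (rule weakly_regular_var_fam_smaller[where s = "card (UNIV :: 'n set) - Suc t"])
      (use homogeneous_esyms Suc.prems in auto)
qed


section \<open>Powers\<close>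

definition pow_up :: "'n::finite set set \<Rightarrow> nat \<Rightarrow> ('n \<Rightarrow>\<^sub>0 nat) set" where
  "pow_up \<A> k = {m. \<exists>M. set_mset M \<subseteq> \<A> \<and> size M = k \<and> (\<exists>q. m = (\<Sum>F\<in>#M. ind F) + q)}"

lemma lookup_sum_mset_ind:
  "lookup (\<Sum>F\<in>#M. ind F) i = size {#F \<in># M. i \<in> F#}"
  by (induction M) (auto simp: lookup_add lookup_ind)

lemma mem_pow_up: "m \<in> pow_up \<A> k \<longleftrightarrow>
    (\<exists>M. set_mset M \<subseteq> \<A> \<and> size M = k \<and> (\<forall>i. size {#F \<in># M. i \<in> F#} \<le> lookup m i))"
  by (simp add: pow_up_def edvd_iff lookup_sum_mset_ind)

lemma up_closed_pow_up [simp]: "up_closed (pow_up \<A> k)"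
proof -
  have "pow_up \<A> k = up_closure ((\<lambda>M. \<Sum>F\<in>#M. ind F) ` {M. set_mset M \<subseteq> \<A> \<and> size M = k})"
    by (auto simp: pow_up_def up_closure_def)
  then show ?thesis by simp
qed

lemma pow_up_0 [simp]: "pow_up \<A> 0 = UNIV"
  by (auto simp: mem_pow_up)

lemma pow_up_empty: "k > 0 \<Longrightarrow> pow_up {} k = {}"
  by (auto simp: mem_pow_up)

text \<open>From a product of \<open>Suc k\<close> members dividing \<open>ind F + m\<close>, one
  factor is discarded: \<open>F\<close> itself if it occurs; otherwise a member with the same core,
  which lacks only \<open>v F\<close>, a vertex that occurs in no factor; otherwise any factor,
  since then none of them meets \<open>F\<close>. In each case a vertex of \<open>F\<close> is in
  the discarded factor or in no factor at all.\<close>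

lemma pow_up_colon:
  assumes v: "\<And>F. F \<in> \<A> \<Longrightarrow> v F \<in> F" "\<And>F H. F \<in> \<A> \<Longrightarrow> H \<in> \<A> \<Longrightarrow> F \<noteq> H \<Longrightarrow> v F \<notin> H"
    and w: "\<And>F H. F \<in> \<A> \<Longrightarrow> H \<in> \<A> \<Longrightarrow> F - {v F} = H - {v H} \<or> F \<inter> H = {}"
    and F: "F \<in> \<A>"
  shows "ind F + m \<in> pow_up \<A> (Suc k) \<longleftrightarrow> m \<in> pow_up \<A> k"
proof
  assume "m \<in> pow_up \<A> k"
  then obtain M where "set_mset M \<subseteq> \<A>" "size M = k" "\<And>i. size {#F \<in># M. i \<in> F#} \<le> lookup m i"
    by (auto simp: mem_pow_up)
  then show "ind F + m \<in> pow_up \<A> (Suc k)"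
    unfolding mem_pow_up using F by (intro exI[of _ "add_mset F M"]) (auto simp: lookup_add lookup_ind)
next
  assume "ind F + m \<in> pow_up \<A> (Suc k)"
  then obtain M where M: "set_mset M \<subseteq> \<A>" "size M = Suc k"
    and le: "\<And>i. size {#F \<in># M. i \<in> F#} \<le> (if i \<in> F then 1 else 0) + lookup m i"
    by (auto simp: mem_pow_up lookup_add lookup_ind)
  have zero: "size {#H \<in># M. i \<in> H#} = 0" if "\<And>H. H \<in># M \<Longrightarrow> i \<notin> H" for i
    using that filter_mset_cong[of M M "\<lambda>H. i \<in> H" "\<lambda>_. False"] by simp
  have "\<exists>H. H \<in># M \<and> (\<forall>i\<in>F. i \<in> H \<or> size {#H \<in># M. i \<in> H#} = 0)"
  proof (cases "F \<in># M")
    case True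
    then show ?thesis by blast
  next
    case FM: False
    show ?thesis
    proof (cases "\<exists>H. H \<in># M \<and> F - {v F} = H - {v H}")
      case True
      then obtain H where H: "H \<in># M" "F - {v F} = H - {v H}" by blast
      have "size {#H \<in># M. v F \<in> H#} = 0" using v(2)[OF F] M FM by (intro zero) blast
      then show ?thesis using H by blast
    next
      case False
      obtain H where "H \<in># M" using M(2) by (cases M) auto
      moreover have "size {#H \<in># M. i \<in> H#} = 0" if "i \<in> F" for i
      proof (rule zero)
        fix H assume H: "H \<in># M"
        then have "F \<inter> H = {}" using w[OF F, of H] M(1) False by auto
        then show "i \<notin> H" using that by auto
      qed
      ultimately show ?thesis by blast
    qed
  qed
  then obtain H where H: "H \<in># M" "\<forall>i\<in>F. i \<in> H \<or> size {#H \<in># M. i \<in> H#} = 0" by blast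
  then obtain M' where M': "M = add_mset H M'" by (meson multi_member_split)
  have "size {#F \<in># M'. i \<in> F#} \<le> lookup m i" for i
  proof -
    have e: "size {#F \<in># M. i \<in> F#} = (if i \<in> H then 1 else 0) + size {#F \<in># M'. i \<in> F#}"
      by (simp add: M')
    show ?thesis
    proof (cases "i \<in> F \<and> i \<notin> H")
      case True
      then have "size {#F \<in># M. i \<in> F#} = 0" using H(2) by blast
      then show ?thesis using e by linarith
    next
      case False
      then show ?thesis using le[of i] e by (cases "i \<in> F") simp_all
    qed
  qed
  then show "m \<in> pow_up \<A> k"
    unfolding mem_pow_up using M M' by (intro exI[of _ M']) auto
qed

text \<open>
  Adding a generator \<open>x\<^sub>F\<close> to the power removes \<open>F\<close> from the base of the power, and the colon by
  \<open>x\<^sub>F\<close> lowers the exponent. This keeps the total number of generators and ends at squarefree ideals.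
\<close>

lemma weakly_regular_pow:
  assumes reg: "\<And>A. card A \<le> s \<Longrightarrow> weakly_regular (mono_ideal (fam_up (var_fam A)) :: ('n::finite, 'k::field) mpoly set) fs"
    and v: "\<And>F. F \<in> \<A> \<Longrightarrow> v F \<in> F" "\<And>F H. F \<in> \<A> \<Longrightarrow> H \<in> \<A> \<Longrightarrow> F \<noteq> H \<Longrightarrow> v F \<notin> H"
    and w: "\<And>F H. F \<in> \<A> \<Longrightarrow> H \<in> \<A> \<Longrightarrow> F - {v F} = H - {v H} \<or> F \<inter> H = {}"
    and "card \<A> + card \<B> \<le> s"
  shows "weakly_regular (mono_ideal (pow_up \<A> k \<union> fam_up \<B>) :: ('n, 'k) mpoly set) fs"
  using assms(2-)
proof (induction "card \<A>" arbitrary: \<A> \<B> k)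
  case 0
  then have "\<A> = {}" by simp
  show ?case
  proof (cases k)
    case 0
    then show ?thesis by (simp add: mono_ideal_def weakly_regular_UNIV)
  next
    case Suc
    have "card \<B> \<le> s" using "0.prems" by simp
    then have "weakly_regular (mono_ideal (fam_up \<B>) :: ('n, 'k) mpoly set) fs"
      by (rule weakly_regular_fam[where s = s, rotated]) (erule reg)
    then show ?thesis using Suc \<open>\<A> = {}\<close> by (simp add: pow_up_empty)
  qed
next
  case (Suc c)
  note hyps1 = Suc.hyps and prems1 = Suc.prems
  then obtain F where F: "F \<in> \<A>" by fastforce
  \<comment> \<open>The colon lowers \<open>k\<close> for fixed \<open>\<A>\<close>, while adjoining
    the monomial of \<open>F\<close> keeps the exponent and removes \<open>F\<close> from
    \<open>\<A>\<close>. Hence an induction on \<open>k\<close> inside the one on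
    \<open>card \<A>\<close>; \<open>\<B>\<close> changes in both.\<close>
  show ?case
    using Suc.prems(4)
  proof (induction k arbitrary: \<B>)
    case 0
    then show ?case by (simp add: mono_ideal_def weakly_regular_UNIV)
  next
    case (Suc k)
    let ?J = "mono_ideal (pow_up \<A> (Suc k) \<union> fam_up \<B>) :: ('n, 'k) mpoly set"
    have up: "up_closed (pow_up \<A> (Suc k) \<union> fam_up \<B>)" by (intro up_closed_Un) simp_all
    show ?case
    proof (rule weakly_regular_colon_adjoin[where u = "monom (ind F)"])
      show "is_ideal ?J" by (rule ideal_mono_ideal[OF up])
      have "{m. ind F + m \<in> pow_up \<A> (Suc k) \<union> fam_up \<B>} = pow_up \<A> k \<union> fam_up ((\<lambda>B. B - F) ` \<B>)"
        using pow_up_colon[of \<A> v F, OF prems1(1-3) F]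
        by (auto simp: fam_up_def keys_add_nat)
      moreover have "card ((\<lambda>B. B - F) ` \<B>) \<le> card \<B>" by (rule card_image_le) simp
      ultimately show "weakly_regular (colon ?J (monom (ind F))) fs"
        using Suc by (simp add: colon_mono_ideal)
      have "pow_up \<A> (Suc k) \<union> fam_up \<B> \<union> up_closure {ind F} = pow_up (\<A> - {F}) (Suc k) \<union> fam_up (insert F \<B>)"
      proof -
        have "pow_up \<A> (Suc k) \<subseteq> pow_up (\<A> - {F}) (Suc k) \<union> fam_up {F}"
        proof
          fix m assume "m \<in> pow_up \<A> (Suc k)"
          then obtain M where M: "set_mset M \<subseteq> \<A>" "size M = Suc k"
            and le: "\<And>i. size {#F \<in># M. i \<in> F#} \<le> lookup m i" by (auto simp: mem_pow_up)
          show "m \<in> pow_up (\<A> - {F}) (Suc k) \<union> fam_up {F}"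
          proof (cases "F \<in># M")
            case True
            then obtain M' where "M = add_mset F M'" by (meson multi_member_split)
            then have "lookup m i \<noteq> 0" if "i \<in> F" for i using le[of i] that by auto
            then show ?thesis by (auto simp: fam_up_def in_keys_iff)
          next
            case False
            then show ?thesis using M le by (auto simp: mem_pow_up)
          qed
        qed
        moreover have "pow_up (\<A> - {F}) (Suc k) \<subseteq> pow_up \<A> (Suc k)" unfolding pow_up_def by blast
        moreover have "up_closure {ind F} = fam_up {F}" by (simp add: fam_up_eq)
        moreover have "fam_up (insert F \<B>) = fam_up {F} \<union> fam_up \<B>" by (auto simp: fam_up_def)
        ultimately show ?thesis by blast
      qed
      moreover have "weakly_regular (mono_ideal (pow_up (\<A> - {F}) (Suc k) \<union> fam_up (insert F \<B>)) :: ('n, 'k) mpoly set) fs"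
      proof (rule hyps1(1))
        show "c = card (\<A> - {F})" using hyps1(2) F by simp
        show "card (\<A> - {F}) + card (insert F \<B>) \<le> s"
          using hyps1(2) F Suc.prems by (cases "F \<in> \<B>") (auto simp: insert_absorb)
      qed (use prems1(1-3) in blast)+
      ultimately show "weakly_regular (adjoin ?J (monom (ind F))) fs"
        by (simp add: adjoin_mono_ideal[OF up])
    qed
  qed
qed


section \<open>An upper bound for the depth of powers\<close>

lemma lookup_ksign_mult:
  "lookup (ksign ord v \<sigma> * f) m = ksign ord v \<sigma> * lookup (f :: ('n, 'k::field) mpoly) m"
  by (cases "even (card {w \<in> \<sigma>. ord w < ord v})") (simp_all add: ksign_def)

lemma lookup_indet_mult:
  "lookup (indet v * f) m =
    (if lookup m v = 0 then 0
     else lookup (f :: ('n, 'k::field) mpoly) (m - single v 1))"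
proof (cases "lookup m v = 0")
  case True
  then have "\<nexists>q. m = single v 1 + q" by (auto simp: lookup_add)
  then show ?thesis using True by (simp add: indet_def lookup_single_mult_eq_0)
next
  case False
  then have "m = single v 1 + (m - single v 1)"
    by (intro poly_mapping_eqI) (auto simp: lookup_add lookup_minus lookup_single when_def)
  then have "lookup (indet v * f) m =
      lookup (single (single v 1) 1 * f)
        (single v 1 + (m - single v 1))"
    by (simp add: indet_def)
  also have "\<dots> = lookup f (m - single v 1)"
    by (simp only: lookup_single_mult mult_1)
  finally show ?thesis using False by simp
qed

lemma ksign_Diff:
  fixes ord :: "'v::finite \<Rightarrow> nat"
  assumes "R \<subseteq> W"
  shows "(ksign ord v (W - R) :: 'a::comm_ring_1) = ksign ord v W * ksign ord v R"
proof -
  have "{a \<in> W. ord a < ord v} = {a \<in> W - R. ord a < ord v} \<union> {a \<in> R. ord a < ord v}" using assms by auto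
  moreover have "{a \<in> W - R. ord a < ord v} \<inter> {a \<in> R. ord a < ord v} = {}" by auto
  ultimately have "card {a \<in> W. ord a < ord v} = card {a \<in> W - R. ord a < ord v} + card {a \<in> R. ord a < ord v}"
    by (simp add: card_Un_disjoint)
  then have "(ksign ord v W :: 'a) = ksign ord v (W - R) * ksign ord v R" by (simp add: ksign_def power_add)
  then show ?thesis by (simp add: mult.assoc)
qed

lemma ksign_neq_0: "(ksign ord v \<sigma> :: 'k::field) \<noteq> 0"
  by (simp add: ksign_def)

text \<open>
  The monomial \<open>u = \<Prod>\<^sub>F\<^sub>\<in>\<^sub>M x\<^sub>F\<close> is chosen so that, for each component, \<open>I\<^sup>k\<^sup>+\<^sup>1 : u\<close> contains the
  product of the ideals generated by its colour classes.
\<close>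

locale coloured_family =
  fixes \<A> :: "'n::finite set set" and cmp \<kappa> :: "'n \<Rightarrow> nat" and C d :: nat and G :: "nat \<Rightarrow> 'n set"
    and M :: "'n set multiset" and k :: nat
  assumes facet: "\<And>F. F \<in> \<A> \<Longrightarrow> \<exists>p<C. (\<forall>v\<in>F. cmp v = p) \<and> bij_betw \<kappa> F {..d}"
    and G: "\<And>p. p < C \<Longrightarrow> G p \<in> \<A>" "\<And>p v. p < C \<Longrightarrow> v \<in> G p \<Longrightarrow> cmp v = p"
    and M: "set_mset M \<subseteq> \<A>" "size M = k"
    and transversal: "\<And>p Y. p < C \<Longrightarrow> Y \<subseteq> \<Union>\<A> \<Longrightarrow> (\<And>v. v \<in> Y \<Longrightarrow> cmp v = p) \<Longrightarrow> bij_betw \<kappa> Y {..d}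
      \<Longrightarrow> (\<Sum>F\<in>#M. ind F) + ind Y \<in> pow_up \<A> (Suc k)"
begin

definition V where "V = \<Union>\<A>"

definition u where "u = (\<Sum>F\<in>#M. ind F)"

definition J :: "('n, 'k::field) mpoly set" where "J = mono_ideal (pow_up \<A> (Suc k))"

lemma ideal_J: "is_ideal J"
  unfolding J_def by (rule ideal_mono_ideal) simp

lemma cmp_less: "v \<in> V \<Longrightarrow> cmp v < C"
  unfolding V_def using facet by fastforce

lemma \<kappa>_le: "v \<in> V \<Longrightarrow> \<kappa> v \<le> d"
  unfolding V_def using facet by (fastforce dest: bij_betwE)

lemma G_subset: "p < C \<Longrightarrow> G p \<subseteq> V"
  unfolding V_def using G(1) by blast

lemma bij_G: "p < C \<Longrightarrow> bij_betw \<kappa> (G p) {..d}"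
  using facet[OF G(1)] by blast

lemma lookup_u_outside: "v \<notin> V \<Longrightarrow> lookup u v = 0"
proof -
  assume "v \<notin> V"
  then have "filter_mset (\<lambda>F. v \<in> F) M = filter_mset (\<lambda>_. False) M"
    using M(1) by (intro filter_mset_cong) (auto simp: V_def)
  then show ?thesis by (simp add: u_def lookup_sum_mset_ind)
qed

text \<open>Both sign computations below depend on the order. In \<open>kdiff_cocycle\<close>, two
  vertices with the same component and colour must be adjacent in the given set; in
  \<open>pairing_kdiff\<close>, two vertices of one component must not be separated by those of
  another.\<close>

lemma order_exists:
  "\<exists>ord :: 'n \<Rightarrow> nat. inj ord \<and>
    (\<forall>v\<in>V. \<forall>w\<in>V. cmp v < cmp w \<longrightarrow> ord v < ord w) \<and>
    (\<forall>v\<in>V. \<forall>w\<in>V. cmp v = cmp w \<longrightarrow> \<kappa> v < \<kappa> w \<longrightarrow> ord v < ord w) \<and>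
    (\<forall>v\<in>V. \<forall>z. z \<notin> V \<longrightarrow> ord v < ord z)"
proof -
  define N where "N = card (UNIV :: 'n set)"
  obtain e :: "'n \<Rightarrow> nat" where e: "bij_betw e UNIV {0..<N}"
    using ex_bij_betw_finite_nat[of "UNIV :: 'n set"] by (auto simp: N_def)
  have eN: "e v < N" for v using bij_betwE[OF e] by auto
  have inj_e: "e v = e w \<Longrightarrow> v = w" for v w using bij_betw_imp_inj_on[OF e] by (auto dest: injD)
  \<comment> \<open>As \<open>\<kappa> v \<le> d\<close>, the keys on \<open>V\<close> are below
    \<open>C * (d + 1)\<close>, the common key of all other vertices. The injection \<open>e\<close>
    only breaks ties.\<close>
  define key where "key v = (if v \<in> V then cmp v * (d + 1) + \<kappa> v else C * (d + 1))" for v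
  define ord where "ord v = key v * N + e v" for v
  have key_ord: "ord v < ord w" if "key v < key w" for v w
  proof -
    have "ord v < Suc (key v) * N" using eN[of v] by (simp add: ord_def)
    also have "\<dots> \<le> key w * N" using that by (intro mult_le_mono1) simp
    also have "\<dots> \<le> ord w" by (simp add: ord_def)
    finally show ?thesis .
  qed
  have step: "a * (d + 1) + i < b * (d + 1)" if "a < b" "i \<le> d" for a b i :: nat
  proof -
    have "a * (d + 1) + i < Suc a * (d + 1)" using that by simp
    also have "\<dots> \<le> b * (d + 1)" using that by (intro mult_le_mono1) simp
    finally show ?thesis .
  qed
  show ?thesis
  proof (intro exI[of _ ord] conjI ballI allI impI)
    show "inj ord"
    proof (rule injI)
      fix v w assume vw: "ord v = ord w"
      then have "ord v mod N = ord w mod N" by simp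
      then show "v = w" using eN by (simp add: ord_def inj_e)
    qed
    show "ord v < ord w" if "v \<in> V" "w \<in> V" "cmp v < cmp w" for v w
      using step[OF that(3) \<kappa>_le[OF that(1)]] that by (intro key_ord) (simp add: key_def)
    show "ord v < ord w" if "v \<in> V" "w \<in> V" "cmp v = cmp w" "\<kappa> v < \<kappa> w" for v w
      using that by (intro key_ord) (simp add: key_def)
    show "ord v < ord z" if "v \<in> V" "z \<notin> V" for v z
      using step[OF cmp_less[OF that(1)] \<kappa>_le[OF that(1)]] that by (intro key_ord) (simp add: key_def)
  qed
qed

text \<open>When each component is collapsed to a simplex on the colours 0, ..., d, such a set lies
  over the face opposite to 0 in every simplex. Including all vertices outside \<open>V\<close> puts
  it in degree \<open>card (- V) + C * d\<close>.\<close>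

definition T where "T \<sigma> \<longleftrightarrow> - V \<subseteq> \<sigma> \<and> bij_betw (\<lambda>v. (cmp v, \<kappa> v)) (\<sigma> \<inter> V) ({..<C} \<times> {1..d})"

text \<open>The indicator of one facet generates the top cohomology of the boundary of a simplex.
  This is its pullback under the collapse, joined over the components, with the monomial of
  \<open>\<sigma> \<inter> V\<close> times that of \<open>u\<close> as coefficient.\<close>

definition cocycle :: "'n set \<Rightarrow> ('n, 'k::field) mpoly" where
  "cocycle \<sigma> = (if T \<sigma> then monom (u + ind (\<sigma> \<inter> V)) else 0)"

lemma card_T: "T \<sigma> \<Longrightarrow> card \<sigma> = card (- V) + C * d"
proof -
  assume T: "T \<sigma>"
  then have "card (\<sigma> \<inter> V) = C * d" using bij_betw_same_card by (fastforce simp: T_def)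
  moreover have "\<sigma> = - V \<union> (\<sigma> \<inter> V)" using T by (auto simp: T_def)
  then have "card \<sigma> = card (- V) + card (\<sigma> \<inter> V)" by (metis card_Un_disjoint finite Compl_disjoint2 Int_assoc Int_commute Int_empty_right)
  ultimately show ?thesis by simp
qed

text \<open>
  With the vertices sorted by component and colour, two vertices of the same colour in a set with
  one repetition are adjacent, so their terms in the differential cancel.
\<close>

lemma kdiff_cocycle:
  assumes "inj ord"
    and ord1: "\<And>v w. v \<in> V \<Longrightarrow> w \<in> V \<Longrightarrow> cmp v < cmp w \<Longrightarrow> ord v < ord w"
    and ord2: "\<And>v w. v \<in> V \<Longrightarrow> w \<in> V \<Longrightarrow> cmp v = cmp w \<Longrightarrow> \<kappa> v < \<kappa> w \<Longrightarrow> ord v < ord w"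
    and ord3: "\<And>v z. v \<in> V \<Longrightarrow> z \<notin> V \<Longrightarrow> ord v < ord z"
  shows "kdiff ord indet cocycle \<rho> \<in> (J :: ('n, 'k::field) mpoly set)"
proof -
  \<comment> \<open>A nonzero term drops a vertex whose removal leaves a \<open>T\<close>-set, and
    the variable of this vertex restores the monomial \<open>?m\<close>. So only a sum of signs
    remains as the coefficient of \<open>?m\<close>.\<close>
  define D where "D = {v \<in> \<rho>. T (\<rho> - {v})}"
  let ?m = "monom (u + ind (\<rho> \<inter> V)) :: ('n, 'k) mpoly"
  have DV: "v \<in> V" if "v \<in> D" for v using that by (auto simp: D_def T_def)
  have "kdiff ord indet cocycle \<rho> = (\<Sum>v\<in>\<rho>. if v \<in> D then ksign ord v \<rho> * ?m else 0)"
    unfolding kdiff_def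
  proof (rule sum.cong)
    fix v assume v: "v \<in> \<rho>"
    show "ksign ord v \<rho> * indet v * cocycle (\<rho> - {v}) = (if v \<in> D then ksign ord v \<rho> * ?m else 0)"
    proof (cases "v \<in> D")
      case True
      then have "ind (\<rho> \<inter> V) = single v 1 + ind ((\<rho> - {v}) \<inter> V)"
        using DV[of v] by (intro poly_mapping_eqI) (auto simp: lookup_add lookup_ind lookup_single when_def D_def)
      then show ?thesis using True
        by (simp add: D_def cocycle_def indet_def mult_single mult.assoc add.left_commute)
    qed (use v in \<open>simp add: D_def cocycle_def\<close>)
  qed simp
  also have "\<dots> = (\<Sum>v\<in>D. ksign ord v \<rho>) * ?m"
    by (simp add: sum.If_cases sum_distrib_right D_def Int_def)
  also have "\<dots> \<in> J"
  proof (cases "\<exists>v\<in>D. \<kappa> v = 0")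
    \<comment> \<open>A vertex of colour 0 completes the part of \<open>\<rho>\<close> in its
      component to a set with every colour once, so \<open>?m\<close> lies in \<open>J\<close>
      whatever the signs are.\<close>
    case True
    then obtain v where v: "v \<in> D" "\<kappa> v = 0" by blast
    let ?Y = "{w \<in> \<rho> \<inter> V. cmp w = cmp v}"
    have bij: "bij_betw (\<lambda>v. (cmp v, \<kappa> v)) ((\<rho> - {v}) \<inter> V) ({..<C} \<times> {1..d})"
      using v by (simp add: D_def T_def)
    have "bij_betw \<kappa> ?Y {..d}"
      unfolding bij_betw_def
    proof
      have pos: "\<kappa> w \<noteq> 0" if "w \<in> ?Y" "w \<noteq> v" for w
        using bspec[OF bij_betwE[OF bij], of w] that by auto
      show "inj_on \<kappa> ?Y"
      proof (rule inj_onI)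
        fix a b assume ab: "a \<in> ?Y" "b \<in> ?Y" "\<kappa> a = \<kappa> b"
        show "a = b"
        proof (cases "a = v \<or> b = v")
          case True
          then show ?thesis using pos ab v(2) by metis
        next
          case False
          then show ?thesis using ab inj_onD[OF bij_betw_imp_inj_on[OF bij], of a b] by simp
        qed
      qed
      show "\<kappa> ` ?Y = {..d}"
      proof
        show "\<kappa> ` ?Y \<subseteq> {..d}" using \<kappa>_le by auto
        show "{..d} \<subseteq> \<kappa> ` ?Y"
        proof
          fix j assume j: "j \<in> {..d}"
          show "j \<in> \<kappa> ` ?Y"
          proof (cases "j = 0")
            case True
            then show ?thesis using v DV by (auto simp: D_def image_iff)
          next
            case False
            then have "(cmp v, j) \<in> {..<C} \<times> {1..d}" using j cmp_less[OF DV[OF v(1)]] by auto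
            then have "(cmp v, j) \<in> (\<lambda>v. (cmp v, \<kappa> v)) ` ((\<rho> - {v}) \<inter> V)"
              using bij by (simp add: bij_betw_def)
            then show ?thesis by auto
          qed
        qed
      qed
    qed
    then have "u + ind ?Y \<in> pow_up \<A> (Suc k)"
      unfolding u_def using cmp_less[OF DV[OF v(1)]] by (intro transversal) (auto simp: V_def)
    moreover have "u + ind (\<rho> \<inter> V) = (u + ind ?Y) + ind ((\<rho> \<inter> V) - ?Y)"
      by (intro poly_mapping_eqI) (auto simp: lookup_add lookup_ind)
    ultimately have "u + ind (\<rho> \<inter> V) \<in> pow_up \<A> (Suc k)"
      using up_closed_pow_up[of \<A> "Suc k"] by (simp only: up_closed_def)
    then have "?m \<in> J" by (simp add: J_def)
    then show ?thesis by (rule ideal_mult[OF ideal_J])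
  next
    case False
    have "(\<Sum>v\<in>D. ksign ord v \<rho>) = (0 :: ('n, 'k) mpoly)"
    proof (cases "D = {}")
      case ne: False
      then obtain v where v: "v \<in> D" by blast
      have bij: "bij_betw (\<lambda>v. (cmp v, \<kappa> v)) ((\<rho> - {v}) \<inter> V) ({..<C} \<times> {1..d})"
        using v by (simp add: D_def T_def)
      note inj = bij_betw_imp_inj_on[OF bij]
      have "\<kappa> v \<noteq> 0" using False v by auto
      then have "(cmp v, \<kappa> v) \<in> {..<C} \<times> {1..d}" using cmp_less[OF DV[OF v]] \<kappa>_le[OF DV[OF v]] by auto
      then have "(cmp v, \<kappa> v) \<in> (\<lambda>v. (cmp v, \<kappa> v)) ` ((\<rho> - {v}) \<inter> V)"
        using bij by (simp add: bij_betw_def)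
      then obtain v' where "v' \<in> (\<rho> - {v}) \<inter> V" "(cmp v, \<kappa> v) = (cmp v', \<kappa> v')" by (rule imageE) simp
      then have v': "v' \<in> \<rho>" "v' \<in> V" "v' \<noteq> v" "cmp v' = cmp v" "\<kappa> v' = \<kappa> v" by auto
      have vV: "v \<in> V" "v \<in> \<rho>" using v DV by (auto simp: D_def)
      have same: "a = v \<or> a = v'" if "a \<in> \<rho>" "a \<in> V" "cmp a = cmp v" "\<kappa> a = \<kappa> v" for a
        using inj_onD[OF inj, of a v'] that v' by auto
      have "T (\<rho> - {v'})"
      proof -
        have "(\<rho> - {v'}) \<inter> V = ((\<rho> - {v}) \<inter> V) - {v'} \<union> {v}" using vV v' by auto
        moreover have "bij_betw (\<lambda>v. (cmp v, \<kappa> v)) (((\<rho> - {v}) \<inter> V) - {v'} \<union> {v}) ({..<C} \<times> {1..d})"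
          unfolding bij_betw_def
        proof
          show "inj_on (\<lambda>v. (cmp v, \<kappa> v)) (((\<rho> - {v}) \<inter> V) - {v'} \<union> {v})"
          proof (rule inj_onI)
            fix a b assume "a \<in> ((\<rho> - {v}) \<inter> V) - {v'} \<union> {v}" "b \<in> ((\<rho> - {v}) \<inter> V) - {v'} \<union> {v}"
              "(cmp a, \<kappa> a) = (cmp b, \<kappa> b)"
            then show "a = b" using same[of a] same[of b] inj_onD[OF inj, of a b] by auto
          qed
          have "(\<rho> - {v}) \<inter> V = ((\<rho> - {v}) \<inter> V) - {v'} \<union> {v'}" using v' by auto
          then have "(\<lambda>v. (cmp v, \<kappa> v)) ` ((\<rho> - {v}) \<inter> V) =
              (\<lambda>v. (cmp v, \<kappa> v)) ` (((\<rho> - {v}) \<inter> V) - {v'} \<union> {v'})" by (rule arg_cong)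
          also have "\<dots> = (\<lambda>v. (cmp v, \<kappa> v)) ` (((\<rho> - {v}) \<inter> V) - {v'} \<union> {v})"
            unfolding image_Un using v' by simp
          finally show "(\<lambda>v. (cmp v, \<kappa> v)) ` (((\<rho> - {v}) \<inter> V) - {v'} \<union> {v}) = {..<C} \<times> {1..d}"
            using bij by (simp only: bij_betw_def)
        qed
        ultimately have "bij_betw (\<lambda>v. (cmp v, \<kappa> v)) ((\<rho> - {v'}) \<inter> V) ({..<C} \<times> {1..d})" by (simp only:)
        moreover have "- V \<subseteq> \<rho> - {v'}" using v v'(2) by (auto simp: D_def T_def)
        ultimately show ?thesis by (simp only: T_def simp_thms)
      qed
      then have v'D: "v' \<in> D" using v' by (simp add: D_def)
      have D: "D = {v, v'}"
      proof
        show "D \<subseteq> {v, v'}"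
        proof
          fix w assume w: "w \<in> D"
          show "w \<in> {v, v'}"
          proof (rule ccontr)
            assume "w \<notin> {v, v'}"
            moreover have "inj_on (\<lambda>v. (cmp v, \<kappa> v)) ((\<rho> - {w}) \<inter> V)"
              using w by (auto simp: D_def T_def bij_betw_def)
            ultimately show False using inj_onD[of "\<lambda>v. (cmp v, \<kappa> v)" "(\<rho> - {w}) \<inter> V" v v'] vV v' by auto
          qed
        qed
      qed (use v v'D in auto)
      have sgn: "ksign ord b \<rho> = - (ksign ord a \<rho> :: ('n, 'k) mpoly)"
        if ab: "{a, b} = {v, v'}" "ord a < ord b" for a b
      proof -
        have ab': "a \<in> V" "b \<in> V" "a \<in> \<rho>" "cmp a = cmp v" "cmp b = cmp v" "\<kappa> a = \<kappa> v" "\<kappa> b = \<kappa> v"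
          using ab(1) vV v' by (auto simp: doubleton_eq_iff)
        have "{x \<in> \<rho>. ord x < ord b} = insert a {x \<in> \<rho>. ord x < ord a}"
        proof (intro equalityI subsetI)
          fix x assume x: "x \<in> {x \<in> \<rho>. ord x < ord b}"
          show "x \<in> insert a {x \<in> \<rho>. ord x < ord a}"
          proof (rule ccontr)
            assume "x \<notin> insert a {x \<in> \<rho>. ord x < ord a}"
            then have xa: "x \<noteq> a" "\<not> ord x < ord a" using x by auto
            then have ax: "ord a < ord x" using assms(1) by (metis injD linorder_neqE_nat)
            have xV: "x \<in> V" using ord3[OF ab'(2), of x] x by fastforce
            have "cmp x = cmp v"
              using ord1[OF xV ab'(1)] ord1[OF ab'(2) xV] ax x ab' by (metis linorder_neqE_nat mem_Collect_eq order_less_asym)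
            moreover then have "\<kappa> x = \<kappa> v"
              using ord2[OF xV ab'(1)] ord2[OF ab'(2) xV] ax x ab' by (metis linorder_neqE_nat mem_Collect_eq order_less_asym)
            ultimately have "x = a \<or> x = b" using same[of x] x xV ab(1) by blast
            then show False using xa x by auto
          qed
        qed (use ab(2) ab' in auto)
        then show ?thesis by (simp add: ksign_def)
      qed
      have "ord v \<noteq> ord v'" using assms(1) v'(3) by (auto dest: injD)
      then have "ksign ord v' \<rho> + (ksign ord v \<rho> :: ('n, 'k) mpoly) = 0"
        using sgn[of v v'] sgn[of v' v] by (cases "ord v < ord v'") (auto simp: insert_commute)
      then show ?thesis using D v'(3) by (simp add: add.commute)
    qed simp
    then show ?thesis using ideal_0[OF ideal_J] by simp
  qed
  finally show ?thesis .
qed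

section \<open>Detecting the class: pairing with boundary spheres\<close>

definition Gs where "Gs = (\<Union>p\<in>{..<C}. G p)"

definition choices where "choices = PiE {..<C} G"

lemma choicesD: "y \<in> choices \<Longrightarrow> p < C \<Longrightarrow> y p \<in> G p"
  by (auto simp: choices_def)

lemma Gs_subset: "Gs \<subseteq> V"
  using G_subset by (auto simp: Gs_def)

lemma GsD: "v \<in> Gs \<Longrightarrow> cmp v < C \<and> v \<in> G (cmp v)"
  using G(2) by (auto simp: Gs_def)

text \<open>A weight separates the two sides. Let \<open>L\<close> consist of the vertices with the
  colour of the omitted vertex in their component. Each facet has exactly one vertex in
  \<open>L\<close>, so a product of \<open>Suc k\<close> facets has weight \<open>Suc k\<close>. But
  \<open>u\<close> has weight \<open>k\<close>, and the vertices of \<open>Gs\<close> that are not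
  omitted have weight 0.\<close>

lemma not_in_pow:
  assumes y: "y \<in> choices"
  shows "u + ind (Gs - y ` {..<C}) \<notin> pow_up \<A> (Suc k)"
proof
  let ?Y = "y ` {..<C}"
  define L where "L = {i \<in> V. \<kappa> i = \<kappa> (y (cmp i))}"
  have one: "(\<Sum>i\<in>L. if i \<in> F then 1 else 0) = (1::nat)" if F: "F \<in> \<A>" for F
  proof -
    obtain p where p: "p < C" "\<forall>v\<in>F. cmp v = p" "bij_betw \<kappa> F {..d}" using facet[OF F] by blast
    have "\<kappa> (y p) \<in> \<kappa> ` F"
      using p(3) \<kappa>_le[of "y p"] choicesD[OF y p(1)] G_subset[OF p(1)] by (auto simp: bij_betw_def)
    then obtain i where i: "i \<in> F" "\<kappa> i = \<kappa> (y p)" by auto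
    have "L \<inter> F = {i}"
    proof
      show "L \<inter> F \<subseteq> {i}"
        using p i inj_onD[OF bij_betw_imp_inj_on[OF p(3)]] by (fastforce simp: L_def)
      show "{i} \<subseteq> L \<inter> F" using p i F by (auto simp: L_def V_def)
    qed
    then show ?thesis by (simp add: sum.If_cases)
  qed
  have size: "(\<Sum>i\<in>L. size {#F \<in># N. i \<in> F#}) = size N" if "set_mset N \<subseteq> \<A>" for N
    using that
  proof (induction N)
    case (add F N)
    have "(\<Sum>i\<in>L. size {#H \<in># add_mset F N. i \<in> H#}) =
        (\<Sum>i\<in>L. (if i \<in> F then 1 else 0) + size {#H \<in># N. i \<in> H#})"
      by (intro sum.cong) auto
    then show ?case using add one[of F] by (simp add: sum.distrib)
  qed simp
  assume "u + ind (Gs - ?Y) \<in> pow_up \<A> (Suc k)"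
  then obtain N where N: "set_mset N \<subseteq> \<A>" "size N = Suc k"
    and le: "\<And>i. size {#F \<in># N. i \<in> F#} \<le> lookup (u + ind (Gs - ?Y)) i"
    by (auto simp: mem_pow_up)
  have "Suc k = (\<Sum>i\<in>L. size {#F \<in># N. i \<in> F#})" using size[OF N(1)] N(2) by simp
  also have "\<dots> \<le> (\<Sum>i\<in>L. size {#F \<in># M. i \<in> F#})"
  proof (rule sum_mono)
    fix i assume i: "i \<in> L"
    have "i \<notin> Gs - ?Y"
    proof
      assume "i \<in> Gs - ?Y"
      then have "i \<in> G (cmp i)" "cmp i < C" "i \<noteq> y (cmp i)" using GsD by auto
      moreover then have "y (cmp i) \<in> G (cmp i)" using choicesD[OF y] by simp
      ultimately show False using i inj_onD[OF bij_betw_imp_inj_on[OF bij_G]] by (auto simp: L_def)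
    qed
    then have "lookup (ind (Gs - ?Y)) i = 0" by (simp only: lookup_ind if_False)
    then show "size {#F \<in># N. i \<in> F#} \<le> size {#F \<in># M. i \<in> F#}"
      using le[of i] by (simp add: lookup_add u_def lookup_sum_mset_ind)
  qed
  also have "\<dots> = k" using size[OF M(1)] M(2) by simp
  finally show False by simp
qed

text \<open>
  This pairs a cochain with the product of the boundary spheres of the simplices \<open>G p\<close>. A choice
  \<open>y\<close> picks the vertex \<open>y p\<close> that is left out of \<open>G p\<close>.
\<close>

definition pairing :: "('n \<Rightarrow> nat) \<Rightarrow> ('n set \<Rightarrow> ('n, 'k::field) mpoly) \<Rightarrow> 'k" where
  "pairing ord c = (\<Sum>y\<in>choices. (\<Prod>p<C. ksign ord (y p) (- V \<union> Gs)) *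
     lookup (c ((- V \<union> Gs) - y ` {..<C})) (u + ind (Gs - y ` {..<C})))"

lemma finite_choices [simp]: "finite choices"
  unfolding choices_def by (rule finite_PiE) auto

lemma pairing_diff: "pairing ord (\<lambda>\<sigma>. a \<sigma> - b \<sigma>) = pairing ord a - pairing ord b"
  by (simp add: pairing_def lookup_minus right_diff_distrib sum_subtractf)

text \<open>By \<open>not_in_pow\<close>, the monomials whose coefficients are read off lie outside
  the exponent set of \<open>J\<close>.\<close>

lemma pairing_J: "(\<And>\<sigma>. c \<sigma> \<in> (J :: ('n, 'k::field) mpoly set)) \<Longrightarrow> pairing ord c = 0"
proof -
  assume c: "\<And>\<sigma>. c \<sigma> \<in> (J :: ('n, 'k) mpoly set)"
  have "lookup (c \<sigma>) (u + ind (Gs - y ` {..<C})) = 0" if "y \<in> choices" for \<sigma> y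
    using c[of \<sigma>] not_in_pow[OF that] by (auto simp: J_def mono_ideal_def in_keys_iff)
  then show ?thesis by (simp add: pairing_def)
qed

text \<open>Only the choice that omits the vertex of colour 0 in every \<open>G p\<close> leads to a
  \<open>T\<close>-set, so a single product of signs survives.\<close>

lemma pairing_cocycle: "pairing ord cocycle \<noteq> (0 :: 'k::field)"
proof -
  define y0 where "y0 = restrict (\<lambda>p. inv_into (G p) \<kappa> 0) {..<C}"
  have y0: "y0 p \<in> G p" "\<kappa> (y0 p) = 0" if "p < C" for p
  proof -
    have "0 \<in> \<kappa> ` G p" using bij_G[OF that] by (simp add: bij_betw_def)
    then show "y0 p \<in> G p" "\<kappa> (y0 p) = 0" using that by (simp_all add: y0_def inv_into_into f_inv_into_f)
  qed
  have y0_choice: "y0 \<in> choices" using y0 by (auto simp: choices_def y0_def)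
  have T_iff: "T ((- V \<union> Gs) - y ` {..<C}) \<longleftrightarrow> y = y0" if y: "y \<in> choices" for y
  proof -
    let ?Y = "y ` {..<C}"
    have int: "((- V \<union> Gs) - ?Y) \<inter> V = Gs - ?Y" using Gs_subset by auto
    have "?Y \<subseteq> V" using choicesD[OF y] G_subset by blast
    then have T: "T ((- V \<union> Gs) - ?Y) \<longleftrightarrow> bij_betw (\<lambda>v. (cmp v, \<kappa> v)) (Gs - ?Y) ({..<C} \<times> {1..d})"
      unfolding T_def int by blast
    show ?thesis
    proof
      assume "T ((- V \<union> Gs) - ?Y)"
      then have bij: "bij_betw (\<lambda>v. (cmp v, \<kappa> v)) (Gs - ?Y) ({..<C} \<times> {1..d})" using T by simp
      have "y p = y0 p" if p: "p < C" for p
      proof (rule ccontr)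
        assume ne: "y p \<noteq> y0 p"
        have "y0 p \<notin> ?Y"
        proof
          assume "y0 p \<in> ?Y"
          then obtain q where q: "q < C" "y0 p = y q" by auto
          then have "q = p" using G(2)[OF p y0(1)[OF p]] G(2)[OF q(1) choicesD[OF y q(1)]] by simp
          then show False using ne q by simp
        qed
        then have "y0 p \<in> Gs - ?Y" using y0(1)[OF p] p by (auto simp: Gs_def)
        then show False using bspec[OF bij_betwE[OF bij], of "y0 p"] y0(2)[OF p] by simp
      qed
      then show "y = y0" using y y0_choice unfolding choices_def by (intro PiE_ext) auto
    next
      assume yy: "y = y0"
      have "bij_betw (\<lambda>v. (cmp v, \<kappa> v)) (Gs - ?Y) ({..<C} \<times> {1..d})"
        unfolding bij_betw_def
      proof
        show "inj_on (\<lambda>v. (cmp v, \<kappa> v)) (Gs - ?Y)"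
        proof (rule inj_onI)
          fix a b assume "a \<in> Gs - ?Y" "b \<in> Gs - ?Y" "(cmp a, \<kappa> a) = (cmp b, \<kappa> b)"
          then show "a = b" using GsD[of a] GsD[of b] inj_onD[OF bij_betw_imp_inj_on[OF bij_G], of "cmp a" a b] by auto
        qed
        show "(\<lambda>v. (cmp v, \<kappa> v)) ` (Gs - ?Y) = {..<C} \<times> {1..d}"
        proof
          show "(\<lambda>v. (cmp v, \<kappa> v)) ` (Gs - ?Y) \<subseteq> {..<C} \<times> {1..d}"
          proof
            fix z assume "z \<in> (\<lambda>v. (cmp v, \<kappa> v)) ` (Gs - ?Y)"
            then obtain v where v: "v \<in> Gs" "v \<notin> ?Y" "z = (cmp v, \<kappa> v)" by auto
            then have p: "cmp v < C" "v \<in> G (cmp v)" "v \<noteq> y0 (cmp v)" using GsD yy by auto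
            then have "\<kappa> v \<noteq> 0" using y0[OF p(1)] inj_onD[OF bij_betw_imp_inj_on[OF bij_G[OF p(1)]]] by metis
            then show "z \<in> {..<C} \<times> {1..d}" using v p \<kappa>_le[of v] Gs_subset by auto
          qed
          show "{..<C} \<times> {1..d} \<subseteq> (\<lambda>v. (cmp v, \<kappa> v)) ` (Gs - ?Y)"
          proof
            fix z assume "z \<in> {..<C} \<times> {1..d}"
            then obtain p j where z: "z = (p, j)" "p < C" "1 \<le> j" "j \<le> d" by auto
            then have "j \<in> \<kappa> ` G p" using bij_G by (simp add: bij_betw_def)
            then obtain v where v: "v \<in> G p" "\<kappa> v = j" by auto
            have "v \<notin> ?Y"
            proof
              assume "v \<in> ?Y"
              then obtain q where "q < C" "v = y0 q" using yy by auto
              then show False using y0(2)[of q] v z by auto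
            qed
            then show "z \<in> (\<lambda>v. (cmp v, \<kappa> v)) ` (Gs - ?Y)"
              using v z G(2)[OF z(2) v(1)] by (auto simp: Gs_def image_iff)
          qed
        qed
      qed
      then show "T ((- V \<union> Gs) - ?Y)" using T by simp
    qed
  qed
  have "pairing ord cocycle = (\<Sum>y\<in>choices. if y = y0 then (\<Prod>p<C. ksign ord (y0 p) (- V \<union> Gs)) else (0 :: 'k))"
    unfolding pairing_def
  proof (rule sum.cong)
    fix y assume y: "y \<in> choices"
    have "((- V \<union> Gs) - y ` {..<C}) \<inter> V = Gs - y ` {..<C}" using Gs_subset by auto
    then have "cocycle ((- V \<union> Gs) - y ` {..<C}) = (if y = y0 then monom (u + ind (Gs - y ` {..<C})) else (0 :: ('n, 'k) mpoly))"
      by (simp only: cocycle_def T_iff[OF y])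
    then show "(\<Prod>p<C. ksign ord (y p) (- V \<union> Gs)) *
        lookup (cocycle ((- V \<union> Gs) - y ` {..<C})) (u + ind (Gs - y ` {..<C})) =
        (if y = y0 then (\<Prod>p<C. ksign ord (y0 p) (- V \<union> Gs)) else (0 :: 'k))"
      by simp
  qed simp
  also have "\<dots> = (\<Prod>p<C. ksign ord (y0 p) (- V \<union> Gs))" using y0_choice by simp
  also have "\<dots> \<noteq> 0" by (simp add: ksign_neq_0)
  finally show ?thesis .
qed

text \<open>Boundary spheres are cycles, so coboundaries pair to zero. The terms are indexed by a
  choice \<open>y\<close> and one more vertex \<open>v\<close> of \<open>Gs\<close> to be dropped;
  exchanging \<open>v\<close> with the omitted vertex of its component leaves the same set and
  monomial and reverses the sign.\<close>

lemma pairing_kdiff: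
  assumes "inj ord"
    and ord1: "\<And>v w. v \<in> V \<Longrightarrow> w \<in> V \<Longrightarrow> cmp v < cmp w \<Longrightarrow> ord v < ord w"
  shows "pairing ord (kdiff ord indet b) = (0 :: 'k::field)"
proof -
  let ?W = "- V \<union> Gs"
  let ?Y = "\<lambda>y. y ` {..<C}"
  let ?a = "\<lambda>y. u + ind (Gs - ?Y y)"
  define \<mu> :: "(nat \<Rightarrow> 'n) \<Rightarrow> 'k" where "\<mu> y = (\<Prod>p<C. ksign ord (y p) ?W)" for y
  define g :: "(nat \<Rightarrow> 'n) \<times> 'n \<Rightarrow> 'k" where
    "g = (\<lambda>(y, v). \<mu> y * ksign ord v (?W - ?Y y) *
        lookup (b (?W - ?Y y - {v})) (?a y - single v 1))"
  define S where "S = Sigma choices (\<lambda>y. Gs - ?Y y)"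
  define swap where "swap = (\<lambda>(y, v). (y(cmp v := v), y (cmp v)) :: (nat \<Rightarrow> 'n) \<times> 'n)"
  have "pairing ord (kdiff ord indet b) = (\<Sum>y\<in>choices. \<Sum>v\<in>Gs - ?Y y. g (y, v))"
    unfolding pairing_def
  proof (rule sum.cong)
    fix y assume y: "y \<in> choices"
    have YV: "?Y y \<subseteq> V" using choicesD[OF y] G_subset by blast
    have "lookup (kdiff ord indet b (?W - ?Y y)) (?a y) =
       (\<Sum>v\<in>?W - ?Y y. ksign ord v (?W - ?Y y) * lookup (indet v * b (?W - ?Y y - {v})) (?a y))"
      by (simp add: kdiff_def lookup_sum lookup_ksign_mult mult.assoc)
    \<comment> \<open>The monomial \<open>?a y\<close> involves no variable outside
      \<open>V\<close>, so the terms of such vertices vanish.\<close>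
    also have "\<dots> = (\<Sum>v\<in>Gs - ?Y y. ksign ord v (?W - ?Y y) * lookup (indet v * b (?W - ?Y y - {v})) (?a y))"
    proof (rule sum.mono_neutral_right)
      show "\<forall>v\<in>(?W - ?Y y) - (Gs - ?Y y).
          ksign ord v (?W - ?Y y) * lookup (indet v * b (?W - ?Y y - {v})) (?a y) = 0"
        using Gs_subset by (auto simp: lookup_indet_mult lookup_add lookup_u_outside lookup_ind)
    qed auto
    also have "\<dots> = (\<Sum>v\<in>Gs - ?Y y. ksign ord v (?W - ?Y y) *
        lookup (b (?W - ?Y y - {v})) (?a y - single v 1))"
      by (intro sum.cong) (auto simp: lookup_indet_mult lookup_add lookup_ind)
    finally show "(\<Prod>p<C. ksign ord (y p) ?W) * lookup (kdiff ord indet b (?W - ?Y y)) (?a y)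
        = (\<Sum>v\<in>Gs - ?Y y. g (y, v))"
      by (simp add: g_def \<mu>_def sum_distrib_left mult.assoc)
  qed simp
  also have "\<dots> = sum g S" unfolding S_def by (simp add: sum.Sigma)
  also have "\<dots> = 0"
  proof -
    have mem_S: "(y, v) \<in> S \<longleftrightarrow> y \<in> choices \<and> v \<in> Gs \<and> v \<noteq> y (cmp v)" for y v
    proof
      assume "(y, v) \<in> S"
      then show "y \<in> choices \<and> v \<in> Gs \<and> v \<noteq> y (cmp v)" using GsD[of v] by (auto simp: S_def)
    next
      assume r: "y \<in> choices \<and> v \<in> Gs \<and> v \<noteq> y (cmp v)"
      have "v \<notin> ?Y y"
      proof
        assume "v \<in> ?Y y"
        then obtain q where "q < C" "v = y q" by auto
        moreover then have "cmp v = q" using G(2) choicesD r by blast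
        ultimately show False using r by simp
      qed
      then show "(y, v) \<in> S" using r by (simp add: S_def)
    qed
    have cmp_y: "cmp (y p) = p" if "y \<in> choices" "p < C" for y p
      using G(2)[OF that(2) choicesD[OF that]] .
    have swap_S: "swap z \<in> S \<and> swap (swap z) = z" if "z \<in> S" for z
    proof -
      obtain y v where z: "z = (y, v)" by (cases z)
      have y: "y \<in> choices" "v \<in> Gs" "v \<noteq> y (cmp v)" using that z mem_S by auto
      have p: "cmp v < C" "v \<in> G (cmp v)" using GsD[OF y(2)] by auto
      have "y(cmp v := v) \<in> choices" using y(1) p unfolding choices_def by (auto simp: PiE_iff extensional_def)
      moreover have "y (cmp v) \<in> Gs" using choicesD[OF y(1) p(1)] p(1) by (auto simp: Gs_def)
      ultimately show ?thesis using y cmp_y[OF y(1) p(1)] by (auto simp: z swap_def mem_S)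
    qed
    have g_swap: "g (swap z) = - g z" if "z \<in> S" for z
    proof -
      obtain y v where z: "z = (y, v)" by (cases z)
      have y: "y \<in> choices" "v \<in> Gs" "v \<noteq> y (cmp v)" using that z mem_S by auto
      define p where "p = cmp v"
      define t where "t = y p"
      have p: "p < C" "v \<in> G p" using GsD[OF y(2)] by (auto simp: p_def)
      have tv: "t \<noteq> v" "t \<in> G p" "cmp t = p" using y p choicesD[OF y(1) p(1)] cmp_y[OF y(1) p(1)] by (auto simp: t_def p_def)
      define R where "R = y ` ({..<C} - {p})"
      have Y: "?Y y = insert t R" using p(1) by (auto simp: R_def t_def)
      have Y': "?Y (y(p := v)) = insert v R" using p(1) by (auto simp: R_def)
      have Rcmp: "cmp r \<noteq> p" "r \<in> Gs" if "r \<in> R" for r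
        using that cmp_y[OF y(1)] choicesD[OF y(1)] by (auto simp: R_def Gs_def)
      have tR: "t \<notin> R" "v \<notin> R" using Rcmp(1) tv(3) p_def by auto
      have Gst: "t \<in> Gs" "v \<in> Gs" using tv p by (auto simp: Gs_def)
      have sets: "?W - insert t R - {v} = ?W - insert v R - {t}" by auto
      have exps: "u + ind (Gs - insert t R) - single v 1 = u + ind (Gs - insert v R) - single t 1"
        using tR tv(1) Gst by (intro poly_mapping_eqI) (auto simp: lookup_add lookup_minus lookup_ind lookup_single when_def)
      have \<mu>: "\<mu> (y(p := v)) * ksign ord t ?W = \<mu> y * ksign ord v ?W"
      proof -
        have *: "(\<Prod>q<C. h q) = h p * (\<Prod>q\<in>{..<C} - {p}. h q)" for h :: "nat \<Rightarrow> 'k"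
          using p(1) by (intro prod.remove) auto
        have "(\<Prod>q\<in>{..<C} - {p}. ksign ord ((y(p := v)) q) ?W) = (\<Prod>q\<in>{..<C} - {p}. ksign ord (y q) ?W :: 'k)"
          by (intro prod.cong) auto
        then show ?thesis unfolding \<mu>_def *[of "\<lambda>q. ksign ord ((y(p := v)) q) ?W"] *[of "\<lambda>q. ksign ord (y q) ?W"]
          by (simp add: t_def mult_ac)
      qed
      have RW: "R \<subseteq> ?W" using Rcmp by auto
      \<comment> \<open>An omitted vertex of another component comes before both \<open>v\<close>
        and \<open>t\<close> or after both, as the order is sorted by components. So it affects the
        two signs equally.\<close>
      have "{r \<in> R. ord r < ord v} = {r \<in> R. ord r < ord t}"
      proof -
        have "ord r < ord v \<longleftrightarrow> ord r < ord t" if r: "r \<in> R" for r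
        proof -
          have V: "r \<in> V" "v \<in> V" "t \<in> V" using Rcmp(2)[OF r] Gst Gs_subset by auto
          show ?thesis
          proof (cases "cmp r < p")
            case True
            then show ?thesis using ord1[OF V(1,2)] ord1[OF V(1,3)] tv(3) by (simp add: p_def)
          next
            case False
            then have "p < cmp r" using Rcmp(1)[OF r] by simp
            then have "ord v < ord r" "ord t < ord r" using ord1[OF V(2,1)] ord1[OF V(3,1)] tv(3) by (simp_all add: p_def)
            then show ?thesis by simp
          qed
        qed
        then show ?thesis by blast
      qed
      then have kR: "(ksign ord v R :: 'k) = ksign ord t R" by (simp add: ksign_def)
      have ordne: "ord t \<noteq> ord v" using assms(1) tv(1) by (auto dest: injD)
      have s1: "(ksign ord v (?W - insert t R) :: 'k) =
          (if ord t < ord v then - (ksign ord v ?W * ksign ord v R) else ksign ord v ?W * ksign ord v R)"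
      proof -
        have "?W - insert t R = (?W - R) - {t}" by auto
        moreover have "t \<in> ?W - R" using tR Gst by auto
        ultimately show ?thesis using ksign_remove[of "?W - R" t ord v, where 'a = 'k] ksign_Diff[OF RW, of ord v, where 'a = 'k] by simp
      qed
      have s2: "(ksign ord t (?W - insert v R) :: 'k) =
          (if ord v < ord t then - (ksign ord t ?W * ksign ord t R) else ksign ord t ?W * ksign ord t R)"
      proof -
        have "?W - insert v R = (?W - R) - {v}" by auto
        moreover have "v \<in> ?W - R" using tR Gst by auto
        ultimately show ?thesis using ksign_remove[of "?W - R" v ord t, where 'a = 'k] ksign_Diff[OF RW, of ord t, where 'a = 'k] by simp
      qed
      have sgn: "\<mu> (y(p := v)) * ksign ord t (?W - insert v R) = - (\<mu> y * ksign ord v (?W - insert t R))"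
      proof -
        have "\<mu> (y(p := v)) * (ksign ord t ?W * ksign ord t R) = \<mu> y * (ksign ord v ?W * ksign ord v R)"
          using \<mu> kR by (simp flip: mult.assoc)
        then show ?thesis using s1 s2 ordne by (cases "ord t < ord v") auto
      qed
      have "g (swap z) = \<mu> (y(p := v)) * ksign ord t (?W - insert v R) *
          lookup (b (?W - insert v R - {t})) (u + ind (Gs - insert v R) - single t 1)"
        by (simp only: z swap_def g_def prod.case flip: p_def t_def) (simp only: Y' t_def)
      moreover have "g z = \<mu> y * ksign ord v (?W - insert t R) *
          lookup (b (?W - insert t R - {v})) (u + ind (Gs - insert t R) - single v 1)"
        by (simp only: z g_def prod.case Y)
      ultimately show ?thesis using sgn by (simp only: sets exps) simp
    qed
    \<comment> \<open>Summing \<open>g (swap z) = - g z\<close> over \<open>S\<close> shows only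
      that twice the sum is zero, which says nothing in characteristic 2. So \<open>S\<close> is
      halved by the order of the two exchanged vertices, and the halves cancel.\<close>
    define S1 where "S1 = {z \<in> S. ord (snd z) < ord (fst z (cmp (snd z)))}"
    have finS: "finite S" unfolding S_def by (rule finite_SigmaI) auto
    have S2: "S - S1 = swap ` S1"
    proof (intro equalityI subsetI)
      fix z assume z: "z \<in> S - S1"
      obtain y v where yv: "z = (y, v)" by (cases z)
      have y: "y \<in> choices" "v \<in> Gs" "v \<noteq> y (cmp v)" using z yv mem_S by auto
      have "\<not> ord v < ord (y (cmp v))" using z by (auto simp: S1_def yv)
      moreover have "ord v \<noteq> ord (y (cmp v))" using y(3) assms(1) by (auto dest: injD)
      ultimately have "ord (y (cmp v)) < ord v" by simp
      moreover have "cmp (y (cmp v)) = cmp v" using cmp_y[OF y(1)] GsD[OF y(2)] by simp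
      ultimately have "swap z \<in> S1" using swap_S[of z] z by (simp add: S1_def yv swap_def)
      then show "z \<in> swap ` S1" using swap_S[of z] z by (metis DiffD1 image_eqI)
    next
      fix z assume "z \<in> swap ` S1"
      then obtain y v where yv: "z = swap (y, v)" "(y, v) \<in> S" "ord v < ord (y (cmp v))" by (auto simp: S1_def)
      have y: "y \<in> choices" "v \<in> Gs" using yv mem_S by auto
      have "cmp (y (cmp v)) = cmp v" using cmp_y[OF y(1)] GsD[OF y(2)] by simp
      then show "z \<in> S - S1" using swap_S[OF yv(2)] yv by (auto simp: S1_def swap_def)
    qed
    have "inj_on swap S1"
      by (rule inj_on_inverseI[of _ swap]) (use swap_S in \<open>auto simp: S1_def\<close>)
    then have "sum g (S - S1) = (\<Sum>z\<in>S1. g (swap z))" unfolding S2 by (simp add: sum.reindex)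
    also have "\<dots> = - sum g S1" using g_swap by (simp add: S1_def sum_negf)
    finally have "sum g (S - S1) = - sum g S1" .
    moreover have "sum g S = sum g (S - S1) + sum g S1"
      by (rule sum.subset_diff) (use finS in \<open>auto simp: S1_def\<close>)
    ultimately show ?thesis by simp
  qed
  finally show ?thesis .
qed

text \<open>A longer regular sequence would make \<open>cocycle\<close> a coboundary modulo
  \<open>J\<close>, and its pairing would vanish by \<open>pairing_kdiff\<close> and
  \<open>pairing_J\<close>.\<close>

lemma depth_le: "depth_quotient (J :: ('n, 'k::field) mpoly set) \<le> enat (card (- V) + C * d)"
proof (rule depth_quotient_le[OF ideal_J])
  fix fs :: "('n, 'k) mpoly list"
  assume fs: "set fs \<subseteq> graded_max_ideal" "weakly_regular J fs"
  obtain ord :: "'n \<Rightarrow> nat" where ord: "inj ord"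
    "\<And>v w. v \<in> V \<Longrightarrow> w \<in> V \<Longrightarrow> cmp v < cmp w \<Longrightarrow> ord v < ord w"
    "\<And>v w. v \<in> V \<Longrightarrow> w \<in> V \<Longrightarrow> cmp v = cmp w \<Longrightarrow> \<kappa> v < \<kappa> w \<Longrightarrow> ord v < ord w"
    "\<And>v z. v \<in> V \<Longrightarrow> z \<notin> V \<Longrightarrow> ord v < ord z"
    using order_exists by blast
  show "length fs \<le> card (- V) + C * d"
  proof (rule ccontr)
    assume "\<not> length fs \<le> card (- V) + C * d"
    then have "card (- V) + C * d < length fs" by simp
    moreover have "cocycle \<sigma> = (0 :: ('n, 'k) mpoly)" if "card \<sigma> \<noteq> card (- V) + C * d" for \<sigma>
      using that card_T[of \<sigma>] by (auto simp: cocycle_def)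
    moreover have "\<exists>a. f = (\<Sum>v\<in>UNIV. a v * indet v)" if "f \<in> set fs" for f
      using graded_max_ideal_combination fs(1) that by blast
    ultimately have "\<exists>b. \<forall>\<sigma>. cocycle \<sigma> - kdiff ord indet b \<sigma> \<in> (J :: ('n, 'k) mpoly set)"
      using kdiff_cocycle[OF ord] by (intro koszul_exact[OF ord(1) ideal_J fs(2)])
    then obtain b where "\<And>\<sigma>. cocycle \<sigma> - kdiff ord indet b \<sigma> \<in> (J :: ('n, 'k) mpoly set)" by blast
    then have "pairing ord (\<lambda>\<sigma>. cocycle \<sigma> - kdiff ord indet b \<sigma> :: ('n, 'k) mpoly) = 0" by (rule pairing_J)
    then have "pairing ord (cocycle :: 'n set \<Rightarrow> ('n, 'k) mpoly) = 0"
      by (simp only: pairing_diff pairing_kdiff[OF ord(1,2)] diff_0_right)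
    then show False using pairing_cocycle by blast
  qed
qed

end


section \<open>Facet ideals, products and sums\<close>

interpretation ideal_monoid: comm_monoid "ideals_set (ring_of_type_algebra :: 'a::comm_ring_1 ring)"
  by (rule type_ring.ideals_set_is_comm_monoid)

interpretation ideal_semiring: semiring "ideals_set (ring_of_type_algebra :: 'a::comm_ring_1 ring)"
  by (rule type_ring.ideals_set_is_semiring)

lemma ideals_set_simps:
  "carrier (ideals_set (ring_of_type_algebra :: 'a::comm_ring_1 ring)) = {I. is_ideal I}"
  "I \<otimes>\<^bsub>ideals_set (ring_of_type_algebra :: 'a ring)\<^esub> J = ideal_prod ring_of_type_algebra I J"
  "I \<oplus>\<^bsub>ideals_set (ring_of_type_algebra :: 'a ring)\<^esub> J = I <+>\<^bsub>ring_of_type_algebra\<^esub> J"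
  "\<one>\<^bsub>ideals_set (ring_of_type_algebra :: 'a ring)\<^esub> = UNIV"
  "\<zero>\<^bsub>ideals_set (ring_of_type_algebra :: 'a ring)\<^esub> = {0}"
  by (simp_all add: ideals_set_def ideal_type_ring_iff)

lemma mono_ideal_UNIV: "mono_ideal UNIV = UNIV"
  by (simp add: mono_ideal_def)

lemma prod_indet: "(\<Prod>i\<in>F. indet i) = (monom (ind F) :: ('n::finite, 'k::field) mpoly)"
proof (induction F rule: finite_induct[OF finite])
  case 1
  then show ?case by (simp add: ind_def)
next
  case (2 i F)
  then show ?case by (simp add: indet_def mult_single ind_def)
qed

lemma facet_ideal_eq: "facet_ideal \<Delta> = (mono_ideal (fam_up (facets \<Delta>)) :: ('n::finite, 'k::field) mpoly set)"
proof -
  have "(\<lambda>F. \<Prod>i\<in>F. indet i) ` facets \<Delta> = (monom ` ind ` facets \<Delta> :: ('n, 'k) mpoly set)"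
    by (simp add: prod_indet image_image)
  then show ?thesis unfolding facet_ideal_def by (simp only: genideal_monom fam_up_eq)
qed

lemma pow_up_Suc: "{a + b | a b. a \<in> pow_up \<A> k \<and> b \<in> fam_up \<A>} = pow_up \<A> (Suc k)"
proof (intro equalityI subsetI)
  fix m assume "m \<in> {a + b | a b. a \<in> pow_up \<A> k \<and> b \<in> fam_up \<A>}"
  then obtain a b where m: "m = a + b" "a \<in> pow_up \<A> k" "b \<in> fam_up \<A>" by blast
  obtain M where M: "set_mset M \<subseteq> \<A>" "size M = k" and le: "\<And>i. size {#F \<in># M. i \<in> F#} \<le> lookup a i"
    using m(2) by (auto simp: mem_pow_up)
  obtain F where F: "F \<in> \<A>" "F \<subseteq> keys b" using m(3) by (auto simp: fam_up_def)
  have "size {#H \<in># add_mset F M. i \<in> H#} \<le> lookup m i" for i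
  proof -
    have "i \<in> F \<Longrightarrow> 1 \<le> lookup b i" using F(2) by (auto simp: in_keys_iff Suc_le_eq)
    then show ?thesis using le[of i] by (auto simp: m(1) lookup_add)
  qed
  then show "m \<in> pow_up \<A> (Suc k)"
    unfolding mem_pow_up using M F by (intro exI[of _ "add_mset F M"]) auto
next
  fix m assume "m \<in> pow_up \<A> (Suc k)"
  then obtain M q where M: "set_mset M \<subseteq> \<A>" "size M = Suc k" "m = (\<Sum>F\<in>#M. ind F) + q"
    by (auto simp: pow_up_def)
  obtain F M' where M': "M = add_mset F M'" using M(2) by (cases M) auto
  have "m = (\<Sum>F\<in>#M'. ind F) + (ind F + q)" using M(3) M' by (simp add: algebra_simps)
  moreover have "(\<Sum>F\<in>#M'. ind F) \<in> pow_up \<A> k"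
    unfolding pow_up_def using M M' by (intro CollectI exI[of _ M']) (auto intro!: exI[of _ 0])
  moreover have "ind F + q \<in> fam_up \<A>" using M M' by (auto simp: fam_up_def keys_add_nat)
  ultimately show "m \<in> {a + b | a b. a \<in> pow_up \<A> k \<and> b \<in> fam_up \<A>}" by blast
qed

lemma facet_ideal_power:
  "facet_ideal \<Delta> [^]\<^bsub>poly_ideals\<^esub> k = (mono_ideal (pow_up (facets \<Delta>) k) :: ('n::finite, 'k::field) mpoly set)"
proof (induction k)
  case 0
  show ?case by (simp add: ideals_set_simps mono_ideal_UNIV)
next
  case (Suc k)
  have "facet_ideal \<Delta> [^]\<^bsub>poly_ideals\<^esub> Suc k =
      ideal_prod poly_ring (facet_ideal \<Delta> [^]\<^bsub>poly_ideals\<^esub> k) (facet_ideal \<Delta> :: ('n, 'k) mpoly set)"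
    by (simp add: ideals_set_simps)
  also have "\<dots> = ideal_prod poly_ring (mono_ideal (pow_up (facets \<Delta>) k)) (mono_ideal (fam_up (facets \<Delta>)))"
    unfolding Suc by (simp only: facet_ideal_eq)
  also have "\<dots> = mono_ideal (pow_up (facets \<Delta>) (Suc k))"
    by (simp only: ideal_prod_mono_ideal[OF up_closed_pow_up up_closed_fam_up] pow_up_Suc)
  finally show ?case .
qed

section \<open>Products and sums of monomial primes as exponent sets\<close>

lemma monomial_prime_eq: "monomial_prime A = (mono_ideal (fam_up (var_fam A)) :: ('n::finite, 'k::field) mpoly set)"
proof -
  have "indet ` A = (monom ` ind ` var_fam A :: ('n, 'k) mpoly set)"
    by (simp add: indet_def ind_singleton image_image var_fam_def)
  then show ?thesis unfolding monomial_prime_def by (simp only: genideal_monom fam_up_eq)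
qed

text \<open>The exponent set of a product of \<open>r\<close> monomial primes: a generator selects
  one variable from each factor, possibly with repetitions, and \<open>r = 0\<close> gives the whole
  ring.\<close>

definition prod_up :: "(nat \<Rightarrow> 'n set) \<Rightarrow> nat \<Rightarrow> ('n::finite \<Rightarrow>\<^sub>0 nat) set" where
  "prod_up A r = up_closure {\<Sum>j<r. single (a j) 1 | a. \<forall>j<r. a j \<in> A j}"

lemma mem_prod_up: "m \<in> prod_up A r \<longleftrightarrow> (\<exists>a q. (\<forall>j<r. a j \<in> A j) \<and> m = (\<Sum>j<r. single (a j) 1) + q)"
  by (auto simp: prod_up_def up_closure_def)

lemma up_closed_prod_up [simp]: "up_closed (prod_up A r)"
  by (simp add: prod_up_def)

lemma prod_up_Suc: "{u + v | u v. u \<in> fam_up (var_fam (A r)) \<and> v \<in> prod_up A r} = prod_up A (Suc r)"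
proof (intro equalityI subsetI)
  fix m assume "m \<in> {u + v | u v. u \<in> fam_up (var_fam (A r)) \<and> v \<in> prod_up A r}"
  then obtain u v where m: "m = u + v" "u \<in> fam_up (var_fam (A r))" "v \<in> prod_up A r" by blast
  obtain x where x: "x \<in> A r" "{x} \<subseteq> keys u" using m(2) by (auto simp: fam_up_def var_fam_def)
  then obtain p where p: "u = single x 1 + p" using ind_edvd_iff[of u "{x}"] by (auto simp: ind_singleton)
  obtain a q where a: "\<forall>j<r. a j \<in> A j" "v = (\<Sum>j<r. single (a j) 1) + q"
    using m(3) by (auto simp: mem_prod_up)
  have "m = (\<Sum>j<Suc r. single ((a(r := x)) j) 1) + (p + q)"
    by (simp add: m(1) p a(2) algebra_simps)
  moreover have "\<forall>j<Suc r. (a(r := x)) j \<in> A j" using a(1) x(1) by (auto simp: less_Suc_eq)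
  ultimately show "m \<in> prod_up A (Suc r)" unfolding mem_prod_up by blast
next
  fix m assume "m \<in> prod_up A (Suc r)"
  then obtain a q where a: "\<forall>j<Suc r. a j \<in> A j" "m = (\<Sum>j<Suc r. single (a j) 1) + q"
    by (auto simp: mem_prod_up)
  have "m = single (a r) 1 + ((\<Sum>j<r. single (a j) 1) + q)"
    by (simp add: a(2) algebra_simps)
  moreover have "single (a r) 1 \<in> fam_up (var_fam (A r))"
    using a(1) by (auto simp: fam_up_def var_fam_def)
  moreover have "(\<Sum>j<r. single (a j) 1) + q \<in> prod_up A r"
    unfolding mem_prod_up using a(1) by (intro exI[of _ a] exI[of _ q]) simp
  ultimately show "m \<in> {u + v | u v. u \<in> fam_up (var_fam (A r)) \<and> v \<in> prod_up A r}" by blast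
qed

lemma finprod_monomial_prime:
  "(\<Otimes>\<^bsub>poly_ideals\<^esub> j \<in> {..<r}. monomial_prime (A j)) = (mono_ideal (prod_up A r) :: ('n::finite, 'k::field) mpoly set)"
proof (induction r)
  case 0
  have "prod_up A 0 = UNIV" by (auto simp: mem_prod_up)
  then show ?case by (simp add: ideals_set_simps mono_ideal_UNIV)
next
  case (Suc r)
  have "(\<Otimes>\<^bsub>poly_ideals\<^esub> j \<in> {..<Suc r}. monomial_prime (A j)) =
      ideal_prod poly_ring (monomial_prime (A r)) ((\<Otimes>\<^bsub>poly_ideals\<^esub> j \<in> {..<r}. monomial_prime (A j)) :: ('n, 'k) mpoly set)"
    unfolding lessThan_Suc
    by (subst ideal_monoid.finprod_insert) (auto simp: ideals_set_simps monomial_prime_eq)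
  also have "\<dots> = ideal_prod poly_ring (mono_ideal (fam_up (var_fam (A r)))) (mono_ideal (prod_up A r))"
    unfolding Suc by (simp only: monomial_prime_eq)
  also have "\<dots> = mono_ideal (prod_up A (Suc r))"
    by (simp only: ideal_prod_mono_ideal[OF up_closed_fam_up up_closed_prod_up] prod_up_Suc)
  finally show ?case .
qed

lemma finsum_mono_ideal:
  fixes r :: nat
  assumes "\<And>j. j < r \<Longrightarrow> J j = (mono_ideal (U j) :: ('n::finite, 'k::field) mpoly set)" "\<And>j. j < r \<Longrightarrow> up_closed (U j)"
  shows "(\<Oplus>\<^bsub>poly_ideals\<^esub> j \<in> {..<r}. J j) = mono_ideal (\<Union>j<r. U j)"
  using assms
proof (induction r)
  case 0
  have "mono_ideal {} = ({0} :: ('n, 'k) mpoly set)" by (auto simp: mono_ideal_def)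
  then show ?case by (simp add: ideals_set_simps)
next
  case (Suc r)
  have up: "up_closed (\<Union>j<r. U j)" 
    using Suc.prems(2)[OF less_SucI] unfolding up_closed_def by blast
  have "(\<Oplus>\<^bsub>poly_ideals\<^esub> j \<in> {..<Suc r}. J j) = J r <+>\<^bsub>poly_ring\<^esub> (\<Oplus>\<^bsub>poly_ideals\<^esub> j \<in> {..<r}. J j)"
    unfolding lessThan_Suc
    by (subst ideal_semiring.finsum_insert) (auto simp: ideals_set_simps Suc.prems ideal_mono_ideal)
  also have "(\<Oplus>\<^bsub>poly_ideals\<^esub> j \<in> {..<r}. J j) = mono_ideal (\<Union>j<r. U j)"
    using Suc by simp
  also have "J r <+>\<^bsub>poly_ring\<^esub> mono_ideal (\<Union>j<r. U j) = mono_ideal (U r \<union> (\<Union>j<r. U j))"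
    by (simp only: Suc.prems(1)[OF lessI] set_add_mono_ideal[OF Suc.prems(2)[OF lessI] up])
  also have "U r \<union> (\<Union>j<r. U j) = (\<Union>j<Suc r. U j)" by (simp only: lessThan_Suc UN_insert)
  finally show ?case .
qed

text \<open>As \<open>f\<close> has no constant term, only the constant term of \<open>g\<close>
  contributes to the linear part of the product.\<close>

lemma lookup_mult_single_linear:
  fixes f g :: "('n::finite, 'k::field) mpoly"
  assumes "lookup f 0 = 0"
  shows "lookup (g * f) (single x 1) =
    lookup g 0 * lookup f (single x 1)"
proof -
  let ?c = "single 0 (lookup g 0)"
  have "single x 1 \<notin> keys ((g - ?c) * f)"
  proof
    assume "single x 1 \<in> keys ((g - ?c) * f)"
    then obtain a b where ab: "single x 1 = a + b" "a \<in> keys (g - ?c)" "b \<in> keys f"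
      using keys_mult by blast
    have "a \<noteq> 0" "b \<noteq> 0" using ab(2,3) assms by (auto simp: in_keys_iff lookup_minus)
    then obtain i j where "lookup a i \<noteq> 0" "lookup b j \<noteq> 0" using nonzero_lookup by blast
    then have "edeg a \<ge> 1" "edeg b \<ge> 1"
      unfolding edeg_def by (auto simp: Suc_le_eq sum_pos2 intro!: sum_pos2[of UNIV i] sum_pos2[of UNIV j])
    moreover have "edeg (single x 1) = 1" using edeg_ind[of "{x}"] by (simp add: ind_singleton)
    ultimately show False using ab(1) by (metis edeg_add add_le_imp_le_left le_add2 not_one_le_zero One_nat_def Suc_n_not_le_n add_mono one_add_one order_trans numeral_2_eq_2)
  qed
  then have "lookup ((g - ?c) * f) (single x 1) = 0" by (simp add: in_keys_iff)
  moreover have "g * f = ?c * f + (g - ?c) * f" by (simp add: algebra_simps)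
  moreover have "lookup (?c * f) (single x 1) =
      lookup g 0 * lookup f (single x 1)"
    using lookup_single_mult[of 0 "lookup g 0" f "single x 1"] by simp
  ultimately show ?thesis by (simp add: lookup_add)
qed

text \<open>Both variables are multiples of a generator \<open>f\<close>, which has no constant
  term. Comparing linear parts, both would be scalar multiples of the linear part of
  \<open>f\<close> and hence proportional.\<close>

lemma principal_monomial_prime_card:
  assumes "principalideal (monomial_prime A :: ('n::finite, 'k::field) mpoly set) poly_ring" "x \<in> A" "y \<in> A"
  shows "x = y"
proof (rule ccontr)
  assume xy: "x \<noteq> y"
  interpret principalideal "monomial_prime A :: ('n, 'k) mpoly set" poly_ring by (rule assms(1))
  obtain f :: "('n, 'k) mpoly" where f: "monomial_prime A = Idl\<^bsub>poly_ring\<^esub> {f}" using generate by auto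
  have "is_ideal (range (\<lambda>g. g * f))"
    unfolding is_ideal_def
  proof (intro conjI ballI allI)
    show "0 \<in> range (\<lambda>g. g * f)" by (rule range_eqI[of _ _ 0]) simp
    show "a + b \<in> range (\<lambda>g. g * f)" if ab: "a \<in> range (\<lambda>g. g * f)" "b \<in> range (\<lambda>g. g * f)" for a b
    proof -
      obtain g h where "a = g * f" "b = h * f" using ab by blast
      then show ?thesis by (intro range_eqI[of _ _ "g + h"]) (simp add: algebra_simps)
    qed
    show "r * a \<in> range (\<lambda>g. g * f)" if a: "a \<in> range (\<lambda>g. g * f)" for a r
    proof -
      obtain g where "a = g * f" using a by blast
      then show ?thesis by (intro range_eqI[of _ _ "r * g"]) (simp add: algebra_simps)
    qed
  qed
  moreover have "f \<in> range (\<lambda>g. g * f)" by (rule range_eqI[of _ _ 1]) simp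
  ultimately have sub: "monomial_prime A \<subseteq> range (\<lambda>g. g * f)"
    unfolding f genideal_type_ring by (intro Inter_lower) simp
  have mem: "indet z \<in> (monomial_prime A :: ('n, 'k) mpoly set)" if "z \<in> A" for z
    using that by (auto simp: monomial_prime_def genideal_type_ring)
  have "indet x \<in> range (\<lambda>g. g * f)" "indet y \<in> range (\<lambda>g. g * f)"
    using subsetD[OF sub mem] assms(2,3) by simp_all
  then obtain g h where gh: "indet x = g * f" "indet y = h * f" by (elim rangeE)
  have "f \<in> monomial_prime A" unfolding f genideal_type_ring by simp
  then have "lookup f 0 = 0" by (auto simp: monomial_prime_eq mono_ideal_def mem_var_fam_up in_keys_iff)
  note lin = lookup_mult_single_linear[OF this]
  have "lookup (indet x :: ('n, 'k) mpoly) (single x 1) = 1"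
    "lookup (indet y :: ('n, 'k) mpoly) (single y 1) = 1"
    by (simp_all add: indet_def)
  moreover have "single x (1::nat) \<noteq> single y 1"
    using xy by (metis lookup_single_eq lookup_single_not_eq zero_neq_one)
  then have "lookup (indet x :: ('n, 'k) mpoly) (single y 1) = 0"
    by (simp add: indet_def lookup_single_not_eq)
  ultimately show False using lin[of g x] lin[of g y] lin[of h y] gh by auto
qed

lemma principal_monomial_prime_singleton:
  "principalideal (monomial_prime {x} :: ('n::finite, 'k::field) mpoly set) poly_ring"
proof (rule principalidealI)
  show "ideal (monomial_prime {x} :: ('n, 'k) mpoly set) poly_ring"
    by (simp add: ideal_type_ring_iff monomial_prime_eq)
  show "\<exists>i\<in>carrier poly_ring. (monomial_prime {x} :: ('n, 'k) mpoly set) = Idl\<^bsub>poly_ring\<^esub> {i}"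
    by (intro bexI[of _ "indet x"]) (simp_all add: monomial_prime_def)
qed

text \<open>Generators in the variables \<open>V\<close> may have several terms, but each term lies
  in the monomial ideal and involves only \<open>V\<close>. So the monomials of \<open>U\<close> on
  \<open>V\<close> already generate.\<close>

lemma ideal_in_vars_mono_ideal:
  assumes "ideal_in_vars V (mono_ideal U :: ('n::finite, 'k::field) mpoly set)" "m \<in> U"
  shows "\<exists>m'\<in>U. keys m' \<subseteq> V \<and> (\<exists>q. m = m' + q)"
proof -
  obtain G where G: "\<forall>g\<in>G. poly_vars g \<subseteq> V" "(mono_ideal U :: ('n, 'k) mpoly set) = Idl\<^bsub>poly_ring\<^esub> G"
    using assms(1) by (auto simp: ideal_in_vars_def)
  let ?W = "up_closure {m'\<in>U. keys m' \<subseteq> V}"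
  have "G \<subseteq> mono_ideal ?W"
  proof
    fix g assume g: "g \<in> G"
    then have "g \<in> mono_ideal U" unfolding G(2) genideal_type_ring by blast
    then have "keys g \<subseteq> {m'\<in>U. keys m' \<subseteq> V}"
      using G(1) g by (auto simp: mono_ideal_def poly_vars_def)
    then show "g \<in> mono_ideal ?W" using up_closure_superset by (fastforce simp: mono_ideal_def)
  qed
  then have "(mono_ideal U :: ('n, 'k) mpoly set) \<subseteq> mono_ideal ?W"
    unfolding G(2) genideal_type_ring by (intro Inter_lower) (simp add: ideal_mono_ideal)
  then have "m \<in> ?W" using assms(2) by (auto simp: mono_ideal_mono)
  then show ?thesis by (auto simp: up_closure_def)
qed

lemma ideal_in_vars_facet_ideal: "ideal_in_vars (\<Union>(facets \<Delta>)) (facet_ideal \<Delta> :: ('n::finite, 'k::field) mpoly set)"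
  unfolding ideal_in_vars_def
proof (intro exI conjI)
  show "facet_ideal \<Delta> = Idl\<^bsub>poly_ring\<^esub> ((\<lambda>F. \<Prod>i \<in> F. indet i) ` facets \<Delta> :: ('n, 'k) mpoly set)"
    by (rule facet_ideal_def)
  show "\<forall>g\<in>(\<lambda>F. \<Prod>i \<in> F. indet i) ` facets \<Delta>. poly_vars (g :: ('n, 'k) mpoly) \<subseteq> \<Union>(facets \<Delta>)"
    by (auto simp: prod_indet poly_vars_def)
qed

text \<open>The ideal of a sunflower with core \<open>G\<close> is the product of the principal
  primes of the vertices of \<open>G\<close> and one prime on the petals \<open>Vs\<close>, which is
  the last factor, with index \<open>card G\<close>.\<close>

lemma prod_up_sunflower:
  fixes G :: "'n::finite set"
  assumes "Vs \<inter> G = {}"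
  shows "\<exists>A. disjoint_family_on A {..<Suc (card G)} \<and>
    prod_up A (Suc (card G)) = fam_up ((\<lambda>v. insert v G) ` Vs) \<and> (\<forall>j<card G. \<exists>x. A j = {x})"
proof -
  obtain e :: "nat \<Rightarrow> 'n" where e: "bij_betw e {0..<card G} G"
    using ex_bij_betw_nat_finite[of G] by auto
  define A where "A j = (if j < card G then {e j} else Vs)" for j
  have "disjoint_family_on A {..<Suc (card G)}"
    using bij_betwE[OF e] bij_betw_imp_inj_on[OF e] assms
    by (auto simp: disjoint_family_on_def A_def dest: inj_onD)
  moreover have "prod_up A (Suc (card G)) = fam_up ((\<lambda>v. insert v G) ` Vs)"
  proof -
    have sum: "(\<Sum>j<Suc (card G). single (a j) 1) = ind (insert v G)"
      if a: "\<forall>j<Suc (card G). a j \<in> A j" "v = a (card G)" for a v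
    proof -
      have "(\<Sum>j<card G. single (a j) (1::nat)) = (\<Sum>j<card G. single (e j) 1)"
      proof (rule sum.cong)
        fix j assume "j \<in> {..<card G}"
        then have "a j \<in> A j" "j < card G" using a(1) by auto
        then show "single (a j) (1::nat) = single (e j) 1" by (simp add: A_def)
      qed simp
      also have "\<dots> = ind G"
        unfolding ind_def using sum.reindex_bij_betw[OF e, of "\<lambda>i. single i (1::nat)"]
        by (simp add: atLeast0LessThan)
      finally have "(\<Sum>j<Suc (card G). single (a j) 1) = single v 1 + ind G"
        using a(2) by (simp add: add.commute)
      moreover have "v \<notin> G"
      proof -
        have "a (card G) \<in> A (card G)" using a(1) by blast
        then show ?thesis using a(2) assms by (auto simp: A_def)
      qed
      ultimately show ?thesis by (simp add: ind_def)
    qed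
    have "m \<in> prod_up A (Suc (card G)) \<longleftrightarrow> (\<exists>v\<in>Vs. \<exists>q. m = ind (insert v G) + q)" for m
    proof
      assume "m \<in> prod_up A (Suc (card G))"
      then obtain a q where a: "\<forall>j<Suc (card G). a j \<in> A j" "m = (\<Sum>j<Suc (card G). single (a j) 1) + q"
        by (auto simp: mem_prod_up)
      have "a (card G) \<in> Vs" using a(1) by (auto simp: A_def)
      then show "\<exists>v\<in>Vs. \<exists>q. m = ind (insert v G) + q" using a(2) sum[OF a(1) refl] by metis
    next
      assume "\<exists>v\<in>Vs. \<exists>q. m = ind (insert v G) + q"
      then obtain v q where v: "v \<in> Vs" "m = ind (insert v G) + q" by blast
      let ?a = "e(card G := v)"
      have "\<forall>j<Suc (card G). ?a j \<in> A j" using v(1) by (auto simp: A_def less_Suc_eq)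
      moreover then have "m = (\<Sum>j<Suc (card G). single (?a j) 1) + q" using v(2) sum[of ?a v] by simp
      ultimately show "m \<in> prod_up A (Suc (card G))" unfolding mem_prod_up by blast
    qed
    then show ?thesis by (auto simp: fam_up_def ind_edvd_iff)
  qed
  moreover have "\<forall>j<card G. \<exists>x. A j = {x}" by (simp add: A_def)
  ultimately show ?thesis by blast
qed


section \<open>Families connected in codimension one\<close>

definition ridge_rel :: "nat \<Rightarrow> 'n set set \<Rightarrow> ('n set \<times> 'n set) set" where
  "ridge_rel d \<F> = {(F, G). F \<in> \<F> \<and> G \<in> \<F> \<and> card (F \<inter> G) = d}"

definition ridge_connected :: "nat \<Rightarrow> 'n set set \<Rightarrow> bool" where
  "ridge_connected d \<F> \<longleftrightarrow> (\<forall>F\<in>\<F>. card F = Suc d) \<and> (\<forall>F\<in>\<F>. \<forall>G\<in>\<F>. (F, G) \<in> (ridge_rel d \<F>)\<^sup>*)"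

definition hereditary_leaves :: "'n set set \<Rightarrow> bool" where
  "hereditary_leaves \<F> \<longleftrightarrow> (\<forall>\<G>. \<G> \<subseteq> \<F> \<and> \<G> \<noteq> {} \<longrightarrow>
     (\<exists>F\<in>\<G>. \<G> = {F} \<or> (\<exists>G\<in>\<G>. G \<noteq> F \<and> (\<forall>H\<in>\<G>. H \<noteq> F \<longrightarrow> F \<inter> H \<subseteq> F \<inter> G))))"

definition free_vertices :: "'n set set \<Rightarrow> bool" where
  "free_vertices \<F> \<longleftrightarrow> (\<forall>F\<in>\<F>. \<exists>v\<in>F. \<forall>H\<in>\<F>. H \<noteq> F \<longrightarrow> v \<notin> H)"

text \<open>The indicator of \<open>Y\<close> is written as an integral combination, with
  coefficient sum 1, of the indicators of the members. So the monomial of \<open>Y\<close> is a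
  Laurent monomial of degree 1 in the facet monomials; for a path of three edges and
  \<open>Y\<close> its two end points, the middle edge gets coefficient -1.\<close>

definition affine_combination :: "'n set set \<Rightarrow> ('n set \<Rightarrow> int) \<Rightarrow> 'n set \<Rightarrow> bool" where
  "affine_combination \<F> m Y \<longleftrightarrow> (\<Sum>F\<in>\<F>. m F) = 1 \<and>
     (\<forall>v. (\<Sum>F\<in>\<F>. if v \<in> F then m F else 0) = (if v \<in> Y then 1 else 0))"

lemma card_Int_less:
  fixes F :: "'n::finite set"
  assumes "card F = Suc d" "card G = Suc d" "F \<noteq> G"
  shows "card (F \<inter> G) \<le> d"
proof (rule ccontr)
  assume "\<not> card (F \<inter> G) \<le> d"
  then have "card F \<le> card (F \<inter> G)" "card G \<le> card (F \<inter> G)" using assms by simp_all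
  then have "F \<inter> G = F" "F \<inter> G = G" by (simp_all add: card_seteq)
  then show False using assms(3) by simp
qed

text \<open>Connectedness gives \<open>F\<close> a neighbour across a ridge, and the leaf condition
  puts this ridge into \<open>F \<inter> G\<close>. So every neighbour of \<open>F\<close> contains
  \<open>F \<inter> G\<close> and is \<open>G\<close> or a neighbour of \<open>G\<close>, and paths
  through \<open>F\<close> can be rerouted through \<open>G\<close>.\<close>

lemma remove_leaf:
  fixes \<F> :: "'n::finite set set"
  assumes conn: "ridge_connected d \<F>"
    and FG: "F \<in> \<F>" "G \<in> \<F>" "G \<noteq> F" "\<And>H. H \<in> \<F> \<Longrightarrow> H \<noteq> F \<Longrightarrow> F \<inter> H \<subseteq> F \<inter> G"
  shows "card (F \<inter> G) = d" "ridge_connected d (\<F> - {F})"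
proof -
  have card: "card H = Suc d" if "H \<in> \<F>" for H using conn that by (simp add: ridge_connected_def)
  have "(F, G) \<in> (ridge_rel d \<F>)\<^sup>*" using conn FG by (simp add: ridge_connected_def)
  then obtain H where H: "(F, H) \<in> ridge_rel d \<F>" using FG(3) by (metis converse_rtranclE)
  then have H': "H \<in> \<F>" "card (F \<inter> H) = d" by (auto simp: ridge_rel_def)
  have "H \<noteq> F" using H' card[OF FG(1)] by auto
  then have "d \<le> card (F \<inter> G)" using card_mono[OF _ FG(4)[OF H'(1)]] H'(2) by simp
  then show cFG: "card (F \<inter> G) = d" using card_Int_less[OF card[OF FG(1)] card[OF FG(2)]] FG(3) by simp
  let ?R' = "ridge_rel d (\<F> - {F})"
  have nbr: "C = G \<or> ((G, C) \<in> ?R' \<and> (C, G) \<in> ?R')" if C: "C \<in> \<F>" "C \<noteq> F" "card (F \<inter> C) = d" for C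
  proof (cases "C = G")
    case False
    have "F \<inter> C = F \<inter> G" using FG(4)[OF C(1,2)] C(3) cFG by (intro card_subset_eq) auto
    then have "F \<inter> G \<subseteq> G \<inter> C" by auto
    then have "d \<le> card (G \<inter> C)" using cFG card_mono[of "G \<inter> C" "F \<inter> G"] by simp
    then have "card (G \<inter> C) = d" using card_Int_less[OF card[OF FG(2)] card[OF C(1)]] False by simp
    then show ?thesis using C FG by (auto simp: ridge_rel_def Int_commute)
  qed simp
  have path: "(B \<noteq> F \<longrightarrow> (A, B) \<in> ?R'\<^sup>*) \<and> (B = F \<longrightarrow> (A, G) \<in> ?R'\<^sup>*)"
    if "(A, B) \<in> (ridge_rel d \<F>)\<^sup>*" "A \<in> \<F> - {F}" for A B
    using that(1)
  proof (induction rule: rtrancl_induct)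
    case base
    then show ?case using that(2) by simp
  next
    case (step B C)
    have BC: "B \<in> \<F>" "C \<in> \<F>" "card (B \<inter> C) = d" using step.hyps(2) by (auto simp: ridge_rel_def)
    show ?case
    proof (cases "B = F")
      case BF: True
      show ?thesis
      proof (cases "C = F")
        case False
        then have "C = G \<or> (G, C) \<in> ?R'" using nbr[of C] BC BF by auto
        then show ?thesis using step.IH BF False by (auto intro: rtrancl.rtrancl_into_rtrancl)
      qed (use step.IH BF in simp)
    next
      case BF: False
      show ?thesis
      proof (cases "C = F")
        case True
        then have "B = G \<or> (B, G) \<in> ?R'" using nbr[of B] BC BF by (auto simp: Int_commute)
        then show ?thesis using step.IH BF True by (auto intro: rtrancl.rtrancl_into_rtrancl)
      next
        case False
        then have "(B, C) \<in> ?R'" using BC BF by (simp add: ridge_rel_def)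
        then show ?thesis using step.IH BF False by (auto intro: rtrancl.rtrancl_into_rtrancl)
      qed
    qed
  qed
  show "ridge_connected d (\<F> - {F})"
    unfolding ridge_connected_def
  proof (intro conjI ballI)
    fix A B assume AB: "A \<in> \<F> - {F}" "B \<in> \<F> - {F}"
    then have "(A, B) \<in> (ridge_rel d \<F>)\<^sup>*" using conn by (simp add: ridge_connected_def)
    then show "(A, B) \<in> ?R'\<^sup>*" using path AB by blast
  qed (use card in simp)
qed

text \<open>
  The colouring identifies the vertices that are exchanged across ridges.
\<close>

lemma tree_colouring:
  fixes \<F> :: "'n::finite set set"
  assumes "\<F> \<noteq> {}" "ridge_connected d \<F>" "hereditary_leaves \<F>"
  shows "\<exists>\<kappa>. (\<forall>F\<in>\<F>. bij_betw \<kappa> F {..d}) \<and> card (\<Union>\<F>) = card \<F> + d \<and>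
    (\<forall>Y. Y \<subseteq> \<Union>\<F> \<and> bij_betw \<kappa> Y {..d} \<longrightarrow> (\<exists>m. affine_combination \<F> m Y))"
  using assms
proof (induction "card \<F>" arbitrary: \<F> rule: less_induct)
  case (less \<F>)
  have card: "card H = Suc d" if "H \<in> \<F>" for H using less.prems(2) that by (simp add: ridge_connected_def)
  obtain F where F: "F \<in> \<F>" "\<F> = {F} \<or> (\<exists>G\<in>\<F>. G \<noteq> F \<and> (\<forall>H\<in>\<F>. H \<noteq> F \<longrightarrow> F \<inter> H \<subseteq> F \<inter> G))"
    using less.prems(3)[unfolded hereditary_leaves_def, rule_format, of \<F>] less.prems(1) by auto
  show ?case
  proof (cases "\<F> = {F}")
    case True
    obtain \<kappa> where \<kappa>: "bij_betw \<kappa> F {0..<card F}" using ex_bij_betw_finite_nat[of F] by auto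
    have "{0..<card F} = {..d}" using card[OF F(1)] by auto
    with \<kappa> have \<kappa>: "bij_betw \<kappa> F {..d}" by simp
    have "Y = F" if "Y \<subseteq> F" "bij_betw \<kappa> Y {..d}" for Y
      using that bij_betw_same_card[OF that(2)] card[OF F(1)] by (intro card_subset_eq) auto
    then have "\<exists>m. affine_combination \<F> m Y"
      if "Y \<subseteq> \<Union>\<F>" "bij_betw \<kappa> Y {..d}" for Y
    proof -
      have "Y = F" using \<open>\<And>Y. Y \<subseteq> F \<Longrightarrow> bij_betw \<kappa> Y {..d} \<Longrightarrow> Y = F\<close> that True by simp
      then show ?thesis using True by (intro exI[of _ "\<lambda>_. 1"]) (simp add: affine_combination_def)
    qed
    then show ?thesis using \<kappa> True card[OF F(1)] by (intro exI[of _ \<kappa>]) simp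
  next
    case False
    then obtain G where G: "G \<in> \<F>" "G \<noteq> F" "\<And>H. H \<in> \<F> \<Longrightarrow> H \<noteq> F \<Longrightarrow> F \<inter> H \<subseteq> F \<inter> G" using F(2) by blast
    note leaf = remove_leaf[OF less.prems(2) F(1) G]
    let ?\<F>' = "\<F> - {F}"
    have \<F>: "\<F> = insert F ?\<F>'" using F(1) by blast
    have "card (F - G) = 1" using leaf(1) card[OF F(1)] by (simp add: card_Diff_subset_Int)
    then obtain v where v: "F - G = {v}" by (auto simp: card_1_singleton_iff)
    have "card (G - F) = 1" using leaf(1) card[OF G(1)] by (simp add: card_Diff_subset_Int Int_commute)
    then obtain v' where v': "G - F = {v'}" by (auto simp: card_1_singleton_iff)
    have vv': "v \<noteq> v'" "v \<in> F" "v \<notin> G" "v' \<in> G" "v' \<notin> F" using v v' by auto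
    have Fv: "F = insert v (F \<inter> G)" and Gv': "G = insert v' (F \<inter> G)" using v v' by auto
    have v_new: "v \<notin> H" if "H \<in> ?\<F>'" for H using G(3)[of H] that vv' by auto
    have "card ?\<F>' < card \<F>" using F(1) by (intro psubset_card_mono) auto
    moreover have "?\<F>' \<noteq> {}" using G by auto
    moreover have "hereditary_leaves ?\<F>'" using less.prems(3) unfolding hereditary_leaves_def by blast
    ultimately obtain \<kappa>' where \<kappa>': "\<forall>F\<in>?\<F>'. bij_betw \<kappa>' F {..d}" "card (\<Union>?\<F>') = card ?\<F>' + d"
      and comb: "\<And>Y. Y \<subseteq> \<Union>?\<F>' \<Longrightarrow> bij_betw \<kappa>' Y {..d} \<Longrightarrow> \<exists>m. affine_combination ?\<F>' m Y"
      using less.hyps[of ?\<F>'] leaf(2) by blast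
    \<comment> \<open>The new vertex \<open>v\<close> of the leaf replaces \<open>v'\<close> across
      the common ridge and takes over its colour.\<close>
    define \<kappa> where "\<kappa> = \<kappa>'(v := \<kappa>' v')"
    have same: "bij_betw \<kappa> H B \<longleftrightarrow> bij_betw \<kappa>' H B" if "v \<notin> H" for H B
      using that by (intro bij_betw_cong) (auto simp: \<kappa>_def)
    have bijG: "bij_betw \<kappa>' G {..d}" using \<kappa>' G by blast
    have "bij_betw \<kappa> H {..d}" if H: "H \<in> \<F>" for H
    proof (cases "H = F")
      case True
      have "\<kappa> ` F = insert (\<kappa> v) (\<kappa> ` (F \<inter> G))" by (subst Fv) (simp only: image_insert)
      also have "\<kappa> ` (F \<inter> G) = \<kappa>' ` (F \<inter> G)" using vv' by (intro image_cong) (auto simp: \<kappa>_def)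
      also have "insert (\<kappa> v) (\<kappa>' ` (F \<inter> G)) = \<kappa>' ` insert v' (F \<inter> G)" by (simp add: \<kappa>_def)
      also have "\<dots> = {..d}" using bijG Gv' by (simp add: bij_betw_def)
      finally have im: "\<kappa> ` F = {..d}" .
      then have "card (\<kappa> ` F) = card F" using card[OF F(1)] by simp
      then show ?thesis using im True by (auto simp: bij_betw_def intro: eq_card_imp_inj_on)
    next
      case False
      then show ?thesis using \<kappa>'(1) H v_new same by auto
    qed
    moreover have "card (\<Union>\<F>) = card \<F> + d"
    proof -
      have "\<Union>\<F> = insert v (\<Union>?\<F>')" using \<F> Fv G(1,2) by blast
      moreover have "v \<notin> \<Union>?\<F>'" using v_new by auto
      moreover have "card \<F> = Suc (card ?\<F>')" using F(1) by (metis card_Suc_Diff1 finite)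
      ultimately show ?thesis using \<kappa>'(2) by simp
    qed
    moreover have "\<exists>m. affine_combination \<F> m Y"
      if Y: "Y \<subseteq> \<Union>\<F>" "bij_betw \<kappa> Y {..d}" for Y
    proof -
      have sub: "\<Union>\<F> \<subseteq> insert v (\<Union>?\<F>')" using \<F> Fv G(1,2) by blast
      have sum_split: "(\<Sum>H\<in>\<F>. h H) = h F + (\<Sum>H\<in>?\<F>'. h H)" for h :: "'n set \<Rightarrow> int"
        using F(1) by (intro sum.remove) auto
      show ?thesis
      proof (cases "v \<in> Y")
        case False
        then have "Y \<subseteq> \<Union>?\<F>'" "bij_betw \<kappa>' Y {..d}" using Y(1) sub Y(2) same[OF False] by blast+
        then obtain m where "affine_combination ?\<F>' m Y" using comb by blast
        then have m: "(\<Sum>F\<in>?\<F>'. m F) = 1"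
          "\<And>w. (\<Sum>F\<in>?\<F>'. if w \<in> F then m F else 0) = (if w \<in> Y then 1 else 0)"
          by (simp_all add: affine_combination_def)
        have "(\<Sum>H\<in>?\<F>'. (m(F := 0)) H) = (\<Sum>H\<in>?\<F>'. m H)" by (intro sum.cong) auto
        moreover have "(\<Sum>H\<in>?\<F>'. if w \<in> H then (m(F := 0)) H else 0) = (\<Sum>H\<in>?\<F>'. if w \<in> H then m H else 0)" for w
          by (intro sum.cong) auto
        ultimately show ?thesis using m by (intro exI[of _ "m(F := 0)"]) (simp add: sum_split affine_combination_def)
      next
        case True
        have v'Y: "v' \<notin> Y"
        proof
          assume "v' \<in> Y"
          then have "v = v'" using True inj_onD[OF bij_betw_imp_inj_on[OF Y(2)], of v v'] vv' by (simp add: \<kappa>_def)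
          then show False using vv' by simp
        qed
        \<comment> \<open>Exchanging \<open>v\<close> for \<open>v'\<close> moves \<open>Y\<close>
          into the smaller family. Adding \<open>F\<close> and subtracting \<open>G\<close>
          afterwards restores \<open>v\<close> and removes \<open>v'\<close>; this is where negative
          coefficients arise.\<close>
        define Y' where "Y' = insert v' (Y - {v})"
        have "Y' \<subseteq> \<Union>?\<F>'" using Y(1) sub vv' G by (auto simp: Y'_def)
        moreover have "bij_betw \<kappa>' Y' {..d}"
        proof -
          have "\<kappa>' ` Y' = insert (\<kappa> v) (\<kappa>' ` (Y - {v}))" by (simp add: Y'_def \<kappa>_def)
          also have "\<kappa>' ` (Y - {v}) = \<kappa> ` (Y - {v})" by (intro image_cong) (auto simp: \<kappa>_def)
          also have "insert (\<kappa> v) (\<kappa> ` (Y - {v})) = \<kappa> ` Y" using True by auto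
          also have "\<dots> = {..d}" using Y(2) by (simp add: bij_betw_def)
          finally have im: "\<kappa>' ` Y' = {..d}" .
          have "card Y' = Suc (card (Y - {v}))" unfolding Y'_def using v'Y by (intro card_insert_disjoint) auto
          also have "\<dots> = card Y" using True by (intro card_Suc_Diff1) auto
          also have "\<dots> = card {..d}" using bij_betw_same_card[OF Y(2)] .
          finally have "card (\<kappa>' ` Y') = card Y'" using im by simp
          then show ?thesis using im by (auto simp: bij_betw_def intro: eq_card_imp_inj_on)
        qed
        ultimately obtain m where "affine_combination ?\<F>' m Y'" using comb by blast
        then have m: "(\<Sum>F\<in>?\<F>'. m F) = 1"
          "\<And>w. (\<Sum>F\<in>?\<F>'. if w \<in> F then m F else 0) = (if w \<in> Y' then 1 else 0)"
          by (simp_all add: affine_combination_def)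
        define m' where "m' H = (if H = F then 1 else if H = G then m G - 1 else m H)" for H
        have G': "G \<in> ?\<F>'" using G by simp
        have "(\<Sum>H\<in>?\<F>'. m' H) = (\<Sum>H\<in>?\<F>'. m H - (if H = G then 1 else 0))"
          by (intro sum.cong) (auto simp: m'_def)
        also have "\<dots> = 0" using m(1) G' by (simp add: sum_subtractf)
        finally have "(\<Sum>H\<in>\<F>. m' H) = 1" unfolding sum_split by (simp add: m'_def)
        moreover have "(\<Sum>H\<in>\<F>. if w \<in> H then m' H else 0) = (if w \<in> Y then 1 else 0)" for w
        proof -
          have "(\<Sum>H\<in>?\<F>'. if w \<in> H then m' H else 0) =
              (\<Sum>H\<in>?\<F>'. (if w \<in> H then m H else 0) - (if H = G then (if w \<in> G then 1 else 0) else 0))"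
            by (intro sum.cong) (auto simp: m'_def)
          also have "\<dots> = (if w \<in> Y' then 1 else 0) - (if w \<in> G then 1 else 0)"
            using m(2) G' by (simp add: sum_subtractf)
          finally have "(\<Sum>H\<in>\<F>. if w \<in> H then m' H else 0) =
              (if w \<in> F then 1 else 0) + ((if w \<in> Y' then 1 else 0) - (if w \<in> G then 1 else 0))"
            unfolding sum_split by (simp add: m'_def)
          moreover have "w \<in> F \<longleftrightarrow> w \<in> G" if "w \<noteq> v" "w \<noteq> v'" using that v v' by blast
          ultimately show ?thesis
            using vv' v'Y True by (cases "w = v"; cases "w = v'") (auto simp: Y'_def)
        qed
        ultimately show ?thesis unfolding affine_combination_def by blast
      qed
    qed
    ultimately show ?thesis by blast
  qed
qed

text \<open>Across a ridge between distinct \<open>F\<close> and \<open>H\<close>, the intersection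
  has \<open>d\<close> elements and avoids \<open>v F\<close>, so it equals \<open>F - {v F}\<close>
  and, by symmetry, \<open>H - {v H}\<close>. The core is therefore constant along ridge
  paths.\<close>

lemma ridge_connected_sunflower:
  fixes \<F> :: "'n::finite set set"
  assumes conn: "ridge_connected d \<F>" and ne: "\<F> \<noteq> {}"
    and v: "\<And>F. F \<in> \<F> \<Longrightarrow> v F \<in> F" "\<And>F H. F \<in> \<F> \<Longrightarrow> H \<in> \<F> \<Longrightarrow> F \<noteq> H \<Longrightarrow> v F \<notin> H"
  shows "\<exists>G. (\<forall>F\<in>\<F>. F - {v F} = G) \<and> v ` \<F> \<inter> G = {}"
proof -
  have card: "card H = Suc d" if "H \<in> \<F>" for H using conn that by (simp add: ridge_connected_def)
  have step: "F - {v F} = H - {v H}" if "(F, H) \<in> ridge_rel d \<F>" for F H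
  proof (cases "F = H")
    case False
    have FH: "F \<in> \<F>" "H \<in> \<F>" "card (F \<inter> H) = d" using that by (auto simp: ridge_rel_def)
    have "F \<inter> H = F - {v F}"
      using v(2)[OF FH(1,2) False] v(1)[OF FH(1)] FH card[OF FH(1)] by (intro card_subset_eq) auto
    moreover have "F \<inter> H = H - {v H}"
      using v(2)[OF FH(2,1)] False v(1)[OF FH(2)] FH card[OF FH(2)] by (intro card_subset_eq) auto
    ultimately show ?thesis by simp
  qed simp
  have all: "F - {v F} = H - {v H}" if "(F, H) \<in> (ridge_rel d \<F>)\<^sup>*" for F H
    using that by (induction rule: rtrancl_induct) (use step in auto)
  obtain F0 where F0: "F0 \<in> \<F>" using ne by blast
  let ?G = "F0 - {v F0}"
  have G: "F - {v F} = ?G" if "F \<in> \<F>" for F using all[of F F0] conn that F0 by (simp add: ridge_connected_def)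
  moreover have "v F \<notin> ?G" if "F \<in> \<F>" for F using G[OF that] by blast
  ultimately show ?thesis by (intro exI[of _ ?G]) blast
qed


section \<open>Components of a simplicial complex\<close>

lemma face_in_facet:
  fixes \<Delta> :: "'n::finite set set"
  assumes "A \<in> \<Delta>"
  shows "\<exists>F\<in>facets \<Delta>. A \<subseteq> F"
proof -
  have "finite \<Delta>" by simp
  then obtain F where "F \<in> \<Delta>" "A \<subseteq> F" "\<forall>G\<in>\<Delta>. F \<subseteq> G \<longrightarrow> F = G"
    using finite_has_maximal2[OF _ assms] by blast
  then show ?thesis by (auto simp: facets_def)
qed

lemma facets_antichain: "F \<in> facets \<Delta> \<Longrightarrow> G \<in> facets \<Delta> \<Longrightarrow> F \<subseteq> G \<Longrightarrow> F = G"
  by (auto simp: facets_def)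

definition edge_rel :: "'n set set \<Rightarrow> ('n \<times> 'n) set" where
  "edge_rel \<Delta> = {(a, b). {a, b} \<in> \<Delta>}"

definition component_of :: "'n set set \<Rightarrow> 'n \<Rightarrow> 'n set set" where
  "component_of \<Delta> v = {F \<in> \<Delta>. \<forall>w\<in>F. (v, w) \<in> (edge_rel \<Delta>)\<^sup>*}"

lemma edge_rel_face: "simplicial_complex \<Delta> \<Longrightarrow> F \<in> \<Delta> \<Longrightarrow> a \<in> F \<Longrightarrow> b \<in> F \<Longrightarrow> (a, b) \<in> edge_rel \<Delta>"
  unfolding simplicial_complex_def edge_rel_def by auto

lemma edge_rel_sym: "(a, b) \<in> (edge_rel \<Delta>)\<^sup>* \<Longrightarrow> (b, a) \<in> (edge_rel \<Delta>)\<^sup>*"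
proof -
  have "sym (edge_rel \<Delta>)" by (auto simp: sym_def edge_rel_def insert_commute)
  then show "(a, b) \<in> (edge_rel \<Delta>)\<^sup>* \<Longrightarrow> (b, a) \<in> (edge_rel \<Delta>)\<^sup>*" using sym_rtrancl by (auto dest: symD)
qed

lemma singleton_face: "simplicial_complex \<Delta> \<Longrightarrow> v \<in> \<Union>\<Delta> \<Longrightarrow> {v} \<in> \<Delta>"
  unfolding simplicial_complex_def by auto

lemma singleton_component_of: "simplicial_complex \<Delta> \<Longrightarrow> v \<in> \<Union>\<Delta> \<Longrightarrow> {v} \<in> component_of \<Delta> v"
  by (auto simp: component_of_def intro: singleton_face)

lemma connected_complex_alt:
  "connected_complex \<Gamma> \<longleftrightarrow> (\<forall>u \<in> \<Union>\<Gamma>. \<forall>v \<in> \<Union>\<Gamma>. (u, v) \<in> (edge_rel \<Gamma>)\<^sup>*)"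
  by (simp add: connected_complex_def edge_rel_def)

lemma connected_subset_component_of:
  assumes "connected_subcomplex \<Delta> \<Gamma>" "v \<in> \<Union>\<Gamma>"
  shows "\<Gamma> \<subseteq> component_of \<Delta> v"
proof
  fix F assume F: "F \<in> \<Gamma>"
  have sub: "\<Gamma> \<subseteq> \<Delta>" using assms(1) by (simp add: connected_subcomplex_def)
  then have "edge_rel \<Gamma> \<subseteq> edge_rel \<Delta>" by (auto simp: edge_rel_def)
  then have mono: "(edge_rel \<Gamma>)\<^sup>* \<subseteq> (edge_rel \<Delta>)\<^sup>*" by (rule rtrancl_mono)
  have "(v, w) \<in> (edge_rel \<Gamma>)\<^sup>*" if "w \<in> F" for w
    using assms F that by (auto simp: connected_subcomplex_def connected_complex_alt)
  then show "F \<in> component_of \<Delta> v" using mono sub F by (auto simp: component_of_def)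
qed

lemma connected_component_of:
  assumes "simplicial_complex \<Delta>"
  shows "connected_subcomplex \<Delta> (component_of \<Delta> v)"
proof -
  have "{} \<in> \<Delta>" using assms unfolding simplicial_complex_def by blast
  then have sc: "simplicial_complex (component_of \<Delta> v)"
    using assms unfolding simplicial_complex_def component_of_def by blast
  have path: "(a, b) \<in> (edge_rel (component_of \<Delta> v))\<^sup>*" if "(a, b) \<in> (edge_rel \<Delta>)\<^sup>*" "(v, a) \<in> (edge_rel \<Delta>)\<^sup>*" for a b
    using that(1)
  proof (induction rule: rtrancl_induct)
    case (step b c)
    have vb: "(v, b) \<in> (edge_rel \<Delta>)\<^sup>*" using that(2) step.hyps(1) by (rule rtrancl_trans)
    then have "(v, c) \<in> (edge_rel \<Delta>)\<^sup>*" using step.hyps(2) by (rule rtrancl_into_rtrancl)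
    then have "(b, c) \<in> edge_rel (component_of \<Delta> v)"
      using vb step.hyps(2) by (auto simp: edge_rel_def component_of_def)
    then show ?case by (rule rtrancl_into_rtrancl[OF step.IH])
  qed simp
  have "(a, b) \<in> (edge_rel (component_of \<Delta> v))\<^sup>*"
    if "a \<in> \<Union>(component_of \<Delta> v)" "b \<in> \<Union>(component_of \<Delta> v)" for a b
  proof -
    have va: "(v, a) \<in> (edge_rel \<Delta>)\<^sup>*" "(v, b) \<in> (edge_rel \<Delta>)\<^sup>*" using that by (auto simp: component_of_def)
    then have "(a, b) \<in> (edge_rel \<Delta>)\<^sup>*" using edge_rel_sym rtrancl_trans by metis
    then show ?thesis using path va(1) by simp
  qed
  then show ?thesis using sc by (auto simp: connected_subcomplex_def connected_complex_alt component_of_def)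
qed

text \<open>Maximal connected subcomplexes correspond to classes of vertices under edge paths. The
  complex \<open>{{}}\<close> is set apart because it is its own component but has no
  vertex.\<close>

lemma complex_components_eq:
  assumes "simplicial_complex \<Delta>" "\<Delta> \<noteq> {{}}"
  shows "complex_components \<Delta> = component_of \<Delta> ` \<Union>\<Delta>"
proof (intro equalityI subsetI)
  fix \<Gamma> assume \<Gamma>: "\<Gamma> \<in> complex_components \<Delta>"
  then have con: "connected_subcomplex \<Delta> \<Gamma>"
    and max: "\<And>\<Gamma>'. connected_subcomplex \<Delta> \<Gamma>' \<Longrightarrow> \<Gamma> \<subseteq> \<Gamma>' \<Longrightarrow> \<Gamma>' = \<Gamma>"
    by (auto simp: complex_components_def)
  have ne: "{} \<in> \<Delta>" "\<Delta> \<noteq> {}" using assms(1) unfolding simplicial_complex_def by blast+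
  then obtain x where x: "x \<in> \<Union>\<Delta>" using assms(2) by blast
  have "\<Union>\<Gamma> \<noteq> {}"
  proof
    assume "\<Union>\<Gamma> = {}"
    then have "\<Gamma> \<subseteq> {{}}" by auto
    moreover have "{} \<in> component_of \<Delta> x" using ne by (simp add: component_of_def)
    ultimately have "component_of \<Delta> x = \<Gamma>" using max[OF connected_component_of[OF assms(1), of x]] by blast
    then show False using singleton_component_of[OF assms(1) x] \<open>\<Gamma> \<subseteq> {{}}\<close> by auto
  qed
  then obtain v where v: "v \<in> \<Union>\<Gamma>" by blast
  then have "component_of \<Delta> v = \<Gamma>"
    using max[OF connected_component_of[OF assms(1), of v]] connected_subset_component_of[OF con] by blast
  moreover have "v \<in> \<Union>\<Delta>" using v con by (auto simp: connected_subcomplex_def)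
  ultimately show "\<Gamma> \<in> component_of \<Delta> ` \<Union>\<Delta>" by blast
next
  fix \<Gamma> assume "\<Gamma> \<in> component_of \<Delta> ` \<Union>\<Delta>"
  then obtain v where v: "v \<in> \<Union>\<Delta>" "\<Gamma> = component_of \<Delta> v" by blast
  have "\<Gamma>' = \<Gamma>" if "connected_subcomplex \<Delta> \<Gamma>'" "\<Gamma> \<subseteq> \<Gamma>'" for \<Gamma>'
  proof -
    have "v \<in> \<Union>\<Gamma>'" using singleton_component_of[OF assms(1) v(1)] that(2) v(2) by blast
    then show ?thesis using connected_subset_component_of[OF that(1)] that(2) v(2) by blast
  qed
  then show "\<Gamma> \<in> complex_components \<Delta>"
    using connected_component_of[OF assms(1), of v] v(2) by (auto simp: complex_components_def)
qed

lemma facets_nonempty: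
  assumes "simplicial_complex \<Delta>" "\<Delta> \<noteq> {{}}" "F \<in> facets \<Delta>"
  shows "F \<noteq> {}"
proof
  assume "F = {}"
  then have "\<forall>G\<in>\<Delta>. G = {}" using assms(3) by (auto simp: facets_def)
  then show False using assms(1,2) by (auto simp: simplicial_complex_def)
qed

lemma face_subset_component:
  assumes "simplicial_complex \<Delta>" "F \<in> \<Delta>" "a \<in> F" "(v, a) \<in> (edge_rel \<Delta>)\<^sup>*"
  shows "F \<in> component_of \<Delta> v"
proof -
  have "(v, w) \<in> (edge_rel \<Delta>)\<^sup>*" if "w \<in> F" for w
    using assms(4) edge_rel_face[OF assms(1-3) that] by (rule rtrancl_into_rtrancl)
  then show ?thesis using assms(2) by (simp add: component_of_def)
qed

lemma facets_component_of:
  assumes "simplicial_complex \<Delta>" "\<Delta> \<noteq> {{}}" "v \<in> \<Union>\<Delta>"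
  shows "facets (component_of \<Delta> v) = facets \<Delta> \<inter> component_of \<Delta> v"
proof (intro equalityI subsetI)
  fix F assume F: "F \<in> facets (component_of \<Delta> v)"
  then have FC: "F \<in> component_of \<Delta> v" and max: "\<And>G. G \<in> component_of \<Delta> v \<Longrightarrow> F \<subseteq> G \<Longrightarrow> G = F"
    by (auto simp: facets_def)
  have "F \<noteq> {}" using max[OF singleton_component_of[OF assms(1,3)]] by auto
  then obtain a where a: "a \<in> F" by blast
  have va: "(v, a) \<in> (edge_rel \<Delta>)\<^sup>*" using FC a by (simp add: component_of_def)
  have "G = F" if "G \<in> \<Delta>" "F \<subseteq> G" for G
    using max[OF face_subset_component[OF assms(1) that(1) _ va]] that(2) a by blast
  then show "F \<in> facets \<Delta> \<inter> component_of \<Delta> v" using FC by (auto simp: facets_def component_of_def)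
qed (auto simp: facets_def component_of_def)

lemma Union_facets_components:
  assumes "simplicial_complex \<Delta>" "\<Delta> \<noteq> {{}}"
  shows "facets \<Delta> = (\<Union>\<Gamma>\<in>complex_components \<Delta>. facets \<Gamma>)"
proof (intro equalityI subsetI)
  fix F assume F: "F \<in> facets \<Delta>"
  then obtain v where v: "v \<in> F" using facets_nonempty[OF assms] by blast
  have "F \<in> \<Delta>" using F by (simp add: facets_def)
  then have "F \<in> component_of \<Delta> v" "v \<in> \<Union>\<Delta>" using face_subset_component[OF assms(1) _ v] v by auto
  then show "F \<in> (\<Union>\<Gamma>\<in>complex_components \<Delta>. facets \<Gamma>)"
    using F by (auto simp: complex_components_eq[OF assms] facets_component_of[OF assms])
next
  fix F assume "F \<in> (\<Union>\<Gamma>\<in>complex_components \<Delta>. facets \<Gamma>)"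
  then show "F \<in> facets \<Delta>"
    by (auto simp: complex_components_eq[OF assms] facets_component_of[OF assms])
qed

lemma components_disjoint:
  assumes "simplicial_complex \<Delta>" "\<Delta> \<noteq> {{}}"
    and "\<Gamma> \<in> complex_components \<Delta>" "\<Gamma>' \<in> complex_components \<Delta>" "F \<in> facets \<Gamma>" "F' \<in> facets \<Gamma>'" "a \<in> F" "a \<in> F'"
  shows "\<Gamma> = \<Gamma>'"
proof -
  obtain v v' where v: "v \<in> \<Union>\<Delta>" "\<Gamma> = component_of \<Delta> v" "v' \<in> \<Union>\<Delta>" "\<Gamma>' = component_of \<Delta> v'"
    using assms(3,4) by (auto simp: complex_components_eq[OF assms(1,2)])
  have "(v, a) \<in> (edge_rel \<Delta>)\<^sup>*" "(v', a) \<in> (edge_rel \<Delta>)\<^sup>*"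
    using assms(5-8) v by (auto simp: facets_def component_of_def)
  then have "(v, v') \<in> (edge_rel \<Delta>)\<^sup>*" "(v', v) \<in> (edge_rel \<Delta>)\<^sup>*" using edge_rel_sym rtrancl_trans by metis+
  then have "(v, w) \<in> (edge_rel \<Delta>)\<^sup>* \<longleftrightarrow> (v', w) \<in> (edge_rel \<Delta>)\<^sup>*" for w using rtrancl_trans by metis
  then show ?thesis using v by (simp add: component_of_def)
qed

lemma component_facets_nonempty:
  fixes \<Delta> :: "'n::finite set set"
  assumes "simplicial_complex \<Delta>" "\<Delta> \<noteq> {{}}" "\<Gamma> \<in> complex_components \<Delta>"
  shows "facets \<Gamma> \<noteq> {}"
proof -
  obtain v where "v \<in> \<Union>\<Delta>" "\<Gamma> = component_of \<Delta> v" using assms(3) by (auto simp: complex_components_eq[OF assms(1,2)])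
  then show ?thesis using face_in_facet[OF singleton_component_of[OF assms(1)], of v] by auto
qed

lemma complex_components_nonempty:
  assumes "simplicial_complex \<Delta>" "\<Delta> \<noteq> {{}}"
  shows "complex_components \<Delta> \<noteq> {}"
  using assms by (auto simp: complex_components_eq[OF assms] simplicial_complex_def)

section \<open>From facet paths and forests to families of sets\<close>

lemma ridge_path:
  assumes "Fs \<noteq> []" "set Fs \<subseteq> \<F>" "\<forall>i. Suc i < length Fs \<longrightarrow> card (Fs ! i \<inter> Fs ! Suc i) = d"
  shows "(hd Fs, last Fs) \<in> (ridge_rel d \<F>)\<^sup>*"
  using assms
proof (induction Fs)
  case (Cons F Fs)
  show ?case
  proof (cases Fs)
    case (Cons H Hs)
    have "card (F \<inter> H) = d" using Cons.prems(3)[rule_format, of 0] Cons by simp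
    then have "(F, H) \<in> ridge_rel d \<F>" using Cons.prems(2) Cons by (simp add: ridge_rel_def)
    moreover have "(H, last Fs) \<in> (ridge_rel d \<F>)\<^sup>*"
    proof -
      have "card (Fs ! i \<inter> Fs ! Suc i) = d" if "Suc i < length Fs" for i
        using Cons.prems(3)[rule_format, of "Suc i"] that by simp
      then show ?thesis using Cons.IH Cons.prems(2) Cons by simp
    qed
    ultimately show ?thesis using Cons by (simp add: converse_rtrancl_into_rtrancl)
  qed simp
qed simp

lemma connected_in_codim_one_ridge_connected:
  fixes \<Gamma> :: "'n::finite set set"
  assumes "connected_in_codim_one \<Gamma>" "\<And>F. F \<in> facets \<Gamma> \<Longrightarrow> card F = Suc d" "\<Gamma> \<noteq> {}"
  shows "ridge_connected d (facets \<Gamma>)"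
proof -
  have "complex_dim \<Gamma> = int d"
    unfolding complex_dim_def
  proof (rule Max_eqI)
    fix y assume "y \<in> face_dim ` \<Gamma>"
    then obtain A where A: "A \<in> \<Gamma>" "y = face_dim A" by blast
    then obtain F where F: "F \<in> facets \<Gamma>" "A \<subseteq> F" using face_in_facet by blast
    then have "card A \<le> Suc d" using card_mono[of F A] assms(2) by simp
    then show "y \<le> int d" using A by (simp add: face_dim_def)
  next
    obtain A where "A \<in> \<Gamma>" using assms(3) by blast
    then obtain F where F: "F \<in> facets \<Gamma>" using face_in_facet by blast
    then have "F \<in> \<Gamma>" "int d = face_dim F" using assms(2) by (auto simp: facets_def face_dim_def)
    then show "int d \<in> face_dim ` \<Gamma>" by blast
  qed simp
  then have dim: "face_dim A = complex_dim \<Gamma> - 1 \<longleftrightarrow> card A = d" for A :: "'n set"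
    by (auto simp: face_dim_def)
  have "(F, G) \<in> (ridge_rel d (facets \<Gamma>))\<^sup>*" if "F \<in> facets \<Gamma>" "G \<in> facets \<Gamma>" for F G
  proof -
    have "\<exists>Fs. Fs \<noteq> [] \<and> set Fs \<subseteq> facets \<Gamma> \<and> hd Fs = F \<and> last Fs = G \<and>
        (\<forall>i. Suc i < length Fs \<longrightarrow> card (Fs ! i \<inter> Fs ! Suc i) = d)"
      using bspec[OF bspec[OF assms(1)[unfolded connected_in_codim_one_def dim] that(1)] that(2)] .
    then obtain Fs where "Fs \<noteq> []" "set Fs \<subseteq> facets \<Gamma>" "hd Fs = F" "last Fs = G"
      "\<forall>i. Suc i < length Fs \<longrightarrow> card (Fs ! i \<inter> Fs ! Suc i) = d"
      by (elim exE conjE)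
    then show ?thesis using ridge_path[of Fs "facets \<Gamma>" d] by simp
  qed
  then show ?thesis using assms(2) by (simp add: ridge_connected_def)
qed

text \<open>As facets form an antichain, a subfamily of them generates a complex whose facets are
  exactly this subfamily.\<close>

lemma simplicial_forest_hereditary_leaves:
  assumes "simplicial_forest \<Delta>"
  shows "hereditary_leaves (facets \<Delta>)"
  unfolding hereditary_leaves_def
proof (intro allI impI)
  fix \<G> assume \<G>: "\<G> \<subseteq> facets \<Delta> \<and> \<G> \<noteq> {}"
  let ?\<Gamma> = "{A. \<exists>F\<in>\<G>. A \<subseteq> F}"
  have fac: "facets ?\<Gamma> = \<G>"
  proof (intro equalityI subsetI)
    fix F assume "F \<in> facets ?\<Gamma>"
    then show "F \<in> \<G>" by (auto simp: facets_def)
  next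
    fix F assume F: "F \<in> \<G>"
    have "G = F" if G: "G \<in> ?\<Gamma>" "F \<subseteq> G" for G
    proof -
      obtain H where H: "H \<in> \<G>" "G \<subseteq> H" using G(1) by blast
      then have "F = H" using facets_antichain[of F \<Delta> H] \<G> F G(2) by blast
      then show ?thesis using H G(2) by blast
    qed
    then show "F \<in> facets ?\<Gamma>" using F by (auto simp: facets_def)
  qed
  have "simplicial_complex ?\<Gamma>" using \<G> unfolding simplicial_complex_def by blast
  moreover have "facets ?\<Gamma> \<subseteq> facets \<Delta>" using \<G> by (simp only: fac)
  ultimately have "\<exists>F. leaf ?\<Gamma> F" using assms by (simp only: simplicial_forest_def)
  then obtain F where "leaf ?\<Gamma> F" ..
  then show "\<exists>F\<in>\<G>. \<G> = {F} \<or> (\<exists>G\<in>\<G>. G \<noteq> F \<and> (\<forall>H\<in>\<G>. H \<noteq> F \<longrightarrow> F \<inter> H \<subseteq> F \<inter> G))"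
    unfolding leaf_def fac by (elim conjE) (rule bexI)
qed


section \<open>Products of monomial primes and free vertices\<close>

definition vsum :: "nat \<Rightarrow> (nat \<Rightarrow> 'n) \<Rightarrow> 'n \<Rightarrow>\<^sub>0 nat" where
  "vsum r a = (\<Sum>j<r. single (a j) 1)"

lemma lookup_vsum: "lookup (vsum r a) v = card {j. j < r \<and> a j = v}"
proof -
  have "lookup (vsum r a) v = (\<Sum>j<r. if a j = v then 1 else 0)"
    unfolding vsum_def lookup_sum by (intro sum.cong) (auto simp: lookup_single when_def)
  then show ?thesis by (simp add: sum.If_cases Int_def)
qed

lemma keys_vsum: "keys (vsum r a) = a ` {..<r}"
  by (auto simp: in_keys_iff lookup_vsum)

lemma mem_prod_up_vsum: "m \<in> prod_up A r \<longleftrightarrow> (\<exists>a q. (\<forall>j<r. a j \<in> A j) \<and> m = vsum r a + q)"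
  by (simp add: mem_prod_up vsum_def)

lemma vsum_in_prod_up: "\<forall>j<r. a j \<in> A j \<Longrightarrow> vsum r a \<in> prod_up A r"
  unfolding mem_prod_up_vsum by (intro exI[of _ a] exI[of _ 0]) simp

lemma ind_in_fam_up: "F \<in> \<F> \<Longrightarrow> ind F \<in> fam_up \<F>"
  by (auto simp: fam_up_def)

text \<open>All factors except the one with index \<open>i0\<close> have at most one variable. By
  minimality, a facet is a choice of one variable from each factor, so two facets differ only at
  \<open>i0\<close>, and the vertex chosen there is private.\<close>

lemma product_free_vertices:
  assumes "product_at_most_one_nonprincipal (facet_ideal \<Gamma> :: ('n::finite, 'k::field) mpoly set)"
  shows "free_vertices (facets \<Gamma>)"
proof -
  obtain r and A :: "nat \<Rightarrow> 'n set" where r: "r > 0"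
    and eq: "facet_ideal \<Gamma> = (\<Otimes>\<^bsub>poly_ideals\<^esub> j \<in> {..<r}. monomial_prime (A j) :: ('n, 'k) mpoly set)"
    and np: "card {j. j < r \<and> \<not> principalideal (monomial_prime (A j) :: ('n, 'k) mpoly set) poly_ring} \<le> 1"
    using assms unfolding product_at_most_one_nonprincipal_def by blast
  have up: "fam_up (facets \<Gamma>) = prod_up A r"
    using eq unfolding facet_ideal_eq finprod_monomial_prime by (simp only: mono_ideal_inject)
  let ?NP = "{j. j < r \<and> \<not> principalideal (monomial_prime (A j) :: ('n, 'k) mpoly set) poly_ring}"
  have "\<exists>i0<r. ?NP \<subseteq> {i0}"
  proof (cases "?NP = {}")
    case False
    then have "card ?NP > 0" by (subst card_gt_0_iff) simp
    then have "card ?NP = 1" using np by linarith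
    then obtain i0 where "?NP = {i0}" by (auto simp: card_1_singleton_iff)
    moreover then have "i0 < r" by blast
    ultimately show ?thesis by blast
  qed (use r in auto)
  then obtain i0 where i0: "i0 < r" "?NP \<subseteq> {i0}" by blast
  have single: "x = y" if "j < r" "j \<noteq> i0" "x \<in> A j" "y \<in> A j" for j x y
    using principal_monomial_prime_card[OF _ that(3,4), where 'k = 'k] that(1,2) i0(2) by blast
  have facet: "\<exists>a. (\<forall>j<r. a j \<in> A j) \<and> F = a ` {..<r} \<and> inj_on a {..<r}" if F: "F \<in> facets \<Gamma>" for F
  proof -
    have "ind F \<in> prod_up A r" using ind_in_fam_up[OF F] up by simp
    then obtain a q where a: "\<forall>j<r. a j \<in> A j" "ind F = vsum r a + q" by (auto simp: mem_prod_up_vsum)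
    have "vsum r a \<in> fam_up (facets \<Gamma>)" using vsum_in_prod_up[OF a(1)] up by simp
    then obtain F' where F': "F' \<in> facets \<Gamma>" "F' \<subseteq> a ` {..<r}" by (auto simp: fam_up_def keys_vsum)
    have "keys (ind F) = keys (vsum r a + q)" using a(2) by simp
    then have sub: "a ` {..<r} \<subseteq> F" by (auto simp: keys_add_nat keys_vsum)
    then have "F' = F" using facets_antichain[OF F'(1) F] F'(2) by blast
    then have "F = a ` {..<r}" using F'(2) sub by blast
    moreover have "inj_on a {..<r}"
    proof (rule inj_onI, rule ccontr)
      fix i j assume ij: "i \<in> {..<r}" "j \<in> {..<r}" "a i = a j" "i \<noteq> j"
      have "card {i, j} \<le> card {l. l < r \<and> a l = a i}" using ij by (intro card_mono) auto
      then have "2 \<le> lookup (ind F) (a i)" using ij(4) by (simp add: a(2) lookup_add lookup_vsum)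
      then show False by (simp add: lookup_ind split: if_splits)
    qed
    ultimately show ?thesis using a(1) by blast
  qed
  show ?thesis
    unfolding free_vertices_def
  proof
    fix F assume "F \<in> facets \<Gamma>"
    then obtain a where a: "\<forall>j<r. a j \<in> A j" "F = a ` {..<r}" "inj_on a {..<r}" using facet by blast
    have "a i0 \<notin> H" if H: "H \<in> facets \<Gamma>" "H \<noteq> F" for H
    proof
      assume "a i0 \<in> H"
      obtain b where b: "\<forall>j<r. b j \<in> A j" "H = b ` {..<r}" using facet[OF H(1)] by blast
      have same: "b j = a j" if "j < r" "j \<noteq> i0" for j using single[OF that] a(1) b(1) that(1) by blast
      obtain j where j: "j < r" "a i0 = b j" using \<open>a i0 \<in> H\<close> b(2) by blast
      have "j = i0"
      proof (rule ccontr)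
        assume "j \<noteq> i0"
        then have "a j = a i0" using same j by simp
        then show False using inj_onD[OF a(3), of j i0] j i0 \<open>j \<noteq> i0\<close> by simp
      qed
      then have "b l = a l" if "l < r" for l using same that j by (cases "l = i0") auto
      then have "H = F" unfolding a(2) b(2) by (intro image_cong) auto
      then show False using H(2) by simp
    qed
    then show "\<exists>v\<in>F. \<forall>H\<in>facets \<Gamma>. H \<noteq> F \<longrightarrow> v \<notin> H" using a(2) i0(1) by blast
  qed
qed

text \<open>If two factors of some nonzero \<open>J j\<close> had two variables each, four facets
  would form a square without a leaf. So facets from the same \<open>j\<close> differ in one factor
  only. Facets from different \<open>j\<close> cannot meet, since they lie in disjoint sets of
  variables.\<close>

lemma class_C_free_vertices:
  assumes "(facet_ideal \<Delta> :: ('n::finite, 'k::field) mpoly set) \<in> class_C"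
    and "hereditary_leaves (facets \<Delta>)" "{} \<notin> facets \<Delta>"
  shows "free_vertices (facets \<Delta>)"
proof -
  obtain k :: nat and J :: "nat \<Rightarrow> ('n, 'k) mpoly set" and V where
    V: "disjoint_family_on V {..<k}"
    and J: "\<forall>j<k. ideal_in_vars (V j) (J j) \<and> product_disjoint_monomial_primes (J j)"
    and sum: "facet_ideal \<Delta> = (\<Oplus>\<^bsub>poly_ideals\<^esub> j \<in> {..<k}. J j)"
    using assms(1) unfolding class_C_def by blast
  have "\<forall>j\<in>{..<k}. \<exists>rA. fst rA > 0 \<and> disjoint_family_on (snd rA) {..<fst rA} \<and> J j = mono_ideal (prod_up (snd rA) (fst rA))"
  proof
    fix j assume "j \<in> {..<k}"
    then obtain r A where "r > 0" "disjoint_family_on A {..<r}" "J j = mono_ideal (prod_up A r)"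
      using J unfolding product_disjoint_monomial_primes_def finprod_monomial_prime by blast
    then show "\<exists>rA. fst rA > 0 \<and> disjoint_family_on (snd rA) {..<fst rA} \<and> J j = mono_ideal (prod_up (snd rA) (fst rA))"
      by (intro exI[of _ "(r, A)"]) simp
  qed
  from bchoice[OF this] obtain rA where rA: "\<And>j. j < k \<Longrightarrow> fst (rA j) > 0 \<and>
      disjoint_family_on (snd (rA j)) {..<fst (rA j)} \<and> J j = mono_ideal (prod_up (snd (rA j)) (fst (rA j)))" by auto
  define r where "r j = fst (rA j)" for j
  define A where "A j = snd (rA j)" for j
  have r: "r j > 0" and disj: "\<And>i i' x. i < r j \<Longrightarrow> i' < r j \<Longrightarrow> x \<in> A j i \<Longrightarrow> x \<in> A j i' \<Longrightarrow> i = i'"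
    and Jj: "J j = mono_ideal (prod_up (A j) (r j))" if "j < k" for j
    using rA[OF that] by (auto simp: r_def A_def disjoint_family_on_def)
  have "(\<Oplus>\<^bsub>poly_ideals\<^esub> j \<in> {..<k}. J j) = mono_ideal (\<Union>j<k. prod_up (A j) (r j))"
    by (rule finsum_mono_ideal) (simp_all add: Jj)
  then have up: "fam_up (facets \<Delta>) = (\<Union>j<k. prod_up (A j) (r j))"
    using sum unfolding facet_ideal_eq by (simp only: mono_ideal_inject)
  define trans where "trans j a \<longleftrightarrow> (\<forall>i<r j. a i \<in> A j i)" for j and a :: "nat \<Rightarrow> 'n"
  have sub_eq: "\<forall>i<r j. b i = a i"
    if ab: "j < k" "trans j a" "trans j b" "b ` {..<r j} \<subseteq> a ` {..<r j}" for j a b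
  proof (intro allI impI)
    fix i assume i: "i < r j"
    then obtain i' where i': "i' < r j" "b i = a i'" using ab(4) by blast
    have "b i \<in> A j i" using ab(3) i by (simp add: trans_def)
    moreover have "b i \<in> A j i'" using ab(2) i' by (simp add: trans_def)
    ultimately have "i = i'" by (rule disj[OF ab(1) i i'(1)])
    then show "b i = a i" using i' by simp
  qed
  \<comment> \<open>A monomial of the ideal on \<open>V j\<close> that divides the transversal is
    itself a multiple of a transversal. By \<open>sub_eq\<close> the two transversals
    coincide.\<close>
  have in_V: "a ` {..<r j} \<subseteq> V j" if j: "j < k" and a: "trans j a" for j a
  proof -
    have "ideal_in_vars (V j) (mono_ideal (prod_up (A j) (r j)) :: ('n, 'k) mpoly set)" using J j Jj by metis
    moreover have "vsum (r j) a \<in> prod_up (A j) (r j)" using a by (intro vsum_in_prod_up) (simp add: trans_def)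
    ultimately obtain m q where m: "m \<in> prod_up (A j) (r j)" "keys m \<subseteq> V j" "vsum (r j) a = m + q"
      using ideal_in_vars_mono_ideal by blast
    obtain b q' where b: "trans j b" "m = vsum (r j) b + q'" using m(1) by (auto simp: mem_prod_up_vsum trans_def)
    have "keys (vsum (r j) a) = keys (vsum (r j) b + q' + q)" using m(3) b(2) by simp
    then have "b ` {..<r j} \<subseteq> a ` {..<r j}" by (auto simp: keys_vsum keys_add_nat)
    then have "\<forall>i<r j. b i = a i" by (rule sub_eq[OF j a b(1)])
    then have "a ` {..<r j} = b ` {..<r j}" by (intro image_cong) auto
    also have "\<dots> \<subseteq> V j" using m(2) b(2) by (auto simp: keys_vsum keys_add_nat)
    finally show ?thesis .
  qed
  have facet: "\<exists>j<k. \<exists>a. trans j a \<and> F = a ` {..<r j}" if F: "F \<in> facets \<Delta>" for F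
  proof -
    have "ind F \<in> (\<Union>j<k. prod_up (A j) (r j))" using ind_in_fam_up[OF F] up by simp
    then obtain j a q where a: "j < k" "trans j a" "ind F = vsum (r j) a + q"
      by (auto simp: mem_prod_up_vsum trans_def)
    have "vsum (r j) a \<in> fam_up (facets \<Delta>)"
      using a vsum_in_prod_up[of "r j" a "A j"] unfolding up trans_def by blast
    then obtain F' where F': "F' \<in> facets \<Delta>" "F' \<subseteq> a ` {..<r j}" by (auto simp: fam_up_def keys_vsum)
    have "keys (ind F) = keys (vsum (r j) a + q)" using a(3) by simp
    then have sub: "a ` {..<r j} \<subseteq> F" by (auto simp: keys_add_nat keys_vsum)
    then have "F' = F" using facets_antichain[OF F'(1) F] F'(2) by blast
    then show ?thesis using F'(2) sub a by blast
  qed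
  have trans_facet: "a ` {..<r j} \<in> facets \<Delta>" if j: "j < k" and a: "trans j a" for j a
  proof -
    have "vsum (r j) a \<in> fam_up (facets \<Delta>)"
      using j a vsum_in_prod_up[of "r j" a "A j"] unfolding up trans_def by blast
    then obtain F where F: "F \<in> facets \<Delta>" "F \<subseteq> a ` {..<r j}" by (auto simp: fam_up_def keys_vsum)
    obtain j' b where b: "j' < k" "trans j' b" "F = b ` {..<r j'}" using facet[OF F(1)] by blast
    \<comment> \<open>The facet has an element since \<open>r j'\<close> is positive; as it lies in
      both \<open>V j\<close> and \<open>V j'\<close>, the indices agree.\<close>
    have "b 0 \<in> F" using b(3) r[OF b(1)] by blast
    then have "b 0 \<in> V j" "b 0 \<in> V j'" using in_V[OF j a] in_V[OF b(1,2)] F(2) b(3) by blast+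
    then have "j' = j" using V j b(1) by (auto simp: disjoint_family_on_def)
    then have "\<forall>i<r j. b i = a i" using sub_eq[OF j a] b F(2) by simp
    then have "F = a ` {..<r j}" unfolding b(3) \<open>j' = j\<close> by (intro image_cong) auto
    then show ?thesis using F(1) by simp
  qed
  have one_big: "\<exists>i0<r j. \<forall>i<r j. i \<noteq> i0 \<longrightarrow> (\<forall>x\<in>A j i. \<forall>y\<in>A j i. x = y)" if j: "j < k" and a: "trans j a" for j a
  proof (rule ccontr)
    assume no: "\<not> ?thesis"
    then obtain i x x' where i: "i < r j" "x \<in> A j i" "x' \<in> A j i" "x \<noteq> x'" using r[OF j] by blast
    obtain i' y y' where i': "i' < r j" "i' \<noteq> i" "y \<in> A j i'" "y' \<in> A j i'" "y \<noteq> y'" using no i(1) by blast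
    define T where "T s t = (a(i := s, i' := t)) ` {..<r j}" for s t
    have tr: "trans j (a(i := s, i' := t))" if "s \<in> A j i" "t \<in> A j i'" for s t
      using a that by (simp add: trans_def)
    have T_s: "z \<in> T s t \<longleftrightarrow> z = s" if "z \<in> A j i" "s \<in> A j i" "t \<in> A j i'" for z s t
    proof
      assume "z \<in> T s t"
      then obtain l where l: "l < r j" "z = (a(i := s, i' := t)) l" by (auto simp: T_def)
      have "z \<in> A j l" using tr[OF that(2,3)] l unfolding trans_def by metis
      then have "l = i" using that(1) by (rule disj[OF j l(1) i(1)])
      then show "z = s" using l i' by simp
    next
      assume "z = s"
      then show "z \<in> T s t" using i i' by (auto simp: T_def image_iff intro!: bexI[of _ i])
    qed
    have T_t: "z \<in> T s t \<longleftrightarrow> z = t" if "z \<in> A j i'" "s \<in> A j i" "t \<in> A j i'" for z s t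
    proof
      assume "z \<in> T s t"
      then obtain l where l: "l < r j" "z = (a(i := s, i' := t)) l" by (auto simp: T_def)
      have "z \<in> A j l" using tr[OF that(2,3)] l unfolding trans_def by metis
      then have "l = i'" using that(1) by (rule disj[OF j l(1) i'(1)])
      then show "z = t" using l i' by simp
    next
      assume "z = t"
      then show "z \<in> T s t" using i i' by (auto simp: T_def image_iff intro!: bexI[of _ i'])
    qed
    define \<G> where "\<G> = {T s t | s t. s \<in> {x, x'} \<and> t \<in> {y, y'}}"
    have "\<G> \<subseteq> facets \<Delta>"
    proof
      fix H assume "H \<in> \<G>"
      then obtain s t where "s \<in> A j i" "t \<in> A j i'" "H = T s t" using i i' by (auto simp: \<G>_def)
      then show "H \<in> facets \<Delta>" using trans_facet[OF j tr] by (simp add: T_def)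
    qed
    moreover have "\<G> \<noteq> {}" by (auto simp: \<G>_def)
    ultimately obtain F where F: "F \<in> \<G>"
      "\<G> = {F} \<or> (\<exists>G\<in>\<G>. G \<noteq> F \<and> (\<forall>H\<in>\<G>. H \<noteq> F \<longrightarrow> F \<inter> H \<subseteq> F \<inter> G))"
      using assms(2)[unfolded hereditary_leaves_def, rule_format, of \<G>] by blast
    obtain s t where st: "s \<in> {x, x'}" "t \<in> {y, y'}" "F = T s t" using F(1) by (auto simp: \<G>_def)
    obtain s' where s': "s' \<in> {x, x'}" "s' \<noteq> s" using st(1) i(4) by auto
    obtain t' where t': "t' \<in> {y, y'}" "t' \<noteq> t" using st(2) i'(5) by auto
    have mem: "s \<in> A j i" "s' \<in> A j i" "t \<in> A j i'" "t' \<in> A j i'" using st s' t' i i' by auto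
    \<comment> \<open>\<open>F\<close> shares \<open>t\<close> with \<open>T s' t\<close> and
      \<open>s\<close> with \<open>T s t'\<close>. A member \<open>G\<close> as in the leaf
      condition would contain both \<open>s\<close> and \<open>t\<close> and would thus be
      \<open>F\<close> itself.\<close>
    have H1: "T s' t \<in> \<G>" "T s' t \<noteq> F" "t \<in> F \<inter> T s' t"
      using st s' T_s[OF mem(1,2,3)] T_s[OF mem(1,1,3)] T_t[OF mem(3,1,3)] T_t[OF mem(3,2,3)] by (auto simp: \<G>_def)
    have H2: "T s t' \<in> \<G>" "T s t' \<noteq> F" "s \<in> F \<inter> T s t'"
      using st t' T_t[OF mem(3,1,4)] T_t[OF mem(3,1,3)] T_s[OF mem(1,1,3)] T_s[OF mem(1,1,4)] by (auto simp: \<G>_def)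
    have "\<G> \<noteq> {F}" using H1 by blast
    then obtain G where G: "G \<in> \<G>" "G \<noteq> F" "\<And>H. H \<in> \<G> \<Longrightarrow> H \<noteq> F \<Longrightarrow> F \<inter> H \<subseteq> F \<inter> G" using F(2) by blast
    have in_G: "s \<in> G" "t \<in> G" using G(3)[OF H1(1,2)] G(3)[OF H2(1,2)] H1(3) H2(3) by blast+
    obtain s2 t2 where g: "s2 \<in> A j i" "t2 \<in> A j i'" "G = T s2 t2" using G(1) i i' by (auto simp: \<G>_def)
    have "s = s2" "t = t2" using in_G g T_s[OF mem(1) g(1,2)] T_t[OF mem(3) g(1,2)] by auto
    then show False using G(2) g(3) st(3) by simp
  qed
  show ?thesis
    unfolding free_vertices_def
  proof
    fix F assume "F \<in> facets \<Delta>"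
    then obtain j a where a: "j < k" "trans j a" "F = a ` {..<r j}" using facet by blast
    obtain i0 where i0: "i0 < r j" "\<And>i x y. i < r j \<Longrightarrow> i \<noteq> i0 \<Longrightarrow> x \<in> A j i \<Longrightarrow> y \<in> A j i \<Longrightarrow> x = y"
      using one_big[OF a(1,2)] by blast
    have "a i0 \<notin> H" if H: "H \<in> facets \<Delta>" "H \<noteq> F" for H
    proof
      assume aH: "a i0 \<in> H"
      obtain j' b where b: "j' < k" "trans j' b" "H = b ` {..<r j'}" using facet[OF H(1)] by blast
      have "a i0 \<in> V j" "a i0 \<in> V j'" using in_V[OF a(1,2)] in_V[OF b(1,2)] aH b(3) i0(1) by blast+
      then have jj: "j' = j" using V a(1) b(1) by (auto simp: disjoint_family_on_def)
      obtain l where l: "l < r j" "a i0 = b l" using aH b(3) jj by blast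
      have "a i0 \<in> A j l" using b(2) l jj by (simp add: trans_def)
      moreover have "a i0 \<in> A j i0" using a(2) i0(1) by (simp add: trans_def)
      ultimately have "l = i0" by (rule disj[OF a(1) l(1) i0(1)])
      then have "b i = a i" if "i < r j" for i
        using i0(2)[OF that, of "b i" "a i"] a(2) b(2) that l jj by (cases "i = i0") (auto simp: trans_def)
      then have "H = F" unfolding a(3) b(3) jj by (intro image_cong) auto
      then show False using H(2) by simp
    qed
    then show "\<exists>v\<in>F. \<forall>H\<in>facets \<Delta>. H \<noteq> F \<longrightarrow> v \<notin> H" using a(3) i0(1) by blast
  qed
qed


section \<open>Pure forests with components connected in codimension one\<close>

lemma filter_sum_replicate:
  assumes "finite \<A>"
  shows "size {#F \<in># (\<Sum>F\<in>\<A>. replicate_mset (n F) F). P F#} = (\<Sum>F\<in>\<A>. if P F then n F else 0)"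
proof -
  have "filter_mset P (replicate_mset k F) = (if P F then replicate_mset k F else {#})" for k F
    by (induction k) auto
  note this [simp]
  show ?thesis using assms by (induction \<A> rule: finite_induct) auto
qed

lemma set_mset_sum_replicate:
  assumes "finite \<A>"
  shows "set_mset (\<Sum>F\<in>\<A>. replicate_mset (n F) F) \<subseteq> \<A>"
  using assms by (induction \<A> rule: finite_induct) auto

locale pure_forest =
  fixes \<Delta> :: "'n::finite set set" and d :: nat
  assumes forest: "simplicial_forest \<Delta>" and nontrivial: "\<Delta> \<noteq> {{}}"
    and card_facet: "\<And>F. F \<in> facets \<Delta> \<Longrightarrow> card F = Suc d"
    and codim_one: "\<And>\<Gamma>. \<Gamma> \<in> complex_components \<Delta> \<Longrightarrow> connected_in_codim_one \<Gamma>"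
begin

lemma sc: "simplicial_complex \<Delta>"
  using forest by (simp add: simplicial_forest_def)

lemma facets_component_subset: "\<Gamma> \<in> complex_components \<Delta> \<Longrightarrow> facets \<Gamma> \<subseteq> facets \<Delta>"
  using Union_facets_components[OF sc nontrivial] by blast

lemma empty_not_facet: "{} \<notin> facets \<Delta>"
  using facets_nonempty[OF sc nontrivial] by blast

lemma ridge_connected_component:
  assumes "\<Gamma> \<in> complex_components \<Delta>"
  shows "ridge_connected d (facets \<Gamma>)"
proof (rule connected_in_codim_one_ridge_connected[OF codim_one[OF assms]])
  show "card F = Suc d" if "F \<in> facets \<Gamma>" for F using card_facet facets_component_subset[OF assms] that by blast
  show "\<Gamma> \<noteq> {}" using component_facets_nonempty[OF sc nontrivial assms] by (auto simp: facets_def)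
qed

lemma hereditary_leaves_component:
  assumes "\<Gamma> \<in> complex_components \<Delta>"
  shows "hereditary_leaves (facets \<Gamma>)"
  unfolding hereditary_leaves_def
proof (intro allI impI, elim conjE)
  fix \<G> assume "\<G> \<subseteq> facets \<Gamma>" "\<G> \<noteq> {}"
  then show "\<exists>F\<in>\<G>. \<G> = {F} \<or> (\<exists>G\<in>\<G>. G \<noteq> F \<and> (\<forall>H\<in>\<G>. H \<noteq> F \<longrightarrow> F \<inter> H \<subseteq> F \<inter> G))"
    using simplicial_forest_hereditary_leaves[OF forest, unfolded hereditary_leaves_def, rule_format, of \<G>]
      facets_component_subset[OF assms] by blast
qed

text \<open>A vertex lies in facets of only one component, so a vertex private within its component
  is private in \<open>\<Delta>\<close>.\<close>

lemma free_vertices_components: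
  assumes "\<And>\<Gamma>. \<Gamma> \<in> complex_components \<Delta> \<Longrightarrow> free_vertices (facets \<Gamma>)"
  shows "free_vertices (facets \<Delta>)"
  unfolding free_vertices_def
proof
  fix F assume "F \<in> facets \<Delta>"
  then obtain \<Gamma> where \<Gamma>: "\<Gamma> \<in> complex_components \<Delta>" "F \<in> facets \<Gamma>"
    using Union_facets_components[OF sc nontrivial] by blast
  then obtain v where v: "v \<in> F" "\<And>H. H \<in> facets \<Gamma> \<Longrightarrow> H \<noteq> F \<Longrightarrow> v \<notin> H"
    using bspec[OF assms[OF \<Gamma>(1), unfolded free_vertices_def] \<Gamma>(2)] by auto
  have "v \<notin> H" if H: "H \<in> facets \<Delta>" "H \<noteq> F" for H
  proof
    assume vH: "v \<in> H"
    obtain \<Gamma>' where \<Gamma>': "\<Gamma>' \<in> complex_components \<Delta>" "H \<in> facets \<Gamma>'"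
      using H(1) Union_facets_components[OF sc nontrivial] by blast
    have "\<Gamma> = \<Gamma>'" by (rule components_disjoint[OF sc nontrivial \<Gamma>(1) \<Gamma>'(1) \<Gamma>(2) \<Gamma>'(2) v(1) vH])
    then show False using v(2)[of H] \<Gamma>'(2) H(2) vH by simp
  qed
  then show "\<exists>v\<in>F. \<forall>H\<in>facets \<Delta>. H \<noteq> F \<longrightarrow> v \<notin> H" using v(1) by blast
qed

lemma free_vertex_choice:
  assumes "free_vertices (facets \<Delta>)"
  shows "\<exists>v. (\<forall>F\<in>facets \<Delta>. v F \<in> F) \<and> (\<forall>F\<in>facets \<Delta>. \<forall>H\<in>facets \<Delta>. F \<noteq> H \<longrightarrow> v F \<notin> H)"
proof -
  obtain v where "\<forall>F\<in>facets \<Delta>. v F \<in> F \<and> (\<forall>H\<in>facets \<Delta>. H \<noteq> F \<longrightarrow> v F \<notin> H)"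
    using bchoice[OF assms[unfolded free_vertices_def Bex_def]] by blast
  then show ?thesis by (intro exI[of _ v]) auto
qed

lemma component_sunflower:
  assumes v: "\<forall>F\<in>facets \<Delta>. v F \<in> F" "\<forall>F\<in>facets \<Delta>. \<forall>H\<in>facets \<Delta>. F \<noteq> H \<longrightarrow> v F \<notin> H"
    and \<Gamma>: "\<Gamma> \<in> complex_components \<Delta>"
  shows "\<exists>G. (\<forall>F\<in>facets \<Gamma>. F - {v F} = G) \<and> v ` facets \<Gamma> \<inter> G = {}"
proof (rule ridge_connected_sunflower[OF ridge_connected_component[OF \<Gamma>]
    component_facets_nonempty[OF sc nontrivial \<Gamma>]])
  note sub = facets_component_subset[OF \<Gamma>]
  show "v F \<in> F" if "F \<in> facets \<Gamma>" for F using v(1) sub that by blast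
  show "v F \<notin> H" if "F \<in> facets \<Gamma>" "H \<in> facets \<Gamma>" "F \<noteq> H" for F H
    using v(2) subsetD[OF sub that(1)] subsetD[OF sub that(2)] that(3) by blast
qed

lemma component_product:
  assumes "free_vertices (facets \<Delta>)" "\<Gamma> \<in> complex_components \<Delta>"
  shows "product_at_most_one_nonprincipal (facet_ideal \<Gamma> :: ('n, 'k::field) mpoly set) \<and>
    product_disjoint_monomial_primes (facet_ideal \<Gamma> :: ('n, 'k) mpoly set)"
proof -
  obtain v where v: "\<forall>F\<in>facets \<Delta>. v F \<in> F" "\<forall>F\<in>facets \<Delta>. \<forall>H\<in>facets \<Delta>. F \<noteq> H \<longrightarrow> v F \<notin> H"
    using free_vertex_choice[OF assms(1)] by blast
  note sub = facets_component_subset[OF assms(2)]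
  obtain G where G': "\<forall>F\<in>facets \<Gamma>. F - {v F} = G" and G: "v ` facets \<Gamma> \<inter> G = {}"
    using component_sunflower[OF v assms(2)] by (elim exE conjE)
  have F_eq: "F = insert (v F) G" if "F \<in> facets \<Gamma>" for F
  proof -
    have "v F \<in> F" using v(1) subsetD[OF sub that] by blast
    then show ?thesis unfolding bspec[OF G' that, symmetric] by blast
  qed
  have "(\<lambda>x. insert x G) ` v ` facets \<Gamma> = (\<lambda>F. F) ` facets \<Gamma>"
    unfolding image_image by (rule image_cong[OF refl], rule F_eq[symmetric])
  then have up: "fam_up (facets \<Gamma>) = fam_up ((\<lambda>x. insert x G) ` v ` facets \<Gamma>)" by simp
  obtain A where A: "disjoint_family_on A {..<Suc (card G)}"
    "prod_up A (Suc (card G)) = fam_up ((\<lambda>x. insert x G) ` v ` facets \<Gamma>)" "\<forall>j<card G. \<exists>x. A j = {x}"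
    using prod_up_sunflower[OF G] by blast
  have eq: "(facet_ideal \<Gamma> :: ('n, 'k) mpoly set) = (\<Otimes>\<^bsub>poly_ideals\<^esub> j \<in> {..<Suc (card G)}. monomial_prime (A j))"
    unfolding finprod_monomial_prime facet_ideal_eq using up A(2) by simp
  have "{j. j < Suc (card G) \<and> \<not> principalideal (monomial_prime (A j) :: ('n, 'k) mpoly set) poly_ring} \<subseteq> {card G}"
  proof
    fix j assume j: "j \<in> {j. j < Suc (card G) \<and> \<not> principalideal (monomial_prime (A j) :: ('n, 'k) mpoly set) poly_ring}"
    show "j \<in> {card G}"
    proof (rule ccontr)
      assume "j \<notin> {card G}"
      then have "j < card G" using j by simp
      then obtain x where "A j = {x}" using A(3) by blast
      then show False using j principal_monomial_prime_singleton[of x, where 'k = 'k] by simp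
    qed
  qed
  then have "card {j. j < Suc (card G) \<and> \<not> principalideal (monomial_prime (A j) :: ('n, 'k) mpoly set) poly_ring} \<le> card {card G}"
    by (intro card_mono) simp_all
  then have "card {j. j < Suc (card G) \<and> \<not> principalideal (monomial_prime (A j) :: ('n, 'k) mpoly set) poly_ring} \<le> 1" by simp
  then show ?thesis
    unfolding product_at_most_one_nonprincipal_def product_disjoint_monomial_primes_def
    using eq A(1) by (intro conjI exI[of _ "Suc (card G)"] exI[of _ A]) simp_all
qed

lemma b_iff_free:
  "(\<forall>\<Gamma> \<in> complex_components \<Delta>. product_at_most_one_nonprincipal (facet_ideal \<Gamma> :: ('n, 'k::field) mpoly set))
    \<longleftrightarrow> free_vertices (facets \<Delta>)"
  using component_product[where 'k = 'k] free_vertices_components product_free_vertices[where 'k = 'k] by blast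

lemma component_enumeration:
  "\<exists>e :: nat \<Rightarrow> 'n set set. bij_betw e {..<card (complex_components \<Delta>)} (complex_components \<Delta>)"
  using ex_bij_betw_nat_finite[of "complex_components \<Delta>"] by (simp add: atLeast0LessThan)

lemma c_iff_free: "(facet_ideal \<Delta> :: ('n, 'k::field) mpoly set) \<in> class_C \<longleftrightarrow> free_vertices (facets \<Delta>)"
proof
  assume "(facet_ideal \<Delta> :: ('n, 'k) mpoly set) \<in> class_C"
  then show "free_vertices (facets \<Delta>)"
    by (rule class_C_free_vertices[OF _ simplicial_forest_hereditary_leaves[OF forest] empty_not_facet])
next
  assume free: "free_vertices (facets \<Delta>)"
  let ?C = "card (complex_components \<Delta>)"
  obtain e :: "nat \<Rightarrow> 'n set set" where e: "bij_betw e {..<?C} (complex_components \<Delta>)"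
    using component_enumeration by blast
  have e_mem: "e j \<in> complex_components \<Delta>" if "j < ?C" for j using bij_betwE[OF e] that by simp
  have "disjoint_family_on (\<lambda>j. \<Union>(facets (e j))) {..<?C}"
    unfolding disjoint_family_on_def
  proof (intro ballI impI)
    fix i j assume ij: "i \<in> {..<?C}" "j \<in> {..<?C}" "i \<noteq> j"
    show "\<Union>(facets (e i)) \<inter> \<Union>(facets (e j)) = {}"
    proof (rule ccontr)
      assume "\<Union>(facets (e i)) \<inter> \<Union>(facets (e j)) \<noteq> {}"
      then obtain a F F' where "F \<in> facets (e i)" "F' \<in> facets (e j)" "a \<in> F" "a \<in> F'" by blast
      then have "e i = e j" using components_disjoint[OF sc nontrivial e_mem e_mem] ij by auto
      then show False using inj_onD[OF bij_betw_imp_inj_on[OF e]] ij by blast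
    qed
  qed
  moreover have "facet_ideal \<Delta> = (\<Oplus>\<^bsub>poly_ideals\<^esub> j \<in> {..<?C}. facet_ideal (e j) :: ('n, 'k) mpoly set)"
  proof -
    have "facets \<Delta> = (\<Union>\<Gamma>\<in>e ` {..<?C}. facets \<Gamma>)"
      unfolding bij_betw_imp_surj_on[OF e] by (rule Union_facets_components[OF sc nontrivial])
    then have "facets \<Delta> = (\<Union>j<?C. facets (e j))" by simp
    then have "fam_up (facets \<Delta>) = (\<Union>j<?C. fam_up (facets (e j)))" by (auto simp: fam_up_def)
    then show ?thesis by (simp add: finsum_mono_ideal[OF facet_ideal_eq] facet_ideal_eq[of \<Delta>])
  qed
  moreover have "?C > 0" using complex_components_nonempty[OF sc nontrivial] by (simp add: card_gt_0_iff)
  ultimately show "(facet_ideal \<Delta> :: ('n, 'k) mpoly set) \<in> class_C"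
    unfolding class_C_def using component_product[OF free e_mem, where 'k = 'k] ideal_in_vars_facet_ideal[where 'k = 'k and 'n = 'n]
    by (intro CollectI exI[of _ ?C] conjI exI[of _ "\<lambda>j. facet_ideal (e j)"]
        exI[of _ "\<lambda>j. \<Union>(facets (e j))"]) simp_all
qed

end


section \<open>The depth function of a pure forest\<close>

text \<open>Multiplication by the facet monomials with exponents \<open>c F\<close> turns the
  coefficients \<open>m F\<close> into exponents \<open>c F + m F\<close>, which are not negative.
  Their sum exceeds that of the \<open>c F\<close> by 1, the sum of the \<open>m F\<close>.\<close>

lemma combination_in_pow_up:
  fixes \<A> :: "'n::finite set set" and m :: "'n set \<Rightarrow> int"
  assumes "affine_combination \<A> m Y" "\<And>F. F \<in> \<A> \<Longrightarrow> 0 \<le> int (c F) + m F"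
  shows "(\<Sum>F\<in>#(\<Sum>F\<in>\<A>. replicate_mset (c F) F). ind F) + ind Y \<in> pow_up \<A> (Suc (\<Sum>F\<in>\<A>. c F))"
proof -
  define n where "n F = nat (int (c F) + m F)" for F
  let ?M = "\<lambda>c. \<Sum>F\<in>\<A>. replicate_mset (c F) F"
  have n: "int (n F) = int (c F) + m F" if "F \<in> \<A>" for F using assms(2)[OF that] by (simp add: n_def)
  have "int (size (?M n)) = int (\<Sum>F\<in>\<A>. n F)"
    using filter_sum_replicate[of \<A> "\<lambda>_. True" n] by simp
  also have "\<dots> = (\<Sum>F\<in>\<A>. int (c F) + m F)" using n by simp
  also have "\<dots> = int (Suc (\<Sum>F\<in>\<A>. c F))" using assms(1) by (simp add: sum.distrib affine_combination_def)
  finally have size: "size (?M n) = Suc (\<Sum>F\<in>\<A>. c F)" by linarith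
  have "size {#F \<in># ?M n. i \<in> F#} \<le> lookup ((\<Sum>F\<in>#?M c. ind F) + ind Y) i" for i
  proof -
    have "int (size {#F \<in># ?M n. i \<in> F#}) = (\<Sum>F\<in>\<A>. if i \<in> F then int (n F) else 0)"
      by (simp add: filter_sum_replicate if_distrib[of int] cong: if_cong)
    also have "\<dots> = (\<Sum>F\<in>\<A>. (if i \<in> F then int (c F) else 0) + (if i \<in> F then m F else 0))"
      using n by (intro sum.cong) auto
    also have "\<dots> = int (size {#F \<in># ?M c. i \<in> F#}) + (if i \<in> Y then 1 else 0)"
      using assms(1) by (simp add: affine_combination_def sum.distrib filter_sum_replicate if_distrib[of int] cong: if_cong)
    finally show ?thesis by (simp add: lookup_add lookup_sum_mset_ind lookup_ind split: if_splits)
  qed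
  then show ?thesis
    unfolding mem_pow_up using size set_mset_sum_replicate[of \<A> n] by (intro exI[of _ "?M n"]) simp
qed

context pure_forest
begin

abbreviation "C \<equiv> card (complex_components \<Delta>)"

text \<open>The colourings of the components are glued along \<open>cmp\<close>, and combinations
  are extended by 0 to the facets of other components. The vertex counts add up because components
  have disjoint vertex sets.\<close>

lemma colouring_exists:
  "\<exists>cmp \<kappa> G. (\<forall>F\<in>facets \<Delta>. \<exists>p<C. (\<forall>v\<in>F. cmp v = p) \<and> bij_betw \<kappa> F {..d}) \<and>
    (\<forall>p<C. G p \<in> facets \<Delta> \<and> (\<forall>v\<in>G p. cmp v = p)) \<and>
    (\<forall>p<C. \<forall>Y\<subseteq>\<Union>(facets \<Delta>). (\<forall>v\<in>Y. cmp v = p) \<and> bij_betw \<kappa> Y {..d} \<longrightarrow>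
      (\<exists>m. affine_combination (facets \<Delta>) m Y))"
  and card_vertices: "card (\<Union>(facets \<Delta>)) = card (facets \<Delta>) + C * d"
proof -
  obtain e :: "nat \<Rightarrow> 'n set set" where e: "bij_betw e {..<C} (complex_components \<Delta>)"
    using component_enumeration by blast
  have e_mem: "e p \<in> complex_components \<Delta>" if "p < C" for p using bij_betwE[OF e] that by simp
  define \<F> where "\<F> p = facets (e p)" for p
  have facets_eq: "facets \<Delta> = (\<Union>p<C. \<F> p)"
  proof -
    have "facets \<Delta> = (\<Union>\<Gamma>\<in>e ` {..<C}. facets \<Gamma>)"
      unfolding bij_betw_imp_surj_on[OF e] by (rule Union_facets_components[OF sc nontrivial])
    then show ?thesis by (simp add: \<F>_def)
  qed
  have uniq: "p = q" if pq: "p < C" "q < C" "F \<in> \<F> p" "H \<in> \<F> q" "a \<in> F" "a \<in> H" for p q F H a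
  proof -
    have "e p = e q"
      using components_disjoint[OF sc nontrivial e_mem[OF pq(1)] e_mem[OF pq(2)]] pq(3-6) by (simp add: \<F>_def)
    then show ?thesis using inj_onD[OF bij_betw_imp_inj_on[OF e]] pq(1,2) by simp
  qed
  have ne: "\<F> p \<noteq> {}" if "p < C" for p
    using component_facets_nonempty[OF sc nontrivial e_mem[OF that]] by (simp add: \<F>_def)
  define good where "good p \<kappa> \<longleftrightarrow> (\<forall>F\<in>\<F> p. bij_betw \<kappa> F {..d}) \<and> card (\<Union>(\<F> p)) = card (\<F> p) + d \<and>
    (\<forall>Y. Y \<subseteq> \<Union>(\<F> p) \<and> bij_betw \<kappa> Y {..d} \<longrightarrow>
      (\<exists>m. affine_combination (\<F> p) m Y))" for p and \<kappa> :: "'n \<Rightarrow> nat"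
  have "\<forall>p\<in>{..<C}. \<exists>\<kappa>. good p \<kappa>"
  proof
    fix p assume "p \<in> {..<C}"
    then have "p < C" by simp
    show "\<exists>\<kappa>. good p \<kappa>"
      unfolding good_def \<F>_def
      using ne[OF \<open>p < C\<close>] ridge_connected_component[OF e_mem[OF \<open>p < C\<close>]] hereditary_leaves_component[OF e_mem[OF \<open>p < C\<close>]]
      by (intro tree_colouring) (simp_all add: \<F>_def)
  qed
  from bchoice[OF this] obtain \<kappa>s where \<kappa>s: "\<And>p. p < C \<Longrightarrow> good p (\<kappa>s p)" by auto
  define cmp where "cmp v = (THE p. p < C \<and> v \<in> \<Union>(\<F> p))" for v
  have cmp: "cmp v = p" if "p < C" "F \<in> \<F> p" "v \<in> F" for v p F
    unfolding cmp_def
  proof (rule the_equality)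
    show "p < C \<and> v \<in> \<Union>(\<F> p)" using that by blast
    show "q = p" if "q < C \<and> v \<in> \<Union>(\<F> q)" for q
      using that uniq[of q p _ F v] \<open>p < C\<close> \<open>F \<in> \<F> p\<close> \<open>v \<in> F\<close> by blast
  qed
  define \<kappa> where "\<kappa> v = \<kappa>s (cmp v) v" for v
  have same: "bij_betw \<kappa> Y B \<longleftrightarrow> bij_betw (\<kappa>s p) Y B" if "\<And>v. v \<in> Y \<Longrightarrow> cmp v = p" for Y B p
    using that by (intro bij_betw_cong) (simp add: \<kappa>_def)
  define G where "G p = (SOME F. F \<in> \<F> p)" for p
  have G: "G p \<in> \<F> p" if "p < C" for p
    unfolding G_def using ne[OF that] by (auto intro: someI)
  have "\<exists>p<C. (\<forall>v\<in>F. cmp v = p) \<and> bij_betw \<kappa> F {..d}" if F: "F \<in> facets \<Delta>" for F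
  proof -
    obtain p where p: "p < C" "F \<in> \<F> p" using F facets_eq by blast
    have c: "cmp v = p" if "v \<in> F" for v using cmp[OF p that] .
    have "bij_betw (\<kappa>s p) F {..d}" using \<kappa>s[OF p(1)] p(2) by (simp add: good_def)
    then show ?thesis using p(1) c same[OF c] by blast
  qed
  moreover have "G p \<in> facets \<Delta> \<and> (\<forall>v\<in>G p. cmp v = p)" if p: "p < C" for p
    using G[OF p] cmp[OF p G[OF p]] p facets_eq by blast
  moreover have "\<exists>m. affine_combination (facets \<Delta>) m Y"
    if p: "p < C" and Y: "Y \<subseteq> \<Union>(facets \<Delta>)" "\<forall>v\<in>Y. cmp v = p" "bij_betw \<kappa> Y {..d}" for p Y
  proof -
    have "Y \<subseteq> \<Union>(\<F> p)"
    proof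
      fix v assume v: "v \<in> Y"
      then obtain q F where "q < C" "F \<in> \<F> q" "v \<in> F" using Y(1) facets_eq by blast
      moreover then have "q = p" using cmp Y(2) v by blast
      ultimately show "v \<in> \<Union>(\<F> p)" by blast
    qed
    moreover have "bij_betw (\<kappa>s p) Y {..d}" using Y(2,3) same[of Y p] by blast
    ultimately obtain m where m: "affine_combination (\<F> p) m Y"
      using \<kappa>s[OF p] unfolding good_def by blast
    define m' where "m' F = (if F \<in> \<F> p then m F else 0)" for F
    have sub: "\<F> p \<subseteq> facets \<Delta>" using p facets_eq by blast
    have "(\<Sum>F\<in>facets \<Delta>. m' F) = (\<Sum>F\<in>\<F> p. m F)"
      using sub by (intro sum.mono_neutral_cong_right) (auto simp: m'_def)
    moreover have "(\<Sum>F\<in>facets \<Delta>. if v \<in> F then m' F else 0) = (\<Sum>F\<in>\<F> p. if v \<in> F then m F else 0)" for v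
      using sub by (intro sum.mono_neutral_cong_right) (auto simp: m'_def)
    ultimately show ?thesis using m by (intro exI[of _ m']) (simp add: affine_combination_def)
  qed
  ultimately show "\<exists>cmp \<kappa> G. (\<forall>F\<in>facets \<Delta>. \<exists>p<C. (\<forall>v\<in>F. cmp v = p) \<and> bij_betw \<kappa> F {..d}) \<and>
    (\<forall>p<C. G p \<in> facets \<Delta> \<and> (\<forall>v\<in>G p. cmp v = p)) \<and>
    (\<forall>p<C. \<forall>Y\<subseteq>\<Union>(facets \<Delta>). (\<forall>v\<in>Y. cmp v = p) \<and> bij_betw \<kappa> Y {..d} \<longrightarrow>
      (\<exists>m. affine_combination (facets \<Delta>) m Y))"
    by (intro exI[of _ cmp] exI[of _ \<kappa>] exI[of _ G]) simp
  have "card (facets \<Delta>) = (\<Sum>p<C. card (\<F> p))"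
    unfolding facets_eq
  proof (rule card_UN_disjoint)
    show "\<forall>p\<in>{..<C}. \<forall>q\<in>{..<C}. p \<noteq> q \<longrightarrow> \<F> p \<inter> \<F> q = {}"
    proof (intro ballI impI, rule ccontr)
      fix p q assume pq: "p \<in> {..<C}" "q \<in> {..<C}" "p \<noteq> q" "\<F> p \<inter> \<F> q \<noteq> {}"
      then obtain F where F: "F \<in> \<F> p" "F \<in> \<F> q" by blast
      then have "F \<noteq> {}" using empty_not_facet pq(1) facets_eq by auto
      then obtain a where "a \<in> F" by blast
      then show False using uniq[of p q F F a] F pq by simp
    qed
  qed simp_all
  moreover have "card (\<Union>(facets \<Delta>)) = (\<Sum>p<C. card (\<Union>(\<F> p)))"
  proof -
    have "\<Union>(facets \<Delta>) = (\<Union>p<C. \<Union>(\<F> p))" unfolding facets_eq by blast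
    also have "card \<dots> = (\<Sum>p<C. card (\<Union>(\<F> p)))"
    proof (rule card_UN_disjoint)
      show "\<forall>p\<in>{..<C}. \<forall>q\<in>{..<C}. p \<noteq> q \<longrightarrow> \<Union>(\<F> p) \<inter> \<Union>(\<F> q) = {}"
      proof (intro ballI impI, rule ccontr)
        fix p q assume pq: "p \<in> {..<C}" "q \<in> {..<C}" "p \<noteq> q" "\<Union>(\<F> p) \<inter> \<Union>(\<F> q) \<noteq> {}"
        then obtain a F H where "F \<in> \<F> p" "H \<in> \<F> q" "a \<in> F" "a \<in> H" by blast
        then show False using uniq[of p q F H a] pq by simp
      qed
    qed simp_all
    finally show ?thesis .
  qed
  moreover have "(\<Sum>p<C. card (\<Union>(\<F> p))) = (\<Sum>p<C. card (\<F> p) + d)"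
    using \<kappa>s by (intro sum.cong) (simp_all add: good_def)
  ultimately show "card (\<Union>(facets \<Delta>)) = card (facets \<Delta>) + C * d" by (simp add: sum.distrib)
qed

abbreviation "nfacets \<equiv> card (facets \<Delta>)"

text \<open>This identifies the degree of \<open>cocycle\<close> with n - r: each component has
  \<open>d\<close> more vertices than facets.\<close>

lemma card_outside: "card (- \<Union>(facets \<Delta>)) + C * d = card (UNIV :: 'n set) - nfacets" "nfacets \<le> card (UNIV :: 'n set)"
proof -
  have "card (- \<Union>(facets \<Delta>)) = card (UNIV :: 'n set) - card (\<Union>(facets \<Delta>))"
    unfolding Compl_eq_Diff_UNIV by (rule card_Diff_subset) auto
  moreover have "card (\<Union>(facets \<Delta>)) \<le> card (UNIV :: 'n set)" by (rule card_mono) auto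
  ultimately show "card (- \<Union>(facets \<Delta>)) + C * d = card (UNIV :: 'n set) - nfacets" "nfacets \<le> card (UNIV :: 'n set)"
    using card_vertices by simp_all
qed

text \<open>\<open>c\<close> prescribes the exponents of the multiplier \<open>u\<close>. They have
  to clear the negative coefficients of one combination for each \<open>Y\<close>, not of all of
  them.\<close>

lemma depth_power_le:
  assumes c: "\<And>Y m. affine_combination (facets \<Delta>) m Y \<Longrightarrow>
      \<exists>m'. affine_combination (facets \<Delta>) m' Y \<and> (\<forall>F\<in>facets \<Delta>. 0 \<le> int (c F) + m' F)"
  shows "depth_quotient (mono_ideal (pow_up (facets \<Delta>) (Suc (\<Sum>F\<in>facets \<Delta>. c F))) :: ('n, 'k::field) mpoly set)
    \<le> enat (card (UNIV :: 'n set) - nfacets)"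
proof -
  obtain cmp \<kappa> G where facet: "\<forall>F\<in>facets \<Delta>. \<exists>p<C. (\<forall>v\<in>F. cmp v = p) \<and> bij_betw \<kappa> F {..d}"
    and G: "\<forall>p<C. G p \<in> facets \<Delta> \<and> (\<forall>v\<in>G p. cmp v = p)"
    and comb: "\<forall>p<C. \<forall>Y\<subseteq>\<Union>(facets \<Delta>). (\<forall>v\<in>Y. cmp v = p) \<and> bij_betw \<kappa> Y {..d} \<longrightarrow>
      (\<exists>m. affine_combination (facets \<Delta>) m Y)"
    using colouring_exists by (elim exE conjE)
  let ?M = "\<Sum>F\<in>facets \<Delta>. replicate_mset (c F) F"
  interpret coloured_family "facets \<Delta>" cmp \<kappa> C d G ?M "\<Sum>F\<in>facets \<Delta>. c F"
  proof
    show "\<exists>p<C. (\<forall>v\<in>F. cmp v = p) \<and> bij_betw \<kappa> F {..d}" if "F \<in> facets \<Delta>" for F using facet that by blast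
    show "G p \<in> facets \<Delta>" "v \<in> G p \<Longrightarrow> cmp v = p" if "p < C" for p v using G that by blast+
    show "set_mset ?M \<subseteq> facets \<Delta>" by (rule set_mset_sum_replicate) simp
    show "size ?M = (\<Sum>F\<in>facets \<Delta>. c F)" using filter_sum_replicate[of "facets \<Delta>" "\<lambda>_. True" c] by simp
    fix p Y assume Y: "p < C" "Y \<subseteq> \<Union>(facets \<Delta>)" "\<And>v. v \<in> Y \<Longrightarrow> cmp v = p" "bij_betw \<kappa> Y {..d}"
    then obtain m where "affine_combination (facets \<Delta>) m Y" using comb[rule_format, of p Y] by auto
    then obtain m' where m': "affine_combination (facets \<Delta>) m' Y" "\<forall>F\<in>facets \<Delta>. 0 \<le> int (c F) + m' F"
      using c by blast
    show "(\<Sum>F\<in>#?M. ind F) + ind Y \<in> pow_up (facets \<Delta>) (Suc (\<Sum>F\<in>facets \<Delta>. c F))"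
      by (rule combination_in_pow_up[OF m'(1) bspec[OF m'(2)]])
  qed
  show ?thesis using depth_le[where 'k = 'k] unfolding J_def V_def card_outside(1) .
qed

section \<open>Depth with and without private vertices\<close>

lemma pow_up_subset_nonzero: "k > 0 \<Longrightarrow> pow_up (facets \<Delta>) k \<subseteq> - {0}"
proof
  fix m assume k: "k > 0" and "m \<in> pow_up (facets \<Delta>) k"
  then obtain M where M: "set_mset M \<subseteq> facets \<Delta>" "size M = k"
    "\<And>i. size {#F \<in># M. i \<in> F#} \<le> lookup m i" by (auto simp: mem_pow_up)
  obtain F M' where F: "M = add_mset F M'" using M(2) k by (cases M) auto
  then have "F \<noteq> {}" using M(1) empty_not_facet by auto
  then obtain i where "i \<in> F" by blast
  then have "lookup m i \<noteq> 0" using M(3)[of i] F by auto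
  then show "m \<in> - {0}" by auto
qed

lemma fam_up_subset_nonzero: "fam_up (facets \<Delta>) \<subseteq> - {0}"
  using empty_not_facet by (auto simp: fam_up_def)

text \<open>For the upper bound, only \<open>F\<close> contributes at the vertex \<open>v F\<close>,
  so its coefficient is 0 or 1 and the k-th power of any one facet monomial serves as multiplier.
  For the lower bound, facets that meet lie in one component and so in one sunflower, as
  \<open>weakly_regular_pow\<close> requires.\<close>

lemma depth_power_free:
  assumes free: "free_vertices (facets \<Delta>)"
  shows "depth_quotient (mono_ideal (pow_up (facets \<Delta>) (Suc k)) :: ('n, 'k::field) mpoly set) = enat (card (UNIV :: 'n set) - nfacets)"
proof (rule antisym)
  obtain v where v: "\<forall>F\<in>facets \<Delta>. v F \<in> F" "\<forall>F\<in>facets \<Delta>. \<forall>H\<in>facets \<Delta>. F \<noteq> H \<longrightarrow> v F \<notin> H"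
    using free_vertex_choice[OF free] by blast
  obtain \<Gamma> where "\<Gamma> \<in> complex_components \<Delta>" using complex_components_nonempty[OF sc nontrivial] by blast
  then obtain F0 where F0: "F0 \<in> facets \<Delta>"
    using component_facets_nonempty[OF sc nontrivial] facets_component_subset by blast
  define c where "c F = (if F = F0 then k else 0)" for F
  have sum_c: "(\<Sum>F\<in>facets \<Delta>. c F) = k" using F0 by (simp add: c_def)
  have "depth_quotient (mono_ideal (pow_up (facets \<Delta>) (Suc (\<Sum>F\<in>facets \<Delta>. c F))) :: ('n, 'k) mpoly set)
      \<le> enat (card (UNIV :: 'n set) - nfacets)"
  proof (rule depth_power_le)
    fix Y m assume m: "affine_combination (facets \<Delta>) m Y"
    have "0 \<le> m F" if F: "F \<in> facets \<Delta>" for F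
    proof -
      have "(\<Sum>H\<in>facets \<Delta>. if v F \<in> H then m H else 0) = (\<Sum>H\<in>facets \<Delta>. if H = F then m F else 0)"
        using v F by (intro sum.cong) auto
      then have "m F = (if v F \<in> Y then 1 else 0)" using m F by (simp add: affine_combination_def)
      then show ?thesis by simp
    qed
    then show "\<exists>m'. affine_combination (facets \<Delta>) m' Y \<and> (\<forall>F\<in>facets \<Delta>. 0 \<le> int (c F) + m' F)"
      using m by (intro exI[of _ m]) (auto intro: add_nonneg_nonneg)
  qed
  then show "depth_quotient (mono_ideal (pow_up (facets \<Delta>) (Suc k)) :: ('n, 'k) mpoly set) \<le> enat (card (UNIV :: 'n set) - nfacets)"
    unfolding sum_c .
  have sunflower: "F - {v F} = H - {v H} \<or> F \<inter> H = {}" if FH: "F \<in> facets \<Delta>" "H \<in> facets \<Delta>" for F H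
  proof (cases "F \<inter> H = {}")
    case False
    then obtain a where a: "a \<in> F" "a \<in> H" by blast
    obtain \<Gamma> \<Gamma>' where \<Gamma>: "\<Gamma> \<in> complex_components \<Delta>" "F \<in> facets \<Gamma>" "\<Gamma>' \<in> complex_components \<Delta>" "H \<in> facets \<Gamma>'"
      using FH Union_facets_components[OF sc nontrivial] by blast
    have "\<Gamma>' = \<Gamma>" using components_disjoint[OF sc nontrivial \<Gamma>(3,1,4,2) a(2,1)] .
    obtain G where "\<forall>F\<in>facets \<Gamma>. F - {v F} = G"
      using component_sunflower[OF v \<Gamma>(1)] by (elim exE conjE)
    then show ?thesis using \<Gamma>(2,4) \<open>\<Gamma>' = \<Gamma>\<close> by simp
  qed simp
  have "weakly_regular (mono_ideal (pow_up (facets \<Delta>) (Suc k) \<union> fam_up {}) :: ('n, 'k) mpoly set) (esyms (card (UNIV :: 'n set) - nfacets))"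
  proof (rule weakly_regular_pow[where s = nfacets and v = v])
    show "weakly_regular (mono_ideal (fam_up (var_fam A)) :: ('n, 'k) mpoly set) (esyms (card (UNIV :: 'n set) - nfacets))"
      if "card A \<le> nfacets" for A :: "'n set"
      using that card_outside(2) by (intro weakly_regular_esyms_var_fam) simp_all
    show "v F \<notin> H" if "F \<in> facets \<Delta>" "H \<in> facets \<Delta>" "F \<noteq> H" for F H using v(2) that by blast
  qed (use v(1) sunflower in simp_all)
  then have "weakly_regular (mono_ideal (pow_up (facets \<Delta>) (Suc k)) :: ('n, 'k) mpoly set) (esyms (card (UNIV :: 'n set) - nfacets))"
    by (simp add: fam_up_def)
  then have "enat (length (esyms (card (UNIV :: 'n set) - nfacets) :: ('n, 'k) mpoly list)) \<le>
      depth_quotient (mono_ideal (pow_up (facets \<Delta>) (Suc k)) :: ('n, 'k) mpoly set)"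
    using pow_up_subset_nonzero[of "Suc k"]
    by (intro depth_quotient_ge ideal_mono_ideal esyms_subset_max_ideal) (simp_all add: graded_max_ideal_eq mono_ideal_mono)
  then show "enat (card (UNIV :: 'n set) - nfacets) \<le> depth_quotient (mono_ideal (pow_up (facets \<Delta>) (Suc k)) :: ('n, 'k) mpoly set)"
    by (simp add: length_esyms)
qed

lemma depth_power_small:
  "\<exists>k. depth_quotient (mono_ideal (pow_up (facets \<Delta>) (Suc k)) :: ('n, 'k::field) mpoly set) \<le> enat (card (UNIV :: 'n set) - nfacets)"
proof -
  define \<mu> where "\<mu> Y = (SOME m. affine_combination (facets \<Delta>) m Y)" for Y
  define B where "B = (\<Sum>Y\<in>UNIV. \<Sum>F\<in>UNIV. nat \<bar>\<mu> Y F\<bar>)"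
  have B: "0 \<le> int B + \<mu> Y F" for Y F
  proof -
    have "nat \<bar>\<mu> Y F\<bar> \<le> (\<Sum>F\<in>UNIV. nat \<bar>\<mu> Y F\<bar>)" by (rule member_le_sum) auto
    also have "\<dots> \<le> B" unfolding B_def by (rule member_le_sum) auto
    finally show ?thesis by linarith
  qed
  have "depth_quotient (mono_ideal (pow_up (facets \<Delta>) (Suc (\<Sum>F\<in>facets \<Delta>. B))) :: ('n, 'k) mpoly set)
      \<le> enat (card (UNIV :: 'n set) - nfacets)"
  proof (rule depth_power_le)
    fix Y m assume "affine_combination (facets \<Delta>) m Y"
    then have "affine_combination (facets \<Delta>) (\<mu> Y) Y" unfolding \<mu>_def
      by (rule someI[of "\<lambda>m. affine_combination (facets \<Delta>) m Y"])
    then show "\<exists>m'. affine_combination (facets \<Delta>) m' Y \<and> (\<forall>F\<in>facets \<Delta>. 0 \<le> int B + m' F)"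
      using B by blast
  qed
  then show ?thesis by blast
qed

text \<open>A facet without a private vertex is covered by the others. So primes of height at most r
  - 1 suffice, which leaves room for n - r + 1 symmetric polynomials.\<close>

lemma depth_not_free:
  assumes "\<not> free_vertices (facets \<Delta>)"
  shows "enat (Suc (card (UNIV :: 'n set) - nfacets)) \<le> depth_quotient (facet_ideal \<Delta> :: ('n, 'k::field) mpoly set)"
proof -
  obtain F where F: "F \<in> facets \<Delta>" "F \<subseteq> \<Union>(facets \<Delta> - {F})"
    using assms unfolding free_vertices_def by blast
  have "nfacets > 0" using F(1) by (auto simp: card_gt_0_iff)
  then have t: "Suc (card (UNIV :: 'n set) - nfacets) \<le> card (UNIV :: 'n set)" "card (UNIV :: 'n set) - Suc (card (UNIV :: 'n set) - nfacets) = nfacets - 1"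
    using card_outside(2) by simp_all
  have "weakly_regular (mono_ideal (fam_up (facets \<Delta>)) :: ('n, 'k) mpoly set) (esyms (Suc (card (UNIV :: 'n set) - nfacets)))"
  proof (rule weakly_regular_fam_covered[where s = "nfacets - 1", OF _ _ F])
    show "weakly_regular (mono_ideal (fam_up (var_fam A)) :: ('n, 'k) mpoly set) (esyms (Suc (card (UNIV :: 'n set) - nfacets)))"
      if "card A \<le> nfacets - 1" for A :: "'n set"
      using that t by (intro weakly_regular_esyms_var_fam) simp_all
  qed simp
  then have "enat (length (esyms (Suc (card (UNIV :: 'n set) - nfacets)) :: ('n, 'k) mpoly list)) \<le> depth_quotient (facet_ideal \<Delta> :: ('n, 'k) mpoly set)"
    unfolding facet_ideal_eq using fam_up_subset_nonzero
    by (intro depth_quotient_ge ideal_fam_up esyms_subset_max_ideal) (simp_all add: graded_max_ideal_eq mono_ideal_mono)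
  then show ?thesis by (simp add: length_esyms)
qed

lemma a_iff_free: "constant_depth_function (facet_ideal \<Delta> :: ('n, 'k::field) mpoly set) \<longleftrightarrow> free_vertices (facets \<Delta>)"
proof
  assume const: "constant_depth_function (facet_ideal \<Delta> :: ('n, 'k) mpoly set)"
  show "free_vertices (facets \<Delta>)"
  proof (rule ccontr)
    assume nf: "\<not> free_vertices (facets \<Delta>)"
    obtain k where k: "depth_quotient (mono_ideal (pow_up (facets \<Delta>) (Suc k)) :: ('n, 'k) mpoly set) \<le> enat (card (UNIV :: 'n set) - nfacets)"
      using depth_power_small by blast
    have "depth_quotient (facet_ideal \<Delta> :: ('n, 'k) mpoly set) = depth_function (facet_ideal \<Delta> :: ('n, 'k) mpoly set) (Suc k)"
      using const by (simp add: constant_depth_function_def)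
    also have "\<dots> \<le> enat (card (UNIV :: 'n set) - nfacets)" using k by (simp only: depth_function_def facet_ideal_power)
    finally have "enat (Suc (card (UNIV :: 'n set) - nfacets)) \<le> enat (card (UNIV :: 'n set) - nfacets)"
      using depth_not_free[OF nf, where 'k = 'k] by (rule order_trans[rotated])
    then show False by simp
  qed
next
  assume free: "free_vertices (facets \<Delta>)"
  have power: "depth_function (facet_ideal \<Delta> :: ('n, 'k) mpoly set) k = enat (card (UNIV :: 'n set) - nfacets)" if "k \<ge> 1" for k
    using depth_power_free[OF free, of "k - 1", where 'k = 'k] that by (simp add: depth_function_def facet_ideal_power)
  have "facet_ideal \<Delta> [^]\<^bsub>poly_ideals\<^esub> (1::nat) = (facet_ideal \<Delta> :: ('n, 'k) mpoly set)"
    by (rule ideal_monoid.nat_pow_eone) (simp add: ideals_set_simps facet_ideal_eq)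
  then have "depth_quotient (facet_ideal \<Delta> :: ('n, 'k) mpoly set) = enat (card (UNIV :: 'n set) - nfacets)"
    using power[of 1] by (simp add: depth_function_def)
  then show "constant_depth_function (facet_ideal \<Delta> :: ('n, 'k) mpoly set)"
    using power by (simp add: constant_depth_function_def)
qed

end

text \<open>For \<open>\<Delta> = {{}}\<close> the only facet is empty and its monomial is 1, so the
  facet ideal is the whole ring, whereas depth functions belong to proper ideals.\<close>

theorem theorem2p6:
  fixes \<Delta> :: "'n::finite set set"
  assumes "simplicial_forest \<Delta>"
    and "\<Delta> \<noteq> {{}}"
    and "pure_complex \<Delta>"
    and "\<forall>\<Gamma> \<in> complex_components \<Delta>. connected_in_codim_one \<Gamma>"
  shows "(constant_depth_function (facet_ideal \<Delta> :: ('n, 'k::field) mpoly set) \<longleftrightarrow>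
            (\<forall>\<Gamma> \<in> complex_components \<Delta>.
               product_at_most_one_nonprincipal (facet_ideal \<Gamma> :: ('n, 'k) mpoly set))) \<and>
         ((\<forall>\<Gamma> \<in> complex_components \<Delta>.
               product_at_most_one_nonprincipal (facet_ideal \<Gamma> :: ('n, 'k) mpoly set)) \<longleftrightarrow>
            (facet_ideal \<Delta> :: ('n, 'k) mpoly set) \<in> class_C)"
proof -
  have sc: "simplicial_complex \<Delta>" using assms(1) by (simp add: simplicial_forest_def)
  then obtain A where "A \<in> \<Delta>" by (auto simp: simplicial_complex_def)
  then obtain F0 where F0: "F0 \<in> facets \<Delta>" using face_in_facet by blast
  \<comment> \<open>Since facets are nonempty, \<open>card F0 - 1\<close> below is not a truncated
    difference but the dimension of the facets.\<close>
  have "F0 \<noteq> {}" by (rule facets_nonempty[OF sc assms(2) F0])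
  then have "card F0 > 0" by (simp add: card_gt_0_iff)
  have card: "card F = Suc (card F0 - 1)" if "F \<in> facets \<Delta>" for F
  proof -
    have "face_dim F = face_dim F0"
      using bspec[OF bspec[OF assms(3)[unfolded pure_complex_def] that] F0] .
    then show ?thesis using \<open>card F0 > 0\<close> by (simp add: face_dim_def)
  qed
  interpret pure_forest \<Delta> "card F0 - 1"
    by (rule pure_forest.intro[OF assms(1,2) card bspec[OF assms(4)]])
  show ?thesis
    unfolding a_iff_free b_iff_free c_iff_free by simp
qed

end
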